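(* Let $(M=M_1\times_{f_1}M_2,\Pi^{\nu_1},\tilde g^{f_1})$ be a contravariant warped product space. Then the null sectional curvatures of degenerate planes on $M$ satisfy the following relations, where $\epsilon_{l_1}=\tilde g_1(dx_l,dx_l)=\pm1$, $\epsilon_{l_2}=\tilde g_2(dy_l,dy_l)=\pm1$, and throughout $l\ne i$, $l\ne s$. (1) For $i\in\{1,\dots,q_1\}$, $s\in\{q_1+1,\dots,k_1\}$: $$\mathcal K(\xi^{i,h}_{s,h},dx_l^h)=-\tfrac12\mathcal K^M(dx_i^h,dx_l^h)+\tfrac12\mathcal K^M(dx_s^h,dx_l^h)+\epsilon_{l_1}\tilde g^{f_1}(\mathcal R(dx_i^h,dx_l^h)dx_l^h,dx_s^h),$$ $$\mathcal K(\xi^{i,h}_{s,h},f_1^hdy_l^v)=-\tfrac12\mathcal K^M(dx_i^h,dy_l^v)+\tfrac12\mathcal K^M(dx_s^h,dy_l^v)+\epsilon_{l_2}(f_1^h)^2\tilde g^{f_1}(\mathcal R(dx_i^h,dy_l^v)dy_l^v,dx_s^h).$$ (2) For $i\in\{1,\dots,q_1\}$, $s\in\{q_2+1,\dots,k_2\}$: $$\mathcal K(\xi^{i,h}_{s,v},dx_l^h)=-\tfrac12\mathcal K^M(dx_i^h,dx_l^h)+\tfrac12\mathcal K^M(dy_s^v,dx_l^h)+\epsilon_{l_1}f_1^h\,\tilde g^{f_1}(\mathcal R(dx_i^h,dx_l^h)dx_l^h,dy_s^v),$$ $$\mathcal K(\xi^{i,h}_{s,v},f_1^hdy_l^v)=-\tfrac12\mathcal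 K^M(dx_i^h,dy_l^v)+\tfrac12\mathcal K^M(dy_s^v,dy_l^v)+\epsilon_{l_2}(f_1^h)^3\tilde g^{f_1}(\mathcal R(dx_i^h,dy_l^v)dy_l^v,dy_s^v).$$ (3) For $i\in\{1,\dots,q_2\}$, $s\in\{q_1+1,\dots,k_1\}$: $$\mathcal K(\xi^{i,v}_{s,h},dx_l^h)=\tfrac12\mathcal K^M(dx_s^h,dx_l^h)-\tfrac12\mathcal K^M(dy_i^v,dx_l^h)+\epsilon_{l_1}f_1^h\,\tilde g^{f_1}(\mathcal R(dx_s^h,dx_l^h)dx_l^h,dy_i^v),$$ $$\mathcal K(\xi^{i,v}_{s,h},f_1^hdy_l^v)=\tfrac12\mathcal K^M(dx_s^h,dy_l^v)-\tfrac12\mathcal K^M(dy_i^v,dy_l^v)+\epsilon_{l_2}(f_1^h)^3\tilde g^{f_1}(\mathcal R(dx_s^h,dy_l^v)dy_l^v,dy_i^v).$$ (4) For $i\in\{1,\dots,q_2\}$, $s\in\{q_2+1,\dots,k_2\}$: $$\mathcal K(\xi^{i,v}_{s,v},dx_l^h)=-\tfrac12\mathcal K^M(dy_i^v,dx_l^h)+\tfrac12\mathcal K^M(dy_s^v,dx_l^h)+\epsilon_{l_1}(f_1^h)^2\tilde g^{f_1}(\mathcal R(dy_i^v,dx_l^h)dx_l^h,dy_s^v),$$ $$\mathcal K(\xi^{i,v}_{s,v},f_1^hdy_l^v)=-\tfrac12\mathcal K^M(dy_i^v,dy_l^v)+\tfrac12\mathcal K^M(dy_s^v,dy_l^v)+\epsilon_{l_2}(f_1^h)^4\tilde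 g^{f_1}(\mathcal R(dy_i^v,dy_l^v)dy_l^v,dy_s^v).$$
   Context: Everything is smooth. For a bivector field $\Pi$ on a manifold $N$, the sharp map $\sharp_\Pi:T^*N\to TN$ is defined by $\eta(\sharp_\Pi(\omega))=\Pi(\omega,\eta)$, and the bracket on one-forms is $[\omega,\eta]_\Pi=\mathcal L_{\sharp_\Pi(\omega)}\eta-\mathcal L_{\sharp_\Pi(\eta)}\omega-d(\Pi(\omega,\eta))$. $(N,\Pi)$ is a Poisson manifold if the Schouten bracket $[\Pi,\Pi]_S$ vanishes. For a semi-Riemannian metric $\bar g$ on $N$, its cometric $\tilde g$ is the induced metric on $T^*N$. A contravariant connection $\mathcal D$ is an $\mathbb R$-bilinear map on one-forms with $\mathcal D_{f\omega}\eta=f\mathcal D_\omega\eta$ and $\mathcal D_\omega(f\eta)=f\mathcal D_\omega\eta+\sharp_\Pi(\omega)(f)\eta$. The contravariant Levi-Civita connection of $(\tilde g,\Pi)$ is the unique one satisfying $\mathcal D_\omega\eta-\mathcal D_\eta\omega=[\omega,\eta]_\Pi$ and $\sharp_\Pi(\omega)\tilde g(\eta,\gamma)=\tilde g(\mathcal D_\omega\eta,\gamma)+\tilde g(\eta,\mathcal D_\omega\gamma)$. Its curvature is $\mathcal R(\omega,\eta)\gamma=\mathcal D_\omega\mathcal D_\eta\gamma-\mathcal D_\eta\mathcal D_\omega\gamma-\mathcal D_{[\omega,\eta]_\Pi}\gamma$, and the sectional curvature is $$\mathcal K(\omega,\eta)=\frac{\tilde g(\mathcal R(\omega,\eta)\eta,\omega)}{\tilde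 g(\omega,\omega)\tilde g(\eta,\eta)-\tilde g(\omega,\eta)^2}.$$ Contravariant warped product space: for $i=1,2$ let $(M_i,\Pi_i)$ be a Poisson manifold of dimension $k_i$ with semi-Riemannian metric $\bar g_i$ of index $q_i$ and cometric $\tilde g_i$. Let $f_1$ be a positive smooth function and $\nu_1$ a smooth function on $M_1$. Put $M=M_1\times M_2$ with projections $\pi_1,\pi_2$. The superscript $h$ denotes horizontal lift (pull-back by $\pi_1$) and $v$ denotes vertical lift (pull-back by $\pi_2$). $M$ carries the warped metric $\bar g^{f_1}=\pi_1^*\bar g_1+(f_1^h)^2\pi_2^*\bar g_2$, whose cometric is $\tilde g^{f_1}=\tilde g_1^h+\frac1{(f_1^h)^2}\tilde g_2^v$, and the bivector field $\Pi^{\nu_1}=\Pi_1+\nu_1\Pi_2$, i.e. $\Pi^{\nu_1}(\omega_1^h+\omega_2^v,\gamma_1^h+\gamma_2^v)=\Pi_1(\omega_1,\gamma_1)^h+\nu_1^h\Pi_2(\omega_2,\gamma_2)^v$. $\mathcal R$ and $\mathcal K^M$ are the curvature and sectional curvature of the contravariant Levi-Civita connection of $(\tilde g^{f_1},\Pi^{\nu_1})$. Frames: $\{dx_1,\dots,dx_{k_1}\}$ and $\{dy_1,\dots,dy_{k_2}\}$ are local orthonormal bases of one-forms for $\tilde g_1$ and $\tilde g_2$, the first $q_1$ (respectively $q_2$) having square norm $-1$ and the others $+1$, so that $\{dx_1^h,\dots,dx_{k_1}^h,f_1^hdy_1^v,\dots,f_1^hdy_{k_2}^v\}$ is a local $\tilde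 g^{f_1}$-orthonormal basis. The null one-forms are $$\xi^{i,h}_{s,h}=\tfrac1{\sqrt2}(dx_i^h+dx_s^h)\ (i\le q_1,\ s>q_1),\qquad \xi^{i,h}_{s,v}=\tfrac1{\sqrt2}(dx_i^h+f_1^hdy_s^v)\ (i\le q_1,\ s>q_2),$$ $$\xi^{i,v}_{s,h}=\tfrac1{\sqrt2}(f_1^hdy_i^v+dx_s^h)\ (i\le q_2,\ s>q_1),\qquad \xi^{i,v}_{s,v}=\tfrac1{\sqrt2}(f_1^hdy_i^v+f_1^hdy_s^v)\ (i\le q_2,\ s>q_2).$$ For such a null form $\xi$ and a basis form $\theta_l\in\{dx_l^h,\ f_1^hdy_l^v\}$, the null sectional curvature of the degenerate plane spanned by $\xi$ and $\theta_l$ is $$\mathcal K(\xi,\theta_l)=\frac{\tilde g^{f_1}(\mathcal R(\xi,\theta_l)\theta_l,\xi)}{\tilde g^{f_1}(\theta_l,\theta_l)}.$$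
   Formalization: The second formulas of (2) and (3) and both formulas of (4) are proved only when Π^{ν_1} is itself a Poisson bivector on M, since they fail for general ν_1; the other four hold unconditionally; both factors have dimension at least 1. *)

theory Defs
  imports "HOL-Analysis.Analysis"
begin

section \<open>Smooth manifolds\<close>

primrec Ck_on :: "nat \<Rightarrow> ('e::euclidean_space \<Rightarrow> 'f::real_normed_vector) \<Rightarrow> 'e set \<Rightarrow> bool" where
  "Ck_on 0 f S \<longleftrightarrow> continuous_on S f"
| "Ck_on (Suc k) f S \<longleftrightarrow>
     f differentiable_on S \<and> (\<forall>v. Ck_on k (\<lambda>x. frechet_derivative f (at x) v) S)"

definition smooth_on :: "('e::euclidean_space \<Rightarrow> 'f::real_normed_vector) \<Rightarrow> 'e set \<Rightarrow> bool" where
  "smooth_on f S \<longleftrightarrow> (\<forall>k. Ck_on k f S)"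

text \<open>
  A chart is a pair of its domain and its coordinate map into the model space; the dimension of
  the manifold is the dimension of the model space. The selected chart \<open>chart_at M p\<close> around each
  point serves only to identify the tangent space at \<open>p\<close> with the model space; it carries no
  geometric content, and no compatibility between the selections at different points is required.
\<close>

record ('a, 'e) manifold =
  mtop :: "'a topology"
  charts :: "('a set \<times> ('a \<Rightarrow> 'e)) set"
  chart_at :: "'a \<Rightarrow> 'a set \<times> ('a \<Rightarrow> 'e)"

abbreviation points :: "('a, 'e) manifold \<Rightarrow> 'a set" where
  "points M \<equiv> topspace (mtop M)"

definition smooth_manifold :: "('a, 'e::euclidean_space) manifold \<Rightarrow> bool" where
  "smooth_manifold M \<longleftrightarrow>
     Hausdorff_space (mtop M) \<and> second_countable (mtop M) \<and>
     (\<forall>(U, \<phi>) \<in> charts M. openin (mtop M) U \<and> open (\<phi> ` U) \<and>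
        homeomorphic_map (subtopology (mtop M) U) (top_of_set (\<phi> ` U)) \<phi>) \<and>
     (\<forall>(U, \<phi>) \<in> charts M. \<forall>(V, \<psi>) \<in> charts M.
        smooth_on (\<psi> \<circ> inv_into U \<phi>) (\<phi> ` (U \<inter> V))) \<and>
     (\<forall>p \<in> points M. chart_at M p \<in> charts M \<and> p \<in> fst (chart_at M p))"

definition prod_manifold ::
  "('a, 'e) manifold \<Rightarrow> ('b, 'f) manifold \<Rightarrow> ('a \<times> 'b, 'e \<times> 'f) manifold" where
  "prod_manifold M N =
     \<lparr>mtop = prod_topology (mtop M) (mtop N),
      charts = {(U \<times> V, map_prod \<phi> \<psi>) | U \<phi> V \<psi>. (U, \<phi>) \<in> charts M \<and> (V, \<psi>) \<in> charts N},
      chart_at = (\<lambda>(p, q). (fst (chart_at M p) \<times> fst (chart_at N q),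
                            map_prod (snd (chart_at M p)) (snd (chart_at N q))))\<rparr>"

definition coord :: "('a, 'e) manifold \<Rightarrow> 'a \<Rightarrow> 'a \<Rightarrow> 'e" where
  "coord M p = snd (chart_at M p)"

definition inv_coord :: "('a, 'e) manifold \<Rightarrow> 'a \<Rightarrow> 'e \<Rightarrow> 'a" where
  "inv_coord M p = inv_into (fst (chart_at M p)) (coord M p)"

section \<open>Functions, vector fields and one-forms\<close>

text \<open>
  The tangent space at \<open>p\<close> is the model space \<open>'e\<close>, read through the chart \<open>chart_at M p\<close>, and the
  cotangent space is its dual \<open>'e \<Rightarrow>\<^sub>L real\<close>. Sections over an open set \<open>U\<close> are total functions of
  which only the values on \<open>U\<close> matter, so that restriction to a smaller open set is implicit.
\<close>

type_synonym 'e covector = "'e \<Rightarrow>\<^sub>L real"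
type_synonym ('a, 'e) vector_field = "'a \<Rightarrow> 'e"
type_synonym ('a, 'e) one_form = "'a \<Rightarrow> 'e covector"
type_synonym ('a, 'e) metric = "'a \<Rightarrow> 'e \<Rightarrow> 'e \<Rightarrow> real"
type_synonym ('a, 'e) cotensor = "'a \<Rightarrow> 'e covector \<Rightarrow> 'e covector \<Rightarrow> real"

definition smooth_fun ::
  "('a, 'e::euclidean_space) manifold \<Rightarrow> 'a set \<Rightarrow> ('a \<Rightarrow> real) \<Rightarrow> bool" where
  "smooth_fun M U f \<longleftrightarrow> (\<forall>(V, \<phi>) \<in> charts M. smooth_on (f \<circ> inv_into V \<phi>) (\<phi> ` (U \<inter> V)))"

definition tangent_map ::
  "('a, 'e::euclidean_space) manifold \<Rightarrow> ('b, 'f::euclidean_space) manifold \<Rightarrow>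
   ('a \<Rightarrow> 'b) \<Rightarrow> 'a \<Rightarrow> 'e \<Rightarrow> 'f" where
  "tangent_map M N F p = frechet_derivative (coord N (F p) \<circ> F \<circ> inv_coord M p) (at (coord M p p))"

definition ext_d :: "('a, 'e::euclidean_space) manifold \<Rightarrow> ('a \<Rightarrow> real) \<Rightarrow> ('a, 'e) one_form" where
  "ext_d M f p = Blinfun (frechet_derivative (f \<circ> inv_coord M p) (at (coord M p p)))"

definition act :: "('a, 'e::euclidean_space) manifold \<Rightarrow> ('a, 'e) vector_field \<Rightarrow>
    ('a \<Rightarrow> real) \<Rightarrow> 'a \<Rightarrow> real" where
  "act M X f p = blinfun_apply (ext_d M f p) (X p)"

definition smooth_field ::
  "('a, 'e::euclidean_space) manifold \<Rightarrow> 'a set \<Rightarrow> ('a, 'e) vector_field \<Rightarrow> bool" where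
  "smooth_field M U X \<longleftrightarrow>
     (\<forall>V f. openin (mtop M) V \<and> V \<subseteq> U \<and> smooth_fun M V f \<longrightarrow> smooth_fun M V (act M X f))"

definition smooth_form ::
  "('a, 'e::euclidean_space) manifold \<Rightarrow> 'a set \<Rightarrow> ('a, 'e) one_form \<Rightarrow> bool" where
  "smooth_form M U \<omega> \<longleftrightarrow>
     (\<forall>V X. openin (mtop M) V \<and> V \<subseteq> U \<and> smooth_field M V X \<longrightarrow>
        smooth_fun M V (\<lambda>p. blinfun_apply (\<omega> p) (X p)))"

definition lie_bracket :: "('a, 'e::euclidean_space) manifold \<Rightarrow>
    ('a, 'e) vector_field \<Rightarrow> ('a, 'e) vector_field \<Rightarrow> ('a, 'e) vector_field" where
  "lie_bracket M X Y p =
     (THE w. \<forall>U f. openin (mtop M) U \<and> p \<in> U \<and> smooth_fun M U f \<longrightarrow>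
        blinfun_apply (ext_d M f p) w = act M X (act M Y f) p - act M Y (act M X f) p)"

text \<open>The Lie derivative of a one-form, by \<open>(L\<^sub>X \<eta>)(Y) = X(\<eta>(Y)) - \<eta>([X, Y])\<close>.\<close>

definition lie_deriv :: "('a, 'e::euclidean_space) manifold \<Rightarrow>
    ('a, 'e) vector_field \<Rightarrow> ('a, 'e) one_form \<Rightarrow> ('a, 'e) one_form" where
  "lie_deriv M X \<eta> p =
     (THE \<alpha>. \<forall>U Y. openin (mtop M) U \<and> p \<in> U \<and> smooth_field M U Y \<longrightarrow>
        blinfun_apply \<alpha> (Y p) =
          act M X (\<lambda>q. blinfun_apply (\<eta> q) (Y q)) p - blinfun_apply (\<eta> p) (lie_bracket M X Y p))"

definition pullback_form ::
  "('a, 'e::euclidean_space) manifold \<Rightarrow> ('b, 'f::euclidean_space) manifold \<Rightarrow>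
   ('a \<Rightarrow> 'b) \<Rightarrow> ('b, 'f) one_form \<Rightarrow> ('a, 'e) one_form" where
  "pullback_form M N F \<omega> p = Blinfun (\<lambda>u. blinfun_apply (\<omega> (F p)) (tangent_map M N F p u))"

definition pullback_metric ::
  "('a, 'e::euclidean_space) manifold \<Rightarrow> ('b, 'f::euclidean_space) manifold \<Rightarrow>
   ('a \<Rightarrow> 'b) \<Rightarrow> ('b, 'f) metric \<Rightarrow> ('a, 'e) metric" where
  "pullback_metric M N F g p u v = g (F p) (tangent_map M N F p u) (tangent_map M N F p v)"

section \<open>Semi-Riemannian metrics and cometrics\<close>

definition form_index :: "('e::euclidean_space \<Rightarrow> 'e \<Rightarrow> real) \<Rightarrow> nat" where
  "form_index b = Max {dim S | S. subspace S \<and> (\<forall>v \<in> S. v \<noteq> 0 \<longrightarrow> b v v < 0)}"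

definition semi_riemannian ::
  "('a, 'e::euclidean_space) manifold \<Rightarrow> ('a, 'e) metric \<Rightarrow> nat \<Rightarrow> bool" where
  "semi_riemannian M g q \<longleftrightarrow>
     (\<forall>p \<in> points M. bilinear (g p) \<and> (\<forall>u v. g p u v = g p v u) \<and>
        (\<forall>u. (\<forall>v. g p u v = 0) \<longrightarrow> u = 0) \<and> form_index (g p) = q) \<and>
     (\<forall>U X Y. openin (mtop M) U \<and> smooth_field M U X \<and> smooth_field M U Y \<longrightarrow>
        smooth_fun M U (\<lambda>p. g p (X p) (Y p)))"

definition raise :: "('a, 'e::euclidean_space) metric \<Rightarrow> 'a \<Rightarrow> 'e covector \<Rightarrow> 'e" where
  "raise g p \<alpha> = (THE u. \<forall>v. g p u v = blinfun_apply \<alpha> v)"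

definition cometric :: "('a, 'e::euclidean_space) metric \<Rightarrow> ('a, 'e) cotensor" where
  "cometric g p \<alpha> \<beta> = g p (raise g p \<alpha>) (raise g p \<beta>)"

section \<open>Bivector fields and Poisson structures\<close>

definition bivector_field ::
  "('a, 'e::euclidean_space) manifold \<Rightarrow> ('a, 'e) cotensor \<Rightarrow> bool" where
  "bivector_field M P \<longleftrightarrow>
     (\<forall>p \<in> points M. bilinear (P p) \<and> (\<forall>\<alpha> \<beta>. P p \<alpha> \<beta> = - P p \<beta> \<alpha>)) \<and>
     (\<forall>U \<omega> \<eta>. openin (mtop M) U \<and> smooth_form M U \<omega> \<and> smooth_form M U \<eta> \<longrightarrow>
        smooth_fun M U (\<lambda>p. P p (\<omega> p) (\<eta> p)))"

definition sharp :: "('a, 'e::euclidean_space) cotensor \<Rightarrow> ('a, 'e) one_form \<Rightarrow>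
    ('a, 'e) vector_field" where
  "sharp P \<omega> p = (THE w. \<forall>\<eta>. blinfun_apply \<eta> w = P p (\<omega> p) \<eta>)"

definition form_bracket :: "('a, 'e::euclidean_space) manifold \<Rightarrow> ('a, 'e) cotensor \<Rightarrow>
    ('a, 'e) one_form \<Rightarrow> ('a, 'e) one_form \<Rightarrow> ('a, 'e) one_form" where
  "form_bracket M P \<omega> \<eta> p =
     lie_deriv M (sharp P \<omega>) \<eta> p - lie_deriv M (sharp P \<eta>) \<omega> p
       - ext_d M (\<lambda>q. P q (\<omega> q) (\<eta> q)) p"

definition biderivation :: "('a, 'e::euclidean_space) manifold \<Rightarrow> ('a, 'e) cotensor \<Rightarrow>
    ('a \<Rightarrow> real) \<Rightarrow> ('a \<Rightarrow> real) \<Rightarrow> 'a \<Rightarrow> real" where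
  "biderivation M P f g p = P p (ext_d M f p) (ext_d M g p)"

text \<open>
  The Schouten bracket of bivector fields, viewed as a skew-symmetric triderivation
  \<open>(f, g, h) \<mapsto> [P, Q]\<^sub>S(df, dg, dh)\<close>. For multivector fields of degrees \<open>k\<close> and \<open>l\<close> it is
  \<open>P \<circ> Q - (-1)^((k-1)(l-1)) Q \<circ> P\<close>, where \<open>P \<circ> Q\<close> is the signed sum over \<open>(l, k-1)\<close>-shuffles of
  \<open>P\<close> with \<open>Q\<close> inserted into its first argument; for \<open>k = l = 2\<close> the sign is \<open>+\<close>.
\<close>

definition insertion :: "('a, 'e::euclidean_space) manifold \<Rightarrow> ('a, 'e) cotensor \<Rightarrow>
    ('a, 'e) cotensor \<Rightarrow> ('a \<Rightarrow> real) \<Rightarrow> ('a \<Rightarrow> real) \<Rightarrow> ('a \<Rightarrow> real) \<Rightarrow> 'a \<Rightarrow> real" where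
  "insertion M P Q f g h p =
     biderivation M P (biderivation M Q f g) h p
     - biderivation M P (biderivation M Q f h) g p
     + biderivation M P (biderivation M Q g h) f p"

definition schouten :: "('a, 'e::euclidean_space) manifold \<Rightarrow> ('a, 'e) cotensor \<Rightarrow>
    ('a, 'e) cotensor \<Rightarrow> ('a \<Rightarrow> real) \<Rightarrow> ('a \<Rightarrow> real) \<Rightarrow> ('a \<Rightarrow> real) \<Rightarrow> 'a \<Rightarrow> real" where
  "schouten M P Q f g h p = insertion M P Q f g h p + insertion M Q P f g h p"

definition poisson_manifold ::
  "('a, 'e::euclidean_space) manifold \<Rightarrow> ('a, 'e) cotensor \<Rightarrow> bool" where
  "poisson_manifold M P \<longleftrightarrow>
     smooth_manifold M \<and> bivector_field M P \<and>
     (\<forall>U f g h. openin (mtop M) U \<and> smooth_fun M U f \<and> smooth_fun M U g \<and> smooth_fun M U h \<longrightarrow>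
        (\<forall>p \<in> U. schouten M P P f g h p = 0))"

section \<open>Contravariant connections and their curvature\<close>

text \<open>
  A connection acts on one-forms defined on arbitrary open subsets, as is needed to apply it to
  local frames. Since sections are total functions, its compatibility with restriction amounts
  to the last clause.
\<close>

definition contravariant_connection :: "('a, 'e::euclidean_space) manifold \<Rightarrow>
    ('a, 'e) cotensor \<Rightarrow> (('a, 'e) one_form \<Rightarrow> ('a, 'e) one_form \<Rightarrow> ('a, 'e) one_form) \<Rightarrow> bool" where
  "contravariant_connection M P D \<longleftrightarrow>
     (\<forall>U \<omega> \<eta>. openin (mtop M) U \<and> smooth_form M U \<omega> \<and> smooth_form M U \<eta> \<longrightarrow>
        smooth_form M U (D \<omega> \<eta>)) \<and>
     (\<forall>U \<omega> \<omega>' \<eta> a b. openin (mtop M) U \<and> smooth_form M U \<omega> \<and> smooth_form M U \<omega>' \<and>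
          smooth_form M U \<eta> \<longrightarrow>
        (\<forall>p \<in> U. D (\<lambda>q. a *\<^sub>R \<omega> q + b *\<^sub>R \<omega>' q) \<eta> p = a *\<^sub>R D \<omega> \<eta> p + b *\<^sub>R D \<omega>' \<eta> p \<and>
                 D \<eta> (\<lambda>q. a *\<^sub>R \<omega> q + b *\<^sub>R \<omega>' q) p = a *\<^sub>R D \<eta> \<omega> p + b *\<^sub>R D \<eta> \<omega>' p)) \<and>
     (\<forall>U f \<omega> \<eta>. openin (mtop M) U \<and> smooth_fun M U f \<and> smooth_form M U \<omega> \<and>
          smooth_form M U \<eta> \<longrightarrow>
        (\<forall>p \<in> U. D (\<lambda>q. f q *\<^sub>R \<omega> q) \<eta> p = f p *\<^sub>R D \<omega> \<eta> p \<and>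
                 D \<omega> (\<lambda>q. f q *\<^sub>R \<eta> q) p =
                   f p *\<^sub>R D \<omega> \<eta> p + act M (sharp P \<omega>) f p *\<^sub>R \<eta> p)) \<and>
     (\<forall>U \<omega> \<omega>' \<eta> \<eta>'. openin (mtop M) U \<and> smooth_form M U \<omega> \<and> smooth_form M U \<eta> \<and>
          (\<forall>p \<in> U. \<omega>' p = \<omega> p \<and> \<eta>' p = \<eta> p) \<longrightarrow>
        (\<forall>p \<in> U. D \<omega>' \<eta>' p = D \<omega> \<eta> p))"

definition levi_civita :: "('a, 'e::euclidean_space) manifold \<Rightarrow> ('a, 'e) cotensor \<Rightarrow>
    ('a, 'e) cotensor \<Rightarrow> (('a, 'e) one_form \<Rightarrow> ('a, 'e) one_form \<Rightarrow> ('a, 'e) one_form) \<Rightarrow> bool" where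
  "levi_civita M G P D \<longleftrightarrow>
     contravariant_connection M P D \<and>
     (\<forall>U \<omega> \<eta>. openin (mtop M) U \<and> smooth_form M U \<omega> \<and> smooth_form M U \<eta> \<longrightarrow>
        (\<forall>p \<in> U. D \<omega> \<eta> p - D \<eta> \<omega> p = form_bracket M P \<omega> \<eta> p)) \<and>
     (\<forall>U \<omega> \<eta> \<gamma>. openin (mtop M) U \<and> smooth_form M U \<omega> \<and> smooth_form M U \<eta> \<and>
          smooth_form M U \<gamma> \<longrightarrow>
        (\<forall>p \<in> U. act M (sharp P \<omega>) (\<lambda>q. G q (\<eta> q) (\<gamma> q)) p =
                   G p (D \<omega> \<eta> p) (\<gamma> p) + G p (\<eta> p) (D \<omega> \<gamma> p)))"

definition curvature :: "('a, 'e::euclidean_space) manifold \<Rightarrow> ('a, 'e) cotensor \<Rightarrow>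
    (('a, 'e) one_form \<Rightarrow> ('a, 'e) one_form \<Rightarrow> ('a, 'e) one_form) \<Rightarrow>
    ('a, 'e) one_form \<Rightarrow> ('a, 'e) one_form \<Rightarrow> ('a, 'e) one_form \<Rightarrow> ('a, 'e) one_form" where
  "curvature M P D \<omega> \<eta> \<gamma> p =
     D \<omega> (D \<eta> \<gamma>) p - D \<eta> (D \<omega> \<gamma>) p - D (form_bracket M P \<omega> \<eta>) \<gamma> p"

definition sectional :: "('a, 'e::euclidean_space) manifold \<Rightarrow> ('a, 'e) cotensor \<Rightarrow>
    ('a, 'e) cotensor \<Rightarrow> (('a, 'e) one_form \<Rightarrow> ('a, 'e) one_form \<Rightarrow> ('a, 'e) one_form) \<Rightarrow>
    ('a, 'e) one_form \<Rightarrow> ('a, 'e) one_form \<Rightarrow> 'a \<Rightarrow> real" where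
  "sectional M G P D \<omega> \<eta> p =
     G p (curvature M P D \<omega> \<eta> \<eta> p) (\<omega> p) /
     (G p (\<omega> p) (\<omega> p) * G p (\<eta> p) (\<eta> p) - (G p (\<omega> p) (\<eta> p))\<^sup>2)"

definition null_sectional :: "('a, 'e::euclidean_space) manifold \<Rightarrow> ('a, 'e) cotensor \<Rightarrow>
    ('a, 'e) cotensor \<Rightarrow> (('a, 'e) one_form \<Rightarrow> ('a, 'e) one_form \<Rightarrow> ('a, 'e) one_form) \<Rightarrow>
    ('a, 'e) one_form \<Rightarrow> ('a, 'e) one_form \<Rightarrow> 'a \<Rightarrow> real" where
  "null_sectional M G P D \<xi> \<theta> p =
     G p (curvature M P D \<xi> \<theta> \<theta> p) (\<xi> p) / G p (\<theta> p) (\<theta> p)"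

definition null_form :: "('a, 'e::euclidean_space) one_form \<Rightarrow> ('a, 'e) one_form \<Rightarrow>
    ('a, 'e) one_form" where
  "null_form \<alpha> \<beta> p = (1 / sqrt 2) *\<^sub>R (\<alpha> p + \<beta> p)"

definition orthonormal_coframe :: "('a, 'e::euclidean_space) manifold \<Rightarrow> ('a, 'e) metric \<Rightarrow>
    nat \<Rightarrow> 'a set \<Rightarrow> (nat \<Rightarrow> ('a, 'e) one_form) \<Rightarrow> bool" where
  "orthonormal_coframe M g q U e \<longleftrightarrow>
     openin (mtop M) U \<and>
     (\<forall>i \<in> {1..DIM('e)}. smooth_form M U (e i)) \<and>
     (\<forall>i \<in> {1..DIM('e)}. \<forall>j \<in> {1..DIM('e)}. \<forall>p \<in> U.
        cometric g p (e i p) (e j p) = (if i = j then if i \<le> q then - 1 else 1 else 0))"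

section \<open>Contravariant warped products\<close>

definition warped_metric :: "('a, 'e::euclidean_space) manifold \<Rightarrow> ('a, 'e) metric \<Rightarrow>
    ('b, 'f::euclidean_space) manifold \<Rightarrow> ('b, 'f) metric \<Rightarrow> ('a \<Rightarrow> real) \<Rightarrow>
    ('a \<times> 'b, 'e \<times> 'f) metric" where
  "warped_metric M\<^sub>1 g\<^sub>1 M\<^sub>2 g\<^sub>2 f m u v =
     pullback_metric (prod_manifold M\<^sub>1 M\<^sub>2) M\<^sub>1 fst g\<^sub>1 m u v
     + (f (fst m))\<^sup>2 * pullback_metric (prod_manifold M\<^sub>1 M\<^sub>2) M\<^sub>2 snd g\<^sub>2 m u v"

text \<open>
  Every covector of the product at \<open>(p, q)\<close> is uniquely of the form
  \<open>(u, v) \<mapsto> \<alpha>\<^sub>1 u + \<alpha>\<^sub>2 v\<close>; the two components recovered here are the covectors at \<open>p\<close> and \<open>q\<close>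
  whose lifts add up to it.
\<close>

definition hor_part :: "('e::euclidean_space \<times> 'f::euclidean_space) covector \<Rightarrow> 'e covector" where
  "hor_part \<alpha> = Blinfun (\<lambda>u. blinfun_apply \<alpha> (u, 0))"

definition ver_part :: "('e::euclidean_space \<times> 'f::euclidean_space) covector \<Rightarrow> 'f covector" where
  "ver_part \<alpha> = Blinfun (\<lambda>v. blinfun_apply \<alpha> (0, v))"

definition warped_bivector :: "('a, 'e::euclidean_space) cotensor \<Rightarrow>
    ('b, 'f::euclidean_space) cotensor \<Rightarrow> ('a \<Rightarrow> real) \<Rightarrow> ('a \<times> 'b, 'e \<times> 'f) cotensor" where
  "warped_bivector P\<^sub>1 P\<^sub>2 \<nu> m \<alpha> \<beta> =
     P\<^sub>1 (fst m) (hor_part \<alpha>) (hor_part \<beta>) + \<nu> (fst m) * P\<^sub>2 (snd m) (ver_part \<alpha>) (ver_part \<beta>)"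

end

theory Submission
  imports Defs
begin

text \<open>
  Write \<open>A(x, y, z, w) = G(R(x, y)z, w)\<close>. For \<open>\<xi> = (\<alpha> + \<beta>) / \<surd>2\<close> the numerator of the null sectional
  curvature is
  \<open>(1/2) (A(\<alpha>, \<theta>, \<theta>, \<alpha>) + A(\<beta>, \<theta>, \<theta>, \<beta>) + A(\<alpha>, \<theta>, \<theta>, \<beta>) + A(\<beta>, \<theta>, \<theta>, \<alpha>))\<close>. The first two terms are
  sectional curvatures, with signs coming from \<open>G(\<alpha>, \<alpha>) = -1\<close> and \<open>G(\<beta>, \<beta>) = 1\<close>. Everything
  therefore rests on the equality of the two mixed terms, \<open>A(\<alpha>, \<theta>, \<theta>, \<beta>) = A(\<beta>, \<theta>, \<theta>, \<alpha>)\<close>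
  (\<open>R_pair_symmetry\<close>); the powers of the warping function in the statement then come from replacing
  \<open>f\<^sub>1 dy\<close> by \<open>dy\<close>, where the terms that break the tensoriality of the curvature vanish by
  orthogonality (\<open>curvature_scale\<close>).

  The mixed terms agree by the usual argument from the first Bianchi identity and the skew symmetry
  of \<open>A\<close> in its last two arguments. Skew symmetry holds for forms with constant inner products
  (\<open>R_metric_skew\<close>), in particular for an orthonormal frame. The cyclic sum in the Bianchi identity
  equals the Jacobi expression of the bracket of one-forms (\<open>bianchi\<close>), so that expression has to
  vanish on \<open>(\<alpha>, \<theta>, \<beta>)\<close>. The connection axioms make the bracket a Leibniz bracket, and on exact
  forms it is \<open>[df, dg] = d{f, g}\<close> (\<open>form_bracket_exact\<close>). Hence its Jacobi expression on sums of terms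
  \<open>a dx\<close> is controlled by Jacobiators of the functions \<open>a\<close> and \<open>x\<close> alone (\<open>jac_vanishes\<close>).

  There are two sources of vanishing Jacobiators. If the product bivector is Poisson, all of them
  vanish (\<open>jac_poisson\<close>). In general the Schouten square of \<open>\<Pi>\<^sub>1 + \<nu>\<^sub>1 \<Pi>\<^sub>2\<close> is a multiple of
  \<open>X \<and> \<Pi>\<^sub>2\<close>, where \<open>X\<close> is the horizontal field that the sharp map of \<open>\<Pi>\<^sub>1\<close> assigns to \<open>d\<nu>\<^sub>1\<close>;
  this trivector vanishes as soon as two of its arguments are horizontal
  (\<open>jacobiator_hor\<close>). This covers the four relations in which at least two of the three forms
  \<open>\<alpha>, \<theta>, \<beta>\<close> are horizontal.

  Tangent spaces at different points are identified with the model space through unrelated charts,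
  so the calculus is developed from derivations: a chart yields smooth coordinate functions and
  coordinate fields, every covector is a combination of differentials of coordinates, and the
  existence of Lie brackets reduces to the symmetry of second derivatives.
\<close>

section \<open>Calculus of smooth maps between Euclidean spaces\<close>

lemma Ck_on_cong:
  assumes "open S" "\<And>x. x \<in> S \<Longrightarrow> f x = g x" "Ck_on k f S"
  shows "Ck_on k g S"
  using assms(2,3)
proof (induction k arbitrary: f g)
  case 0
  then show ?case by (metis Ck_on.simps(1) continuous_on_cong)
next
  case (Suc k)
  have d: "f differentiable at x" if "x \<in> S" for x
    using Suc.prems(2) that assms(1) by (simp add: differentiable_on_eq_differentiable_at)
  have "g differentiable_on S"
    unfolding differentiable_on_eq_differentiable_at[OF assms(1)]
  proof
    fix x assume x: "x \<in> S"
    from d[OF x] obtain f' where "(f has_derivative f') (at x)"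
      unfolding differentiable_def by blast
    then have "(g has_derivative f') (at x)"
      by (rule has_derivative_transform_within_open[OF _ assms(1) x Suc.prems(1)])
    then show "g differentiable at x"
      by (rule differentiableI)
  qed
  moreover have "Ck_on k (\<lambda>x. frechet_derivative g (at x) v) S" for v
  proof (rule Suc.IH)
    show "Ck_on k (\<lambda>x. frechet_derivative f (at x) v) S" using Suc.prems(2) by simp
    show "frechet_derivative f (at x) v = frechet_derivative g (at x) v" if "x \<in> S" for x
      using frechet_derivative_transform_within_open[OF d[OF that] assms(1) that Suc.prems(1)] by simp
  qed
  ultimately show ?case by simp
qed

lemma Ck_on_subset: "Ck_on k f S \<Longrightarrow> T \<subseteq> S \<Longrightarrow> Ck_on k f T"
  by (induction k arbitrary: f) (auto intro: continuous_on_subset differentiable_on_subset)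

lemma Ck_on_Suc_imp: "Ck_on (Suc k) f S \<Longrightarrow> Ck_on k f S"
proof (induction k arbitrary: f)
  case 0
  then show ?case by (simp add: differentiable_imp_continuous_on)
next
  case (Suc k)
  have "Ck_on (Suc k) (\<lambda>x. frechet_derivative f (at x) v) S" for v
    using Suc.prems unfolding Ck_on.simps(2)[of "Suc k"] by blast
  moreover have "f differentiable_on S"
    using Suc.prems unfolding Ck_on.simps(2)[of "Suc k"] by blast
  ultimately show ?case
    unfolding Ck_on.simps(2)[of k f] by (intro conjI allI Suc.IH)
qed

lemma Ck_on_local:
  assumes "open S" "\<And>x. x \<in> S \<Longrightarrow> \<exists>T. open T \<and> x \<in> T \<and> Ck_on k f T"
  shows "Ck_on k f S"
  using assms(2)
proof (induction k arbitrary: f)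
  case 0
  then have "continuous (at x) f" if "x \<in> S" for x
    using that by (metis Ck_on.simps(1) continuous_on_eq_continuous_at)
  then show ?case by (simp add: continuous_at_imp_continuous_on)
next
  case (Suc k)
  have "f differentiable at x" if "x \<in> S" for x
    using Suc.prems[OF that] by (auto simp: differentiable_on_eq_differentiable_at)
  then have "f differentiable_on S"
    by (meson differentiable_at_imp_differentiable_on)
  moreover have "Ck_on k (\<lambda>x. frechet_derivative f (at x) v) S" for v
    by (rule Suc.IH) (use Suc.prems in fastforce)
  ultimately show ?case by simp
qed

lemma Ck_on_const [simp]: "Ck_on k (\<lambda>x. c) S"
  by (induction k arbitrary: c) (simp_all add: frechet_derivative_const)

lemma Ck_on_Suc_I:
  assumes "open S" "\<And>x. x \<in> S \<Longrightarrow> (f has_derivative f' x) (at x)"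
    and "\<And>v. Ck_on k (\<lambda>x. f' x v) S"
  shows "Ck_on (Suc k) f S"
proof -
  have "f differentiable_on S"
    using assms(2) by (meson differentiable_at_imp_differentiable_on differentiableI)
  moreover have "Ck_on k (\<lambda>x. frechet_derivative f (at x) v) S" for v
    by (rule Ck_on_cong[OF assms(1) _ assms(3)])
      (simp add: frechet_derivative_at[OF assms(2), symmetric])
  ultimately show ?thesis by simp
qed

lemma Ck_on_Suc_D:
  assumes "open S" "Ck_on (Suc k) f S" "x \<in> S"
  shows "(f has_derivative frechet_derivative f (at x)) (at x)"
  using assms by (simp add: differentiable_on_eq_differentiable_at frechet_derivative_works)

lemma Ck_on_add:
  assumes "open S" "Ck_on k f S" "Ck_on k g S"
  shows "Ck_on k (\<lambda>x. f x + g x) S"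
  using assms(2,3)
proof (induction k arbitrary: f g)
  case 0
  then show ?case by (simp add: continuous_on_add)
next
  case (Suc k)
  show ?case
  proof (rule Ck_on_Suc_I[OF assms(1)])
    show "((\<lambda>x. f x + g x) has_derivative
        (\<lambda>v. frechet_derivative f (at x) v + frechet_derivative g (at x) v)) (at x)" if "x \<in> S" for x
      using Ck_on_Suc_D[OF assms(1) Suc.prems(1) that] Ck_on_Suc_D[OF assms(1) Suc.prems(2) that]
      by (rule has_derivative_add)
    show "Ck_on k (\<lambda>x. frechet_derivative f (at x) v + frechet_derivative g (at x) v) S" for v
      by (rule Suc.IH) (use Suc.prems in simp_all)
  qed
qed

lemma Ck_on_sum:
  assumes "open S" "\<And>i. i \<in> I \<Longrightarrow> Ck_on k (f i) S"
  shows "Ck_on k (\<lambda>x. \<Sum>i\<in>I. f i x) S"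
  using assms(2) by (induction I rule: infinite_finite_induct) (auto intro: Ck_on_add[OF assms(1)])

lemma Ck_on_bounded_linear:
  assumes "open S" "bounded_linear L" "Ck_on k f S"
  shows "Ck_on k (\<lambda>x. L (f x)) S"
  using assms(3)
proof (induction k arbitrary: f)
  case 0
  then show ?case
    using assms(2) by (simp add: linear_continuous_on_compose bounded_linear.continuous_on)
next
  case (Suc k)
  show ?case
  proof (rule Ck_on_Suc_I[OF assms(1)])
    show "((\<lambda>x. L (f x)) has_derivative (\<lambda>v. L (frechet_derivative f (at x) v))) (at x)"
      if "x \<in> S" for x
      by (rule bounded_linear.has_derivative[OF assms(2) Ck_on_Suc_D[OF assms(1) Suc.prems that]])
    show "Ck_on k (\<lambda>x. L (frechet_derivative f (at x) v)) S" for v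
      by (rule Suc.IH) (use Suc.prems in simp)
  qed
qed

lemma Ck_on_scaleR:
  assumes "open S" "Ck_on k a S" "Ck_on k f S"
  shows "Ck_on k (\<lambda>x. a x *\<^sub>R f x) S"
  using assms(2,3)
proof (induction k arbitrary: a f)
  case 0
  then show ?case by (simp add: continuous_on_scaleR)
next
  case (Suc k)
  show ?case
  proof (rule Ck_on_Suc_I[OF assms(1)])
    show "((\<lambda>x. a x *\<^sub>R f x) has_derivative
        (\<lambda>v. a x *\<^sub>R frechet_derivative f (at x) v + frechet_derivative a (at x) v *\<^sub>R f x)) (at x)"
      if "x \<in> S" for x
      using Ck_on_Suc_D[OF assms(1) Suc.prems(1) that] Ck_on_Suc_D[OF assms(1) Suc.prems(2) that]
      by (rule has_derivative_scaleR)
    show "Ck_on k (\<lambda>x. a x *\<^sub>R frechet_derivative f (at x) v + frechet_derivative a (at x) v *\<^sub>R f x) S" for v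
      using Suc.prems Ck_on_Suc_imp[OF Suc.prems(1)] Ck_on_Suc_imp[OF Suc.prems(2)]
      by (intro Ck_on_add[OF assms(1)] Suc.IH) simp_all
  qed
qed

text \<open>
  The differential of f is expanded over the basis, \<open>Df(g x) w = (\<Sum>b. (w
  \<bullet> b) *\<^sub>R Df(g x) b)\<close>, because the induction hypothesis concerns
  derivatives in fixed directions.
\<close>

lemma Ck_on_compose:
  fixes f :: "'f::euclidean_space \<Rightarrow> 'g::real_normed_vector" and g :: "'e::euclidean_space \<Rightarrow> 'f"
  assumes "open S" "open T" "g ` S \<subseteq> T" "Ck_on k g S" "Ck_on k f T"
  shows "Ck_on k (\<lambda>x. f (g x)) S"
  using assms(4,5)
proof (induction k arbitrary: f)
  case 0
  then show ?case
    using assms(3) by (auto intro: continuous_on_compose2)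
next
  case (Suc k)
  let ?G = "\<lambda>x. frechet_derivative g (at x)" and ?F = "\<lambda>y. frechet_derivative f (at y)"
  show ?case
  proof (rule Ck_on_Suc_I[OF assms(1)])
    fix x assume x: "x \<in> S"
    then have "g x \<in> T" using assms(3) by auto
    note F = Ck_on_Suc_D[OF assms(2) Suc.prems(2) this]
    have "?F (g x) w = (\<Sum>b\<in>Basis. (w \<bullet> b) *\<^sub>R ?F (g x) b)" for w
    proof -
      have l: "linear (?F (g x))" by (rule has_derivative_linear[OF F])
      have "?F (g x) w = ?F (g x) (\<Sum>b\<in>Basis. (w \<bullet> b) *\<^sub>R b)"
        by (simp add: euclidean_representation)
      also have "\<dots> = (\<Sum>b\<in>Basis. (w \<bullet> b) *\<^sub>R ?F (g x) b)"
        by (simp add: linear_sum[OF l] linear_cmul[OF l])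
      finally show ?thesis .
    qed
    then have "(\<lambda>v. ?F (g x) (?G x v)) = (\<lambda>v. \<Sum>b\<in>Basis. (?G x v \<bullet> b) *\<^sub>R ?F (g x) b)"
      by blast
    moreover have "((\<lambda>x. f (g x)) has_derivative (\<lambda>v. ?F (g x) (?G x v))) (at x)"
      by (rule has_derivative_compose[OF Ck_on_Suc_D[OF assms(1) Suc.prems(1) x] F])
    ultimately show "((\<lambda>x. f (g x)) has_derivative
        (\<lambda>v. \<Sum>b\<in>Basis. (?G x v \<bullet> b) *\<^sub>R ?F (g x) b)) (at x)"
      by (simp only:)
  next
    fix v
    have "Ck_on k (\<lambda>x. ?G x v \<bullet> b) S" for b
      using Suc.prems(1) by (intro Ck_on_bounded_linear[OF assms(1) bounded_linear_inner_left]) simp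
    moreover have "Ck_on k (\<lambda>x. ?F (g x) b) S" for b
      by (rule Suc.IH[OF Ck_on_Suc_imp[OF Suc.prems(1)]]) (use Suc.prems(2) in simp)
    ultimately show "Ck_on k (\<lambda>x. \<Sum>b\<in>Basis. (?G x v \<bullet> b) *\<^sub>R ?F (g x) b) S"
      by (intro Ck_on_sum[OF assms(1)] Ck_on_scaleR[OF assms(1)])
  qed
qed

lemma smooth_on_cong:
  "open S \<Longrightarrow> (\<And>x. x \<in> S \<Longrightarrow> f x = g x) \<Longrightarrow> smooth_on f S \<Longrightarrow> smooth_on g S"
  unfolding smooth_on_def using Ck_on_cong by blast

lemma smooth_on_subset: "smooth_on f S \<Longrightarrow> T \<subseteq> S \<Longrightarrow> smooth_on f T"
  unfolding smooth_on_def using Ck_on_subset by blast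

lemma smooth_on_local:
  assumes "open S" "\<And>x. x \<in> S \<Longrightarrow> \<exists>T. open T \<and> x \<in> T \<and> smooth_on f T"
  shows "smooth_on f S"
  unfolding smooth_on_def
proof
  fix k show "Ck_on k f S"
    by (rule Ck_on_local[OF assms(1)]) (use assms(2) in \<open>auto simp: smooth_on_def\<close>)
qed

lemma smooth_on_const [simp]: "smooth_on (\<lambda>x. c) S"
  by (simp add: smooth_on_def)

lemma smooth_on_add:
  "open S \<Longrightarrow> smooth_on f S \<Longrightarrow> smooth_on g S \<Longrightarrow> smooth_on (\<lambda>x. f x + g x) S"
  unfolding smooth_on_def by (simp add: Ck_on_add)

lemma smooth_on_scaleR:
  "open S \<Longrightarrow> smooth_on a S \<Longrightarrow> smooth_on f S \<Longrightarrow> smooth_on (\<lambda>x. a x *\<^sub>R f x) S"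
  unfolding smooth_on_def by (simp add: Ck_on_scaleR)

lemma smooth_on_bounded_linear:
  "open S \<Longrightarrow> bounded_linear L \<Longrightarrow> smooth_on f S \<Longrightarrow> smooth_on (\<lambda>x. L (f x)) S"
  unfolding smooth_on_def by (simp add: Ck_on_bounded_linear)

lemma smooth_on_compose:
  fixes f :: "'f::euclidean_space \<Rightarrow> 'g::real_normed_vector" and g :: "'e::euclidean_space \<Rightarrow> 'f"
  assumes "open S" "open T" "g ` S \<subseteq> T" "smooth_on g S" "smooth_on f T"
  shows "smooth_on (\<lambda>x. f (g x)) S"
  using assms unfolding smooth_on_def by (auto intro: Ck_on_compose[where T = T])

lemma smooth_on_ident: "open S \<Longrightarrow> smooth_on (\<lambda>x. x) S"
  unfolding smooth_on_def
proof
  fix k assume S: "open S"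
  show "Ck_on k (\<lambda>x. x) S"
    by (cases k) (auto intro!: Ck_on_Suc_I[OF S, where f' = "\<lambda>x v. v"])
qed

lemma smooth_on_has_derivative:
  assumes "smooth_on f S" "open S" "x \<in> S"
  shows "(f has_derivative frechet_derivative f (at x)) (at x)"
  using assms Ck_on_Suc_D[of S 0 f x] unfolding smooth_on_def by blast

lemma smooth_on_frechet_derivative:
  assumes "smooth_on f S"
  shows "smooth_on (\<lambda>x. frechet_derivative f (at x) v) S"
  unfolding smooth_on_def
proof
  fix k
  have "Ck_on (Suc k) f S" using assms unfolding smooth_on_def by blast
  then show "Ck_on k (\<lambda>x. frechet_derivative f (at x) v) S" by simp
qed

lemma smooth_on_continuous_on: "smooth_on f S \<Longrightarrow> continuous_on S f"
  unfolding smooth_on_def by (metis Ck_on.simps(1))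

text \<open>
  The mean value theorem is used twice, first along \<open>u\<close> and then along
  \<open>v\<close>. The left-hand side is symmetric in \<open>u\<close> and
  \<open>v\<close>, so it links the two orders of differentiation.
\<close>

lemma second_difference:
  fixes f :: "'e::euclidean_space \<Rightarrow> real"
  assumes S: "open S" and f: "smooth_on f S" and h: "0 < h"
    and sub: "\<And>s t. s \<in> {0..h} \<Longrightarrow> t \<in> {0..h} \<Longrightarrow> x + s *\<^sub>R u + t *\<^sub>R v \<in> S"
  shows "\<exists>s\<in>{0..h}. \<exists>t\<in>{0..h}. f (x + h *\<^sub>R u + h *\<^sub>R v) - f (x + h *\<^sub>R u) - f (x + h *\<^sub>R v) + f x =
    h\<^sup>2 * frechet_derivative (\<lambda>y. frechet_derivative f (at y) u) (at (x + s *\<^sub>R u + t *\<^sub>R v)) v"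
proof -
  let ?f = "\<lambda>y. frechet_derivative f (at y)"
  have lin: "linear (frechet_derivative g (at y))" if "smooth_on g S" "y \<in> S" for g :: "'e \<Rightarrow> real" and y
    using smooth_on_has_derivative[OF that(1) S that(2)] by (rule has_derivative_linear)
  let ?p = "\<lambda>s. f (x + s *\<^sub>R u + h *\<^sub>R v) - f (x + s *\<^sub>R u)"
  have "\<exists>s\<in>{0<..<h}. ?p h - ?p 0 =
      (\<lambda>k. ?f (x + s *\<^sub>R u + h *\<^sub>R v) (k *\<^sub>R u) - ?f (x + s *\<^sub>R u) (k *\<^sub>R u)) (h - 0)"
  proof (rule mvt_simple[OF h])
    fix s assume s: "0 \<le> s" "s \<le> h"
    then have 1: "x + s *\<^sub>R u + h *\<^sub>R v \<in> S" and 2: "x + s *\<^sub>R u \<in> S"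
      using sub[of s h] sub[of s 0] h by auto
    show "(?p has_derivative (\<lambda>k. ?f (x + s *\<^sub>R u + h *\<^sub>R v) (k *\<^sub>R u) - ?f (x + s *\<^sub>R u) (k *\<^sub>R u)))
        (at s within {0..h})"
      by (rule has_derivative_diff; rule has_derivative_compose[OF _ smooth_on_has_derivative[OF f S]])
        (use 1 2 in \<open>auto intro!: derivative_eq_intros\<close>)
  qed
  then obtain s where s: "s \<in> {0<..<h}"
    and eq: "?p h - ?p 0 = h * (?f (x + s *\<^sub>R u + h *\<^sub>R v) u - ?f (x + s *\<^sub>R u) u)"
    using sub[of _ h] sub[of _ 0] h
    by (auto simp: linear_cmul[OF lin[OF f]] algebra_simps)
  let ?g = "\<lambda>y. ?f y u"
  have g: "smooth_on ?g S" by (rule smooth_on_frechet_derivative[OF f])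
  let ?q = "\<lambda>t. ?g (x + s *\<^sub>R u + t *\<^sub>R v)"
  have "\<exists>t\<in>{0<..<h}. ?q h - ?q 0 = (\<lambda>k. frechet_derivative ?g (at (x + s *\<^sub>R u + t *\<^sub>R v)) (k *\<^sub>R v)) (h - 0)"
  proof (rule mvt_simple[OF h])
    fix t assume t: "0 \<le> t" "t \<le> h"
    then have 1: "x + s *\<^sub>R u + t *\<^sub>R v \<in> S" using sub[of s t] s by auto
    show "(?q has_derivative (\<lambda>k. frechet_derivative ?g (at (x + s *\<^sub>R u + t *\<^sub>R v)) (k *\<^sub>R v)))
        (at t within {0..h})"
      by (rule has_derivative_compose[where f = "\<lambda>t. x + s *\<^sub>R u + t *\<^sub>R v",
            OF _ smooth_on_has_derivative[OF g S 1]])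
        (auto intro!: derivative_eq_intros)
  qed
  then obtain t where t: "t \<in> {0<..<h}"
    and eq2: "?q h - ?q 0 = h * frechet_derivative ?g (at (x + s *\<^sub>R u + t *\<^sub>R v)) v"
    using sub[of s] s by (auto simp: linear_cmul[OF lin[OF g]])
  have "f (x + h *\<^sub>R u + h *\<^sub>R v) - f (x + h *\<^sub>R u) - f (x + h *\<^sub>R v) + f x =
    h\<^sup>2 * frechet_derivative ?g (at (x + s *\<^sub>R u + t *\<^sub>R v)) v"
    using eq eq2 by (simp add: power2_eq_square algebra_simps)
  with s t show ?thesis
    by (intro bexI[of _ s] bexI[of _ t]) auto
qed

text \<open>
  Both iterated derivatives attain the same value, a second difference quotient, at points
  that tend to \<open>x\<close> with the step; both are continuous.
\<close>

lemma second_derivative_symmetric: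
  fixes f :: "'e::euclidean_space \<Rightarrow> real"
  assumes S: "open S" and f: "smooth_on f S" and x: "x \<in> S"
  shows "frechet_derivative (\<lambda>y. frechet_derivative f (at y) u) (at x) v =
    frechet_derivative (\<lambda>y. frechet_derivative f (at y) v) (at x) u"
proof -
  define A where "A = (\<lambda>z. frechet_derivative (\<lambda>y. frechet_derivative f (at y) u) (at z) v)"
  define B where "B = (\<lambda>z. frechet_derivative (\<lambda>y. frechet_derivative f (at y) v) (at z) u)"
  have cA: "isCont A x" and cB: "isCont B x"
    using continuous_on_eq_continuous_at[OF S] x
      smooth_on_continuous_on[OF smooth_on_frechet_derivative[OF smooth_on_frechet_derivative[OF f]]]
    unfolding A_def B_def by blast+
  have "\<bar>A x - B x\<bar> < e" if e: "0 < e" for e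
  proof -
    obtain d where d: "0 < d" "\<And>z. dist z x < d \<Longrightarrow> \<bar>A z - A x\<bar> < e / 2"
      using cA e unfolding continuous_at_eps_delta dist_real_def by (metis half_gt_zero)
    obtain d' where d': "0 < d'" "\<And>z. dist z x < d' \<Longrightarrow> \<bar>B z - B x\<bar> < e / 2"
      using cB e unfolding continuous_at_eps_delta dist_real_def by (metis half_gt_zero)
    obtain r where r: "0 < r" "ball x r \<subseteq> S" using S x open_contains_ball by blast
    define m where "m = min r (min d d')"
    have m: "0 < m" using d d' r by (simp add: m_def)
    \<comment> \<open>The step is so small that the parallelogram spanned by \<open>h u\<close> and
       \<open>h v\<close> lies in the ball of radius \<open>m\<close>; adding 1 keeps the
       denominator positive.\<close>
    define h where "h = m / (2 * (norm u + norm v + 1))"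
    have h: "0 < h" using m by (simp add: h_def add_nonneg_pos)
    have n: "dist (x + s *\<^sub>R u + t *\<^sub>R v) x < m" if "s \<in> {0..h}" "t \<in> {0..h}" for s t
    proof -
      have "dist (x + s *\<^sub>R u + t *\<^sub>R v) x = norm (s *\<^sub>R u + t *\<^sub>R v)"
        by (simp add: dist_norm algebra_simps)
      also have "\<dots> \<le> s * norm u + t * norm v"
        using that norm_triangle_ineq[of "s *\<^sub>R u" "t *\<^sub>R v"] by simp
      also have "\<dots> \<le> h * norm u + h * norm v"
        using that by (intro add_mono mult_right_mono) auto
      also have "\<dots> < 2 * (h * (norm u + norm v + 1))"
        using h by (simp add: algebra_simps add_nonneg_pos)
      also have "\<dots> = m" 
      proof -
        have "norm u + norm v + 1 \<noteq> 0" by (smt (verit) norm_ge_zero)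
        then show ?thesis by (simp add: h_def field_simps)
      qed
      finally show ?thesis .
    qed
    have inS: "x + s *\<^sub>R u + t *\<^sub>R v \<in> S" if "s \<in> {0..h}" "t \<in> {0..h}" for s t
      using n[OF that] r(2) by (auto simp: m_def mem_ball dist_commute)
    obtain s t where st: "s \<in> {0..h}" "t \<in> {0..h}"
      and 1: "f (x + h *\<^sub>R u + h *\<^sub>R v) - f (x + h *\<^sub>R u) - f (x + h *\<^sub>R v) + f x = h\<^sup>2 * A (x + s *\<^sub>R u + t *\<^sub>R v)"
      using second_difference[OF S f h inS] unfolding A_def by blast
    have inS': "x + s *\<^sub>R v + t *\<^sub>R u \<in> S" if "s \<in> {0..h}" "t \<in> {0..h}" for s t
      using inS[OF that(2,1)] by (simp add: add_ac)
    obtain s' t' where st': "s' \<in> {0..h}" "t' \<in> {0..h}"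
      and 2: "f (x + h *\<^sub>R v + h *\<^sub>R u) - f (x + h *\<^sub>R v) - f (x + h *\<^sub>R u) + f x = h\<^sup>2 * B (x + s' *\<^sub>R v + t' *\<^sub>R u)"
      using second_difference[OF S f h inS'] unfolding B_def by blast
    have "h\<^sup>2 * A (x + s *\<^sub>R u + t *\<^sub>R v) = h\<^sup>2 * B (x + s' *\<^sub>R v + t' *\<^sub>R u)"
      using 1 2 by (simp only: add.assoc add.commute[of "h *\<^sub>R v"])
    then have "A (x + s *\<^sub>R u + t *\<^sub>R v) = B (x + t' *\<^sub>R u + s' *\<^sub>R v)"
      using h by (simp add: add_ac)
    moreover have "\<bar>A (x + s *\<^sub>R u + t *\<^sub>R v) - A x\<bar> < e / 2" 
      using n[OF st] by (intro d(2)) (simp add: m_def)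
    moreover have "\<bar>B (x + t' *\<^sub>R u + s' *\<^sub>R v) - B x\<bar> < e / 2" 
      using n[OF st'(2,1)] by (intro d'(2)) (simp add: m_def)
    ultimately show ?thesis by linarith
  qed
  then have "A x = B x"
    by (metis abs_le_zero_iff diff_0_right dual_order.irrefl eq_iff_diff_eq_0 linorder_not_less zero_less_abs_iff)
  then show ?thesis by (simp add: A_def B_def)
qed

section \<open>Differential calculus in charts\<close>

text \<open>
  The local part of the definition of a smooth manifold. It passes to products chart by
  chart, so that calculus on the product is available from the two factors.
\<close>

locale atlas =
  fixes M :: "('a, 'e::euclidean_space) manifold"
  assumes chart_open: "(V, \<phi>) \<in> charts M \<Longrightarrow> openin (mtop M) V"
    and chart_inj: "(V, \<phi>) \<in> charts M \<Longrightarrow> inj_on \<phi> V"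
    and chart_image_open: "(V, \<phi>) \<in> charts M \<Longrightarrow> openin (mtop M) N \<Longrightarrow> open (\<phi> ` (N \<inter> V))"
    and transition: "(V, \<phi>) \<in> charts M \<Longrightarrow> (W, \<psi>) \<in> charts M \<Longrightarrow>
      smooth_on (\<psi> \<circ> inv_into V \<phi>) (\<phi> ` (V \<inter> W))"
    and chart_at_chart: "p \<in> points M \<Longrightarrow> chart_at M p \<in> charts M"
    and chart_at_mem: "p \<in> points M \<Longrightarrow> p \<in> fst (chart_at M p)"

lemma smooth_manifold_atlas: "smooth_manifold M \<Longrightarrow> atlas M"
proof
  assume M: "smooth_manifold M"
  fix V \<phi> assume c: "(V, \<phi>) \<in> charts M"
  then have hom: "openin (mtop M) V" "open (\<phi> ` V)"
    "homeomorphic_map (subtopology (mtop M) V) (top_of_set (\<phi> ` V)) \<phi>"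
    using M unfolding smooth_manifold_def by blast+
  show "openin (mtop M) V" by fact
  have ts: "topspace (subtopology (mtop M) V) = V"
    by (metis hom(1) openin_subset topspace_subtopology_subset)
  show "inj_on \<phi> V"
    using homeomorphic_imp_injective_map[OF hom(3)] ts by simp
  show "open (\<phi> ` (N \<inter> V))" if "openin (mtop M) N" for N
  proof -
    have "openin (subtopology (mtop M) V) (N \<inter> V)"
      using that by (auto simp: openin_subtopology)
    then have "openin (top_of_set (\<phi> ` V)) (\<phi> ` (N \<inter> V))"
      using homeomorphic_imp_open_map[OF hom(3)] unfolding open_map_def by blast
    then show ?thesis
      using hom(2) openin_open_trans by blast
  qed
qed (auto simp: smooth_manifold_def)

text \<open>
  The coordinate field of the chart \<open>\<phi>\<close> in direction \<open>b\<close>: the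
  differential of the change from \<open>\<phi>\<close> to the chart through which the
  tangent space at \<open>q\<close> is identified with the model space.
\<close>

definition coord_field ::
  "('a, 'e::euclidean_space) manifold \<Rightarrow> 'a set \<Rightarrow> ('a \<Rightarrow> 'e) \<Rightarrow> 'e \<Rightarrow> ('a, 'e) vector_field" where
  "coord_field M V \<phi> b q = frechet_derivative (coord M q \<circ> inv_into V \<phi>) (at (\<phi> q)) b"

lemma smooth_fun_subset: "smooth_fun M U f \<Longrightarrow> W \<subseteq> U \<Longrightarrow> smooth_fun M W f"
  unfolding smooth_fun_def by (fast intro: smooth_on_subset)

lemma smooth_field_subset: "smooth_field M U X \<Longrightarrow> W \<subseteq> U \<Longrightarrow> smooth_field M W X"
  unfolding smooth_field_def by blast

lemma smooth_form_subset: "smooth_form M U \<omega> \<Longrightarrow> W \<subseteq> U \<Longrightarrow> smooth_form M W \<omega>"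
  unfolding smooth_form_def by blast

lemma act_ext_d: "act M X f p = blinfun_apply (ext_d M f p) (X p)"
  by (rule act_def)

lemma act_fun_eq: "(\<lambda>p. blinfun_apply (ext_d M f p) (X p)) = act M X f"
  by (simp add: act_def fun_eq_iff)

context atlas
begin

lemma open_subset_points: "openin (mtop M) U \<Longrightarrow> p \<in> U \<Longrightarrow> p \<in> points M"
  using openin_subset by blast

lemma smooth_fun_rep:
  "smooth_fun M U f \<Longrightarrow> (V, \<phi>) \<in> charts M \<Longrightarrow> smooth_on (f \<circ> inv_into V \<phi>) (\<phi> ` (U \<inter> V))"
  unfolding smooth_fun_def by blast

lemma smooth_funI:
  assumes "\<And>V \<phi>. (V, \<phi>) \<in> charts M \<Longrightarrow> smooth_on (f \<circ> inv_into V \<phi>) (\<phi> ` (U \<inter> V))"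
  shows "smooth_fun M U f"
  using assms unfolding smooth_fun_def by blast

lemma inv_chart [simp]: "(V, \<phi>) \<in> charts M \<Longrightarrow> q \<in> V \<Longrightarrow> inv_into V \<phi> (\<phi> q) = q"
  using chart_inj inv_into_f_f by metis

lemma smooth_fun_local:
  assumes U: "openin (mtop M) U"
    and loc: "\<And>p. p \<in> U \<Longrightarrow> \<exists>N. openin (mtop M) N \<and> p \<in> N \<and> smooth_fun M N f"
  shows "smooth_fun M U f"
proof (rule smooth_funI)
  fix V \<phi> assume c: "(V, \<phi>) \<in> charts M"
  show "smooth_on (f \<circ> inv_into V \<phi>) (\<phi> ` (U \<inter> V))"
  proof (rule smooth_on_local[OF chart_image_open[OF c U]])
    fix x assume "x \<in> \<phi> ` (U \<inter> V)"
    then obtain p where p: "p \<in> U" "p \<in> V" "x = \<phi> p" by blast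
    obtain N where N: "openin (mtop M) N" "p \<in> N" "smooth_fun M N f" using loc[OF p(1)] by blast
    show "\<exists>T. open T \<and> x \<in> T \<and> smooth_on (f \<circ> inv_into V \<phi>) T"
      by (rule exI[of _ "\<phi> ` (N \<inter> V)"])
        (use p N chart_image_open[OF c N(1)] smooth_fun_rep[OF N(3) c] in blast)
  qed
qed

lemma smooth_fun_cong:
  assumes U: "openin (mtop M) U" and eq: "\<And>p. p \<in> U \<Longrightarrow> f p = g p" and f: "smooth_fun M U f"
  shows "smooth_fun M U g"
proof (rule smooth_funI)
  fix V \<phi> assume c: "(V, \<phi>) \<in> charts M"
  show "smooth_on (g \<circ> inv_into V \<phi>) (\<phi> ` (U \<inter> V))"
    by (rule smooth_on_cong[OF chart_image_open[OF c U] _ smooth_fun_rep[OF f c]])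
      (use eq c in auto)
qed

lemma smooth_fun_const: "smooth_fun M U (\<lambda>q. c)"
  by (rule smooth_funI) (simp add: comp_def)

lemma smooth_fun_add:
  assumes U: "openin (mtop M) U" and f: "smooth_fun M U f" and g: "smooth_fun M U g"
  shows "smooth_fun M U (\<lambda>q. f q + g q)"
proof (rule smooth_funI)
  fix V \<phi> assume c: "(V, \<phi>) \<in> charts M"
  show "smooth_on ((\<lambda>q. f q + g q) \<circ> inv_into V \<phi>) (\<phi> ` (U \<inter> V))"
    using smooth_on_add[OF chart_image_open[OF c U] smooth_fun_rep[OF f c] smooth_fun_rep[OF g c]]
    by (simp add: comp_def)
qed

lemma smooth_fun_mult:
  assumes U: "openin (mtop M) U" and f: "smooth_fun M U f" and g: "smooth_fun M U g"
  shows "smooth_fun M U (\<lambda>q. f q * g q)"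
proof (rule smooth_funI)
  fix V \<phi> assume c: "(V, \<phi>) \<in> charts M"
  show "smooth_on ((\<lambda>q. f q * g q) \<circ> inv_into V \<phi>) (\<phi> ` (U \<inter> V))"
    using smooth_on_scaleR[OF chart_image_open[OF c U] smooth_fun_rep[OF f c] smooth_fun_rep[OF g c]]
    by (simp add: comp_def)
qed

lemma smooth_fun_cmult:
  "openin (mtop M) U \<Longrightarrow> smooth_fun M U g \<Longrightarrow> smooth_fun M U (\<lambda>q. c * g q)"
  by (intro smooth_fun_mult smooth_fun_const)

lemma smooth_fun_uminus:
  "openin (mtop M) U \<Longrightarrow> smooth_fun M U g \<Longrightarrow> smooth_fun M U (\<lambda>q. - g q)"
  using smooth_fun_cmult[of U g "-1"] by simp

lemma smooth_fun_sum:
  assumes "openin (mtop M) U" "\<And>i. i \<in> I \<Longrightarrow> smooth_fun M U (f i)"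
  shows "smooth_fun M U (\<lambda>q. \<Sum>i\<in>I. f i q)"
  using assms(2)
  by (induction I rule: infinite_finite_induct) (auto intro: smooth_fun_add[OF assms(1)] smooth_fun_const)

text \<open>
  Transition maps carry smoothness from one chart to all others.
\<close>

lemma smooth_fun_chartI:
  assumes c: "(V, \<phi>) \<in> charts M" and U: "openin (mtop M) U" "U \<subseteq> V"
    and f: "smooth_on (f \<circ> inv_into V \<phi>) (\<phi> ` U)"
  shows "smooth_fun M U f"
proof (rule smooth_funI)
  fix W \<psi> assume d: "(W, \<psi>) \<in> charts M"
  have o: "open (\<psi> ` (U \<inter> W))" "open (\<phi> ` U)"
    using chart_image_open[OF d U(1)] chart_image_open[OF c U(1)] U(2) by (simp_all add: Int_absorb2)
  have "smooth_on (\<lambda>x. (f \<circ> inv_into V \<phi>) ((\<phi> \<circ> inv_into W \<psi>) x)) (\<psi> ` (U \<inter> W))"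
  proof (rule smooth_on_compose[OF o _ _ f])
    show "(\<phi> \<circ> inv_into W \<psi>) ` \<psi> ` (U \<inter> W) \<subseteq> \<phi> ` U"
      using d by auto
    show "smooth_on (\<phi> \<circ> inv_into W \<psi>) (\<psi> ` (U \<inter> W))"
      by (rule smooth_on_subset[OF transition[OF d c]]) (use U(2) in blast)
  qed
  then show "smooth_on (f \<circ> inv_into W \<psi>) (\<psi> ` (U \<inter> W))"
    by (rule smooth_on_cong[OF o(1), rotated]) (use c d U(2) in \<open>auto simp: subset_iff\<close>)
qed

lemma rep_has_derivative:
  assumes "smooth_fun M U f" "openin (mtop M) U" "(V, \<phi>) \<in> charts M" "p \<in> U" "p \<in> V"
  shows "((f \<circ> inv_into V \<phi>) has_derivative frechet_derivative (f \<circ> inv_into V \<phi>) (at (\<phi> p))) (at (\<phi> p))"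
  by (rule smooth_on_has_derivative[OF smooth_fun_rep[OF assms(1,3)] chart_image_open[OF assms(3,2)]])
    (use assms in blast)

lemma coord_chart:
  assumes "p \<in> points M"
  shows "(fst (chart_at M p), coord M p) \<in> charts M" "p \<in> fst (chart_at M p)"
  using chart_at_chart[OF assms] chart_at_mem[OF assms] by (simp_all add: coord_def)

lemma ext_d_eqI:
  assumes "((f \<circ> inv_coord M p) has_derivative L) (at (coord M p p))"
  shows "blinfun_apply (ext_d M f p) = L"
  unfolding ext_d_def frechet_derivative_at[OF assms, symmetric]
  by (rule bounded_linear_Blinfun_apply[OF has_derivative_bounded_linear[OF assms]])

lemma ext_d_has_derivative:
  assumes "smooth_fun M U f" "openin (mtop M) U" "p \<in> U"
  shows "((f \<circ> inv_coord M p) has_derivative blinfun_apply (ext_d M f p)) (at (coord M p p))"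
proof -
  have p: "p \<in> points M" using assms open_subset_points by blast
  note D = rep_has_derivative[OF assms(1,2) coord_chart(1)[OF p] assms(3) coord_chart(2)[OF p]]
  show ?thesis
    using ext_d_eqI[of f p] D unfolding inv_coord_def by metis
qed

lemma ext_d_cong:
  assumes f: "smooth_fun M U f" and U: "openin (mtop M) U" and p: "p \<in> U"
    and eq: "\<And>q. q \<in> U \<Longrightarrow> f q = g q"
  shows "ext_d M g p = ext_d M f p"
proof -
  have pp: "p \<in> points M" using U p open_subset_points by blast
  let ?V = "fst (chart_at M p)"
  note c = coord_chart[OF pp]
  have "((g \<circ> inv_coord M p) has_derivative blinfun_apply (ext_d M f p)) (at (coord M p p))"
    by (rule has_derivative_transform_within_open[OF ext_d_has_derivative[OF f U p]
          chart_image_open[OF c(1) U]])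
      (use p c eq in \<open>auto simp: inv_coord_def\<close>)
  then show ?thesis by (metis blinfun_eqI ext_d_eqI)
qed

lemma ext_d_const [simp]: "ext_d M (\<lambda>q. c) p = 0"
  by (rule blinfun_eqI) (simp add: ext_d_eqI[of _ _ "\<lambda>v. 0"] comp_def)

context
  fixes U assumes U: "openin (mtop M) U"
begin

lemma ext_d_add:
  assumes "smooth_fun M U f" "smooth_fun M U g" "p \<in> U"
  shows "ext_d M (\<lambda>q. f q + g q) p = ext_d M f p + ext_d M g p"
  using ext_d_eqI[of "\<lambda>q. f q + g q" p]
    has_derivative_add[OF ext_d_has_derivative[OF assms(1) U assms(3)] ext_d_has_derivative[OF assms(2) U assms(3)]]
  by (intro blinfun_eqI) (simp add: comp_def blinfun.add_left)

lemma ext_d_mult: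
  assumes "smooth_fun M U f" "smooth_fun M U g" "p \<in> U"
  shows "ext_d M (\<lambda>q. f q * g q) p = f p *\<^sub>R ext_d M g p + g p *\<^sub>R ext_d M f p"
proof -
  have "inv_coord M p (coord M p p) = p"
    using coord_chart[OF open_subset_points[OF U assms(3)]] by (simp add: inv_coord_def)
  then show ?thesis
    using ext_d_eqI[of "\<lambda>q. f q * g q" p]
      has_derivative_mult[OF ext_d_has_derivative[OF assms(1) U assms(3)] ext_d_has_derivative[OF assms(2) U assms(3)]]
    by (intro blinfun_eqI) (simp add: comp_def blinfun.add_left blinfun.scaleR_left algebra_simps)
qed

lemma ext_d_cmult:
  assumes "smooth_fun M U g" "p \<in> U"
  shows "ext_d M (\<lambda>q. c * g q) p = c *\<^sub>R ext_d M g p"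
  using ext_d_mult[OF smooth_fun_const assms, of c] by simp

lemma ext_d_uminus:
  assumes "smooth_fun M U g" "p \<in> U"
  shows "ext_d M (\<lambda>q. - g q) p = - ext_d M g p"
  using ext_d_cmult[OF assms, of "-1"] by simp

lemma ext_d_sum:
  assumes "\<And>i. i \<in> I \<Longrightarrow> smooth_fun M U (f i)" "p \<in> U"
  shows "ext_d M (\<lambda>q. \<Sum>i\<in>I. f i q) p = (\<Sum>i\<in>I. ext_d M (f i) p)"
  using assms(1)
  by (induction I rule: infinite_finite_induct)
    (simp_all add: ext_d_add smooth_fun_sum[OF U] assms(2))

lemma smooth_form_ext_d: "smooth_fun M U f \<Longrightarrow> smooth_form M U (ext_d M f)"
  unfolding smooth_form_def act_fun_eq
  using smooth_fun_subset[of M U f] by (auto simp: smooth_field_def)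

lemma smooth_form_add:
  "smooth_form M U \<omega> \<Longrightarrow> smooth_form M U \<eta> \<Longrightarrow> smooth_form M U (\<lambda>q. \<omega> q + \<eta> q)"
  unfolding smooth_form_def by (simp add: blinfun.add_left smooth_fun_add)

lemma smooth_form_scale:
  "smooth_fun M U f \<Longrightarrow> smooth_form M U \<omega> \<Longrightarrow> smooth_form M U (\<lambda>q. f q *\<^sub>R \<omega> q)"
  unfolding smooth_form_def by (simp add: blinfun.scaleR_left smooth_fun_mult smooth_fun_subset)

lemma smooth_form_cscale: "smooth_form M U \<omega> \<Longrightarrow> smooth_form M U (\<lambda>q. c *\<^sub>R \<omega> q)"
  by (rule smooth_form_scale[OF smooth_fun_const])

lemma smooth_form_diff:
  assumes "smooth_form M U \<omega>" "smooth_form M U \<eta>"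
  shows "smooth_form M U (\<lambda>q. \<omega> q - \<eta> q)"
  using smooth_form_add[OF assms(1) smooth_form_cscale[OF assms(2), of "-1"]] by simp

lemma smooth_form_zero: "smooth_form M U (\<lambda>q. 0)"
  unfolding smooth_form_def by (simp add: smooth_fun_const)

lemma smooth_form_sum:
  assumes "\<And>i. i \<in> I \<Longrightarrow> smooth_form M U (\<omega> i)"
  shows "smooth_form M U (\<lambda>q. \<Sum>i\<in>I. \<omega> i q)"
  using assms
  by (induction I rule: infinite_finite_induct) (auto intro: smooth_form_add smooth_form_zero)

lemma smooth_form_cong:
  assumes "\<And>q. q \<in> U \<Longrightarrow> \<omega> q = \<eta> q" "smooth_form M U \<omega>"
  shows "smooth_form M U \<eta>"
  unfolding smooth_form_def
proof (intro allI impI, elim conjE)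
  fix V X assume V: "openin (mtop M) V" "V \<subseteq> U" "smooth_field M V X"
  show "smooth_fun M V (\<lambda>p. blinfun_apply (\<eta> p) (X p))"
    by (rule smooth_fun_cong[OF V(1), of "\<lambda>p. blinfun_apply (\<omega> p) (X p)"])
      (use assms V in \<open>auto simp: smooth_form_def\<close>)
qed

lemma smooth_form_local:
  assumes "\<And>p. p \<in> U \<Longrightarrow> \<exists>N. openin (mtop M) N \<and> p \<in> N \<and> smooth_form M N \<omega>"
  shows "smooth_form M U \<omega>"
  unfolding smooth_form_def
proof (intro allI impI, elim conjE)
  fix V X assume V: "openin (mtop M) V" "V \<subseteq> U" "smooth_field M V X"
  show "smooth_fun M V (\<lambda>p. blinfun_apply (\<omega> p) (X p))"
  proof (rule smooth_fun_local[OF V(1)])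
    fix p assume p: "p \<in> V"
    then obtain N where N: "openin (mtop M) N" "p \<in> N" "smooth_form M N \<omega>"
      using assms V(2) by blast
    show "\<exists>N. openin (mtop M) N \<and> p \<in> N \<and> smooth_fun M N (\<lambda>p. blinfun_apply (\<omega> p) (X p))"
    proof (intro exI conjI)
      show "openin (mtop M) (N \<inter> V)" using N V by blast
      then show "smooth_fun M (N \<inter> V) (\<lambda>p. blinfun_apply (\<omega> p) (X p))"
        using N(3) smooth_field_subset[OF V(3), of "N \<inter> V"] unfolding smooth_form_def by blast
    qed (use p N in blast)
  qed
qed

end

context
  fixes V \<phi> assumes chart: "(V, \<phi>) \<in> charts M"
begin

text \<open>
  The chain rule for \<open>f\<close> in the chart selected at \<open>q\<close>, composed
  with the change from \<open>\<phi>\<close> to it. It shows that coordinate fields act as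
  partial derivatives in \<open>\<phi>\<close>, whichever charts are selected.
\<close>

lemma ext_d_coord_field:
  assumes "smooth_fun M U f" "openin (mtop M) U" "q \<in> U" "q \<in> V"
  shows "blinfun_apply (ext_d M f q) (coord_field M V \<phi> b q) =
    frechet_derivative (f \<circ> inv_into V \<phi>) (at (\<phi> q)) b"
proof -
  have q: "q \<in> points M" using assms open_subset_points by blast
  let ?W = "fst (chart_at M q)" and ?\<psi> = "coord M q"
  note d = coord_chart[OF q]
  have o: "open (\<phi> ` (?W \<inter> V))" by (rule chart_image_open[OF chart chart_open[OF d(1)]])
  have qo: "\<phi> q \<in> \<phi> ` (?W \<inter> V)" using d assms by blast
  have "((?\<psi> \<circ> inv_into V \<phi>) has_derivative (\<lambda>b. coord_field M V \<phi> b q)) (at (\<phi> q))"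
    unfolding coord_field_def
    by (rule smooth_on_has_derivative[OF _ o qo]) (use transition[OF chart d(1)] in \<open>simp add: Int_commute\<close>)
  moreover have "(?\<psi> \<circ> inv_into V \<phi>) (\<phi> q) = coord M q q"
    using assms chart by simp
  ultimately have "((\<lambda>x. (f \<circ> inv_coord M q) ((?\<psi> \<circ> inv_into V \<phi>) x)) has_derivative
      (\<lambda>b. blinfun_apply (ext_d M f q) (coord_field M V \<phi> b q))) (at (\<phi> q))"
    using ext_d_has_derivative[OF assms(1-3)] has_derivative_compose by metis
  then have "((f \<circ> inv_into V \<phi>) has_derivative
      (\<lambda>b. blinfun_apply (ext_d M f q) (coord_field M V \<phi> b q))) (at (\<phi> q))"
    by (rule has_derivative_transform_within_open[OF _ o qo])
      (use chart d in \<open>auto simp: inv_coord_def\<close>)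
  from frechet_derivative_at[OF this] show ?thesis by metis
qed

lemma smooth_field_coord_field: "smooth_field M V (coord_field M V \<phi> b)"
  unfolding smooth_field_def
proof (intro allI impI, elim conjE)
  fix W f assume W: "openin (mtop M) W" "W \<subseteq> V" and f: "smooth_fun M W f"
  have o: "open (\<phi> ` W)" using chart_image_open[OF chart W(1)] W(2) by (simp add: Int_absorb2)
  have "smooth_on (\<lambda>x. frechet_derivative (f \<circ> inv_into V \<phi>) (at x) b) (\<phi> ` W)"
    using smooth_fun_rep[OF f chart] W(2)
    by (intro smooth_on_frechet_derivative) (simp add: Int_absorb2)
  then have "smooth_on (act M (coord_field M V \<phi> b) f \<circ> inv_into V \<phi>) (\<phi> ` W)"
    by (rule smooth_on_cong[OF o, rotated])
      (use ext_d_coord_field[OF f W(1)] W(2) chart in \<open>auto simp: act_def subset_iff\<close>)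
  then show "smooth_fun M W (act M (coord_field M V \<phi> b) f)"
    by (rule smooth_fun_chartI[OF chart W])
qed

lemma smooth_fun_coordinate: "smooth_fun M V (\<lambda>q. \<phi> q \<bullet> b)"
proof (rule smooth_fun_chartI[OF chart chart_open[OF chart] order_refl])
  have o: "open (\<phi> ` V)" using chart_image_open[OF chart chart_open[OF chart]] by simp
  have "smooth_on (\<lambda>x. x \<bullet> b) (\<phi> ` V)"
    by (rule smooth_on_bounded_linear[OF o bounded_linear_inner_left smooth_on_ident[OF o]])
  then show "smooth_on ((\<lambda>q. \<phi> q \<bullet> b) \<circ> inv_into V \<phi>) (\<phi> ` V)"
    by (rule smooth_on_cong[OF o, rotated]) (use chart in auto)
qed

text \<open>
  The changes between \<open>\<phi>\<close> and the chart selected at \<open>q\<close> are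
  inverse to each other near \<open>q\<close>, so their differentials compose to the
  identity.
\<close>

lemma tangent_resolution:
  assumes q: "q \<in> V"
  shows "u = (\<Sum>b\<in>Basis. blinfun_apply (ext_d M (\<lambda>q. \<phi> q \<bullet> b) q) u *\<^sub>R coord_field M V \<phi> b q)"
proof -
  have qp: "q \<in> points M" using open_subset_points[OF chart_open[OF chart] q] .
  let ?W = "fst (chart_at M q)" and ?\<psi> = "coord M q"
  note d = coord_chart[OF qp]
  have o: "open (\<phi> ` (?W \<inter> V))" "open (?\<psi> ` (V \<inter> ?W))"
    by (rule chart_image_open[OF chart chart_open[OF d(1)]],
        rule chart_image_open[OF d(1) chart_open[OF chart]])
  have qo: "\<phi> q \<in> \<phi> ` (?W \<inter> V)" "?\<psi> q \<in> ?\<psi> ` (V \<inter> ?W)" using d q by blast+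
  have 1: "((?\<psi> \<circ> inv_into V \<phi>) has_derivative (\<lambda>b. coord_field M V \<phi> b q)) (at (\<phi> q))"
    unfolding coord_field_def
    by (rule smooth_on_has_derivative[OF _ o(1) qo(1)])
      (use transition[OF chart d(1)] in \<open>simp add: Int_commute\<close>)
  let ?L = "frechet_derivative (\<phi> \<circ> inv_coord M q) (at (?\<psi> q))"
  have 2: "((\<phi> \<circ> inv_coord M q) has_derivative ?L) (at (?\<psi> q))"
    unfolding inv_coord_def
    by (rule smooth_on_has_derivative[OF _ o(2) qo(2)])
      (use transition[OF d(1) chart] in \<open>simp add: Int_commute\<close>)
  have L: "?L u \<bullet> b = blinfun_apply (ext_d M (\<lambda>q. \<phi> q \<bullet> b) q) u" for u b
  proof -
    have "(((\<lambda>q. \<phi> q \<bullet> b) \<circ> inv_coord M q) has_derivative (\<lambda>u. ?L u \<bullet> b)) (at (?\<psi> q))"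
      using has_derivative_inner_left[OF 2, of b] by (simp add: comp_def)
    from ext_d_eqI[OF this] show ?thesis by simp
  qed
  have e: "(\<phi> \<circ> inv_coord M q) (?\<psi> q) = \<phi> q"
    using d by (simp add: inv_coord_def)
  have "((\<lambda>x. (?\<psi> \<circ> inv_into V \<phi>) ((\<phi> \<circ> inv_coord M q) x)) has_derivative
      (\<lambda>u. coord_field M V \<phi> (?L u) q)) (at (?\<psi> q))"
    by (rule has_derivative_compose[OF 2]) (use 1 e in \<open>simp add: comp_def\<close>)
  then have "((\<lambda>x. x) has_derivative (\<lambda>u. coord_field M V \<phi> (?L u) q)) (at (?\<psi> q))"
    by (rule has_derivative_transform_within_open[OF _ o(2) qo(2)])
      (use chart d in \<open>auto simp: inv_coord_def\<close>)
  from has_derivative_unique[OF this has_derivative_ident]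
  have "u = coord_field M V \<phi> (?L u) q" by metis
  also have "\<dots> = coord_field M V \<phi> (\<Sum>b\<in>Basis. (?L u \<bullet> b) *\<^sub>R b) q"
    by (simp add: euclidean_representation)
  also have "\<dots> = (\<Sum>b\<in>Basis. (?L u \<bullet> b) *\<^sub>R coord_field M V \<phi> b q)"
    by (simp add: linear_sum[OF has_derivative_linear[OF 1]] linear_cmul[OF has_derivative_linear[OF 1]])
  finally show ?thesis by (simp add: L)
qed

lemma covector_resolution:
  assumes q: "q \<in> V"
  shows "\<alpha> = (\<Sum>b\<in>Basis. blinfun_apply \<alpha> (coord_field M V \<phi> b q) *\<^sub>R ext_d M (\<lambda>q. \<phi> q \<bullet> b) q)"
proof (rule blinfun_eqI)
  fix u
  have "blinfun_apply \<alpha> u = blinfun_apply \<alpha>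
    (\<Sum>b\<in>Basis. blinfun_apply (ext_d M (\<lambda>q. \<phi> q \<bullet> b) q) u *\<^sub>R coord_field M V \<phi> b q)"
    using tangent_resolution[OF q, of u] by simp
  then show "blinfun_apply \<alpha> u = blinfun_apply
    (\<Sum>b\<in>Basis. blinfun_apply \<alpha> (coord_field M V \<phi> b q) *\<^sub>R ext_d M (\<lambda>q. \<phi> q \<bullet> b) q) u"
    by (simp add: blinfun.sum_left blinfun.sum_right blinfun.scaleR_left blinfun.scaleR_right mult.commute)
qed

lemma smooth_form_coefficient:
  assumes "smooth_form M U \<omega>" "openin (mtop M) U" "U \<subseteq> V"
  shows "smooth_fun M U (\<lambda>q. blinfun_apply (\<omega> q) (coord_field M V \<phi> b q))"
  using assms smooth_field_subset[OF smooth_field_coord_field assms(3)] unfolding smooth_form_def by blast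

lemma act_coord_expansion:
  assumes q: "q \<in> V"
  shows "act M X f q = (\<Sum>b\<in>Basis. act M X (\<lambda>q. \<phi> q \<bullet> b) q * act M (coord_field M V \<phi> b) f q)"
proof -
  have "act M X f q = blinfun_apply (ext_d M f q)
    (\<Sum>b\<in>Basis. blinfun_apply (ext_d M (\<lambda>q. \<phi> q \<bullet> b) q) (X q) *\<^sub>R coord_field M V \<phi> b q)"
    using tangent_resolution[OF q, of "X q"] by (simp add: act_def)
  then show ?thesis by (simp add: act_def blinfun.sum_right blinfun.scaleR_right)
qed

lemma coord_fields_commute:
  assumes f: "smooth_fun M U f" and U: "openin (mtop M) U" "U \<subseteq> V" and q: "q \<in> U"
  shows "act M (coord_field M V \<phi> b) (act M (coord_field M V \<phi> c) f) q =
    act M (coord_field M V \<phi> c) (act M (coord_field M V \<phi> b) f) q"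
proof -
  have o: "open (\<phi> ` U)" using chart_image_open[OF chart U(1)] U(2) by (simp add: Int_absorb2)
  have s: "smooth_on (f \<circ> inv_into V \<phi>) (\<phi> ` U)"
    using smooth_fun_rep[OF f chart] U(2) by (simp add: Int_absorb2)
  have qV: "q \<in> V" using q U(2) by blast
  have 1: "act M (coord_field M V \<phi> b) (act M (coord_field M V \<phi> c) f) q =
    frechet_derivative (\<lambda>x. frechet_derivative (f \<circ> inv_into V \<phi>) (at x) c) (at (\<phi> q)) b" for b c
  proof -
    have sc: "smooth_fun M U (act M (coord_field M V \<phi> c) f)"
      using smooth_field_coord_field U f unfolding smooth_field_def by blast
    have "act M (coord_field M V \<phi> b) (act M (coord_field M V \<phi> c) f) q =
      frechet_derivative (act M (coord_field M V \<phi> c) f \<circ> inv_into V \<phi>) (at (\<phi> q)) b"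
      using ext_d_coord_field[OF sc U(1) q qV] by (simp add: act_def)
    also have "frechet_derivative (act M (coord_field M V \<phi> c) f \<circ> inv_into V \<phi>) (at (\<phi> q)) =
      frechet_derivative (\<lambda>x. frechet_derivative (f \<circ> inv_into V \<phi>) (at x) c) (at (\<phi> q))"
      by (rule frechet_derivative_transform_within_open[OF _ o])
        (use rep_has_derivative[OF sc U(1) chart q qV] ext_d_coord_field[OF f U(1)] U(2) q chart
          in \<open>auto simp: act_def subset_iff intro: differentiableI\<close>)
    finally show ?thesis .
  qed
  show ?thesis
    unfolding 1 by (rule second_derivative_symmetric[OF o s]) (use q in blast)
qed

end

text \<open>
  The product rule applied to \<open>Y f = (\<Sum>b. Y(x\<^sub>b) * \<partial>\<^sub>b
  f)\<close>. The double sum is the second-order part, which becomes symmetric in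
  \<open>X\<close> and \<open>Y\<close> once the coordinate fields commute.
\<close>

lemma act_coord_expansion2:
  assumes chart: "(V, \<phi>) \<in> charts M" and U: "openin (mtop M) U" "U \<subseteq> V" "p \<in> U"
    and Y: "smooth_field M U Y" and f: "smooth_fun M U f"
  shows "act M X (act M Y f) p =
    (\<Sum>b\<in>Basis. act M X (act M Y (\<lambda>q. \<phi> q \<bullet> b)) p * act M (coord_field M V \<phi> b) f p)
    + (\<Sum>b\<in>Basis. \<Sum>c\<in>Basis. act M Y (\<lambda>q. \<phi> q \<bullet> b) p * act M X (\<lambda>q. \<phi> q \<bullet> c) p *
        act M (coord_field M V \<phi> c) (act M (coord_field M V \<phi> b) f) p)"
proof -
  let ?x = "\<lambda>b q. \<phi> q \<bullet> b" and ?E = "coord_field M V \<phi>"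
  have x: "smooth_fun M U (act M Y (?x b))" for b
    using Y U(1) smooth_fun_subset[OF smooth_fun_coordinate[OF chart] U(2)]
    unfolding smooth_field_def by blast
  have E: "smooth_fun M U (act M (?E b) f)" for b
    using smooth_field_coord_field[OF chart] U f unfolding smooth_field_def by blast
  have pV: "p \<in> V" using U by blast
  have "ext_d M (act M Y f) p = ext_d M (\<lambda>q. \<Sum>b\<in>Basis. act M Y (?x b) q * act M (?E b) f q) p"
  proof (rule ext_d_cong[OF _ U(1,3)])
    show "smooth_fun M U (\<lambda>q. \<Sum>b\<in>Basis. act M Y (?x b) q * act M (?E b) f q)"
      by (intro smooth_fun_sum[OF U(1)] smooth_fun_mult[OF U(1)] x E)
    show "(\<Sum>b\<in>Basis. act M Y (?x b) q * act M (?E b) f q) = act M Y f q" if "q \<in> U" for q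
      using act_coord_expansion[OF chart, of q Y f] that U(2) by (simp only: subset_iff)
  qed
  also have "\<dots> = (\<Sum>b\<in>Basis. act M Y (?x b) p *\<^sub>R ext_d M (act M (?E b) f) p
      + act M (?E b) f p *\<^sub>R ext_d M (act M Y (?x b)) p)"
    using x E U(3)
    by (simp add: ext_d_sum[OF U(1)] ext_d_mult[OF U(1)] smooth_fun_mult[OF U(1)])
  finally have "act M X (act M Y f) p = (\<Sum>b\<in>Basis. act M Y (?x b) p * act M X (act M (?E b) f) p
      + act M (?E b) f p * act M X (act M Y (?x b)) p)"
    by (simp add: act_ext_d[of M X] blinfun.sum_left blinfun.add_left blinfun.scaleR_left)
  also have "\<dots> = (\<Sum>b\<in>Basis. act M X (act M Y (?x b)) p * act M (?E b) f p)
      + (\<Sum>b\<in>Basis. act M Y (?x b) p * act M X (act M (?E b) f) p)"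
    by (simp add: sum.distrib mult.commute add.commute)
  also have "(\<Sum>b\<in>Basis. act M Y (?x b) p * act M X (act M (?E b) f) p) =
    (\<Sum>b\<in>Basis. \<Sum>c\<in>Basis. act M Y (?x b) p * act M X (?x c) p * act M (?E c) (act M (?E b) f) p)"
    by (subst act_coord_expansion[OF chart pV, of X]) (simp add: sum_distrib_left mult.assoc)
  finally show ?thesis .
qed

text \<open>
  The second-order parts of \<open>X Y f\<close> and \<open>Y X f\<close> cancel, so the
  commutator is represented by the tangent vector with components \<open>X(Y x\<^sub>b) -
  Y(X x\<^sub>b)\<close>; the coordinate functions leave no other choice. Thus the definite
  description in the definition of the bracket denotes.
\<close>

lemma ext_d_lie_bracket:
  assumes U: "openin (mtop M) U" "p \<in> U" and X: "smooth_field M U X" and Y: "smooth_field M U Y"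
    and W: "openin (mtop M) W" "p \<in> W" and f: "smooth_fun M W f"
  shows "blinfun_apply (ext_d M f p) (lie_bracket M X Y p) = act M X (act M Y f) p - act M Y (act M X f) p"
proof -
  have pp: "p \<in> points M" using U open_subset_points by blast
  obtain V \<phi> where chart: "(V, \<phi>) \<in> charts M" and pV: "p \<in> V" using coord_chart[OF pp] by blast
  let ?x = "\<lambda>b q. \<phi> q \<bullet> b" and ?E = "coord_field M V \<phi>"
  define w where "w = (\<Sum>b\<in>Basis. (act M X (act M Y (?x b)) p - act M Y (act M X (?x b)) p) *\<^sub>R ?E b p)"
  have w: "blinfun_apply (ext_d M f p) w = act M X (act M Y f) p - act M Y (act M X f) p"
    if W: "openin (mtop M) W" "p \<in> W" and f: "smooth_fun M W f" for W f
  proof -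
    define N where "N = U \<inter> V \<inter> W"
    have N: "openin (mtop M) N" "N \<subseteq> V" "p \<in> N" "N \<subseteq> U" "N \<subseteq> W"
      using U W pV chart_open[OF chart] by (auto simp: N_def)
    note fN = smooth_fun_subset[OF f N(5)]
    note e = act_coord_expansion2[OF chart N(1-3) smooth_field_subset[OF Y N(4)] fN, of X]
      act_coord_expansion2[OF chart N(1-3) smooth_field_subset[OF X N(4)] fN, of Y]
    have "(\<Sum>b\<in>Basis. \<Sum>c\<in>Basis. act M Y (?x b) p * act M X (?x c) p * act M (?E c) (act M (?E b) f) p) =
      (\<Sum>b\<in>Basis. \<Sum>c\<in>Basis. act M X (?x b) p * act M Y (?x c) p * act M (?E c) (act M (?E b) f) p)"
      (is "?l = ?r")
    proof -
      have "?l = (\<Sum>c\<in>Basis. \<Sum>b\<in>Basis. act M X (?x c) p * act M Y (?x b) p * act M (?E b) (act M (?E c) f) p)"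
        by (subst sum.swap, intro sum.cong refl) (metis coord_fields_commute[OF chart fN N(1-3)] mult.commute)
      then show ?thesis .
    qed
    then show ?thesis
      unfolding w_def e
      by (simp add: blinfun.sum_right blinfun.scaleR_right act_ext_d[of M "?E _"]
          left_diff_distrib sum_subtractf)
  qed
  have "lie_bracket M X Y p = w"
    unfolding lie_bracket_def
  proof (rule the_equality)
    show "\<forall>U f. openin (mtop M) U \<and> p \<in> U \<and> smooth_fun M U f \<longrightarrow>
        blinfun_apply (ext_d M f p) w = act M X (act M Y f) p - act M Y (act M X f) p"
      using w by blast
    fix w' assume w': "\<forall>U f. openin (mtop M) U \<and> p \<in> U \<and> smooth_fun M U f \<longrightarrow>
        blinfun_apply (ext_d M f p) w' = act M X (act M Y f) p - act M Y (act M X f) p"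
    have "blinfun_apply (ext_d M (?x b) p) w' = blinfun_apply (ext_d M (?x b) p) w" for b
      using w'[rule_format, of V "?x b"] w[OF chart_open[OF chart] pV smooth_fun_coordinate[OF chart]]
        chart_open[OF chart] pV smooth_fun_coordinate[OF chart] by simp
    then show "w' = w"
      using tangent_resolution[OF chart pV, of w] tangent_resolution[OF chart pV, of w'] by simp
  qed
  then show ?thesis using w[OF W f] by simp
qed

text \<open>
  The form \<open>d(X g)\<close> satisfies the defining equation by
  \<open>ext_d_lie_bracket\<close>, and testing against coordinate fields determines the
  solution.
\<close>

lemma lie_deriv_exact:
  assumes U: "openin (mtop M) U" "p \<in> U" and X: "smooth_field M U X" and g: "smooth_fun M U g"
  shows "lie_deriv M X (ext_d M g) p = ext_d M (act M X g) p"
  unfolding lie_deriv_def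
proof (rule the_equality)
  show *: "\<forall>W Y. openin (mtop M) W \<and> p \<in> W \<and> smooth_field M W Y \<longrightarrow>
    blinfun_apply (ext_d M (act M X g) p) (Y p) =
      act M X (\<lambda>q. blinfun_apply (ext_d M g q) (Y q)) p - blinfun_apply (ext_d M g p) (lie_bracket M X Y p)"
  proof (intro allI impI, elim conjE)
    fix W Y assume W: "openin (mtop M) W" "p \<in> W" and Y: "smooth_field M W Y"
    have "blinfun_apply (ext_d M g p) (lie_bracket M X Y p) = act M X (act M Y g) p - act M Y (act M X g) p"
      by (rule ext_d_lie_bracket[where U = "U \<inter> W" and W = U])
        (use U W smooth_field_subset[OF X] smooth_field_subset[OF Y] g in auto)
    then show "blinfun_apply (ext_d M (act M X g) p) (Y p) =
      act M X (\<lambda>q. blinfun_apply (ext_d M g q) (Y q)) p - blinfun_apply (ext_d M g p) (lie_bracket M X Y p)"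
      unfolding act_fun_eq by (simp add: act_def)
  qed
  fix \<alpha> assume \<alpha>: "\<forall>W Y. openin (mtop M) W \<and> p \<in> W \<and> smooth_field M W Y \<longrightarrow>
    blinfun_apply \<alpha> (Y p) =
      act M X (\<lambda>q. blinfun_apply (ext_d M g q) (Y q)) p - blinfun_apply (ext_d M g p) (lie_bracket M X Y p)"
  have pp: "p \<in> points M" using U open_subset_points by blast
  obtain V \<phi> where chart: "(V, \<phi>) \<in> charts M" and pV: "p \<in> V" using coord_chart[OF pp] by blast
  have "blinfun_apply \<alpha> (coord_field M V \<phi> b p) = blinfun_apply (ext_d M (act M X g) p) (coord_field M V \<phi> b p)" for b
    using \<alpha>[rule_format, of V "coord_field M V \<phi> b"] *[rule_format, of V "coord_field M V \<phi> b"]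
      smooth_field_coord_field[OF chart] chart_open[OF chart] pV by simp
  then show "\<alpha> = ext_d M (act M X g) p"
    using covector_resolution[OF chart pV, of \<alpha>]
      covector_resolution[OF chart pV, of "ext_d M (act M X g) p"] by simp
qed

end

section \<open>Bivector fields and the bracket of one-forms\<close>

locale bivector_atlas = atlas M for M :: "('a, 'e::euclidean_space) manifold" +
  fixes P :: "('a, 'e) cotensor"
  assumes bivector: "bivector_field M P"
begin

lemma bivector_bilinear: "p \<in> points M \<Longrightarrow> bilinear (P p)"
  and bivector_skew: "p \<in> points M \<Longrightarrow> P p \<alpha> \<beta> = - P p \<beta> \<alpha>"
  using bivector unfolding bivector_field_def by blast+

text \<open>
  Finite-dimensional duality: the vector is built from the values of \<open>P p (\<omega>
  p)\<close> on the basis dual to \<open>Basis\<close>.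
\<close>

lemma sharp_apply:
  assumes p: "p \<in> points M"
  shows "blinfun_apply \<eta> (sharp P \<omega> p) = P p (\<omega> p) \<eta>"
proof -
  have lin: "linear (P p (\<omega> p))" using bivector_bilinear[OF p] unfolding bilinear_def by blast
  define w where "w = (\<Sum>b\<in>Basis. P p (\<omega> p) (blinfun_inner_left b) *\<^sub>R b)"
  have w: "blinfun_apply \<eta> w = P p (\<omega> p) \<eta>" for \<eta>
  proof -
    have "\<eta> = (\<Sum>b\<in>Basis. blinfun_apply \<eta> b *\<^sub>R blinfun_inner_left b)"
    proof (rule blinfun_eqI)
      fix v
      have "blinfun_apply \<eta> v = blinfun_apply \<eta> (\<Sum>b\<in>Basis. (v \<bullet> b) *\<^sub>R b)"
        by (simp add: euclidean_representation)
      then show "blinfun_apply \<eta> v =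
          blinfun_apply (\<Sum>b\<in>Basis. blinfun_apply \<eta> b *\<^sub>R blinfun_inner_left b) v"
        by (simp add: blinfun.sum_right blinfun.sum_left blinfun.scaleR_left blinfun.scaleR_right
            mult.commute inner_commute)
    qed
    then have "P p (\<omega> p) \<eta> = P p (\<omega> p) (\<Sum>b\<in>Basis. blinfun_apply \<eta> b *\<^sub>R blinfun_inner_left b)"
      by simp
    then show ?thesis
      by (simp add: w_def linear_sum[OF lin] linear_cmul[OF lin] blinfun.sum_right
          blinfun.scaleR_right mult.commute)
  qed
  have "sharp P \<omega> p = w"
    unfolding sharp_def
  proof (rule the_equality)
    show "\<forall>\<eta>. blinfun_apply \<eta> w = P p (\<omega> p) \<eta>" using w by blast
    fix w' assume w': "\<forall>\<eta>. blinfun_apply \<eta> w' = P p (\<omega> p) \<eta>"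
    show "w' = w"
    proof (rule euclidean_eqI)
      fix b :: 'e
      have "blinfun_apply (blinfun_inner_left b) w' = blinfun_apply (blinfun_inner_left b) w"
        using w[of "blinfun_inner_left b"] w'[rule_format, of "blinfun_inner_left b"] by (rule trans[OF _ sym, rotated])
      then show "w' \<bullet> b = w \<bullet> b" by (simp add: inner_commute)
    qed
  qed
  then show ?thesis using w by simp
qed

lemma act_sharp: "p \<in> points M \<Longrightarrow> act M (sharp P \<omega>) f p = P p (\<omega> p) (ext_d M f p)"
  by (simp add: act_def sharp_apply)

lemma smooth_fun_bivector:
  "openin (mtop M) U \<Longrightarrow> smooth_form M U \<omega> \<Longrightarrow> smooth_form M U \<eta> \<Longrightarrow> smooth_fun M U (\<lambda>p. P p (\<omega> p) (\<eta> p))"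
  using bivector unfolding bivector_field_def by blast

lemma smooth_field_sharp:
  assumes \<omega>: "smooth_form M U \<omega>"
  shows "smooth_field M U (sharp P \<omega>)"
  unfolding smooth_field_def
proof (intro allI impI, elim conjE)
  fix V f assume V: "openin (mtop M) V" "V \<subseteq> U" and f: "smooth_fun M V f"
  have "smooth_fun M V (\<lambda>p. P p (\<omega> p) (ext_d M f p))"
    by (rule smooth_fun_bivector[OF V(1) smooth_form_subset[OF \<omega> V(2)] smooth_form_ext_d[OF V(1) f]])
  then show "smooth_fun M V (act M (sharp P \<omega>) f)"
    by (rule smooth_fun_cong[OF V(1), rotated]) (simp add: act_sharp open_subset_points[OF V(1)])
qed

lemma smooth_act_sharp:
  "openin (mtop M) U \<Longrightarrow> smooth_form M U \<omega> \<Longrightarrow> smooth_fun M U f \<Longrightarrow> smooth_fun M U (act M (sharp P \<omega>) f)"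
  using smooth_field_sharp unfolding smooth_field_def by blast

abbreviation pb :: "('a \<Rightarrow> real) \<Rightarrow> ('a \<Rightarrow> real) \<Rightarrow> 'a \<Rightarrow> real" where
  "pb \<equiv> biderivation M P"

lemma smooth_pb:
  "openin (mtop M) U \<Longrightarrow> smooth_fun M U f \<Longrightarrow> smooth_fun M U g \<Longrightarrow> smooth_fun M U (pb f g)"
  unfolding biderivation_def[abs_def] by (intro smooth_fun_bivector smooth_form_ext_d)

lemma act_sharp_exact: "p \<in> points M \<Longrightarrow> act M (sharp P (ext_d M f)) g p = pb f g p"
  by (simp add: act_sharp biderivation_def)

lemma pb_skew: "p \<in> points M \<Longrightarrow> pb f g p = - pb g f p"
  unfolding biderivation_def by (rule bivector_skew)

lemma pb_cong:
  assumes "openin (mtop M) U" "smooth_fun M U f" "smooth_fun M U g" "p \<in> U"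
    and "\<And>q. q \<in> U \<Longrightarrow> f q = f' q" "\<And>q. q \<in> U \<Longrightarrow> g q = g' q"
  shows "pb f' g' p = pb f g p"
  using ext_d_cong[of U f p f'] ext_d_cong[of U g p g'] assms by (simp add: biderivation_def)

lemma pb_uminus_right:
  assumes "openin (mtop M) U" "smooth_fun M U g" "p \<in> U"
  shows "pb f (\<lambda>q. - g q) p = - pb f g p"
  using bilinear_rneg[OF bivector_bilinear[OF open_subset_points[OF assms(1,3)]]]
    ext_d_uminus[OF assms] by (simp add: biderivation_def)

text \<open>
  The two Lie derivatives contribute \<open>d{f, g}\<close> each, and the last term of the
  bracket removes one of them.
\<close>

lemma form_bracket_exact:
  assumes U: "openin (mtop M) U" and f: "smooth_fun M U f" and g: "smooth_fun M U g" and p: "p \<in> U"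
  shows "form_bracket M P (ext_d M f) (ext_d M g) p = ext_d M (pb f g) p"
proof -
  have l: "lie_deriv M (sharp P (ext_d M f)) (ext_d M g) p = ext_d M (pb f g) p"
    if f: "smooth_fun M U f" and g: "smooth_fun M U g" for f g
  proof -
    have "lie_deriv M (sharp P (ext_d M f)) (ext_d M g) p = ext_d M (act M (sharp P (ext_d M f)) g) p"
      by (rule lie_deriv_exact[OF U p smooth_field_sharp[OF smooth_form_ext_d[OF U f]] g])
    also have "\<dots> = ext_d M (pb f g) p"
      by (rule ext_d_cong[OF smooth_pb[OF U f g] U p])
        (simp add: act_sharp_exact open_subset_points[OF U])
    finally show ?thesis .
  qed
  have "ext_d M (pb g f) p = ext_d M (\<lambda>q. - pb f g q) p"
    by (rule ext_d_cong[OF smooth_fun_uminus[OF U smooth_pb[OF U f g]] U p])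
      (metis pb_skew open_subset_points[OF U])
  also have "\<dots> = - ext_d M (pb f g) p"
    by (rule ext_d_uminus[OF U smooth_pb[OF U f g] p])
  finally show ?thesis
    unfolding form_bracket_def l[OF f g] l[OF g f] by (simp add: biderivation_def[abs_def])
qed

definition jacobiator :: "('a \<Rightarrow> real) \<Rightarrow> ('a \<Rightarrow> real) \<Rightarrow> ('a \<Rightarrow> real) \<Rightarrow> 'a \<Rightarrow> real" where
  "jacobiator f g h p = pb f (pb g h) p + pb g (pb h f) p + pb h (pb f g) p"

lemma jacobiator_cycle: "jacobiator f g h p = jacobiator g h f p"
  by (simp add: jacobiator_def)

text \<open>
  The two insertions in the Schouten bracket coincide, which gives the factor 2; reordering
  the arguments of each double bracket into the cyclic form gives the sign.
\<close>

lemma schouten_jacobiator: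
  assumes U: "openin (mtop M) U" and s: "smooth_fun M U f" "smooth_fun M U g" "smooth_fun M U h" and p: "p \<in> U"
  shows "schouten M P P f g h p = - 2 * jacobiator f g h p"
proof -
  note pp = open_subset_points[OF U p]
  have "pb g (pb h f) p = pb g (\<lambda>q. - pb f h q) p"
    by (rule pb_cong[OF U s(2) _ p])
      (auto intro: smooth_fun_uminus[OF U] smooth_pb[OF U] s pb_skew[symmetric] open_subset_points[OF U]
        simp: pb_skew[of _ h f])
  also have "\<dots> = - pb g (pb f h) p" by (rule pb_uminus_right[OF U smooth_pb[OF U s(1,3)] p])
  finally show ?thesis
    using pb_skew[OF pp, of h "pb f g"] pb_skew[OF pp, of g "pb f h"] pb_skew[OF pp, of f "pb g h"]
    by (simp add: schouten_def insertion_def jacobiator_def)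
qed

end

section \<open>Curvature of a contravariant Levi-Civita connection\<close>

locale levi_civita_atlas = bivector_atlas M P for M :: "('a, 'e::euclidean_space) manifold" and P +
  fixes G :: "('a, 'e) cotensor"
    and D :: "('a, 'e) one_form \<Rightarrow> ('a, 'e) one_form \<Rightarrow> ('a, 'e) one_form"
  assumes levi_civita: "levi_civita M G P D"
    and cometric_bilinear: "p \<in> points M \<Longrightarrow> bilinear (G p)"
    and cometric_sym: "p \<in> points M \<Longrightarrow> G p \<alpha> \<beta> = G p \<beta> \<alpha>"
begin

lemmas connection = levi_civita[unfolded levi_civita_def contravariant_connection_def]
lemmas connection_smooth = connection[THEN conjunct1, THEN conjunct1, rule_format]
lemmas connection_linear = connection[THEN conjunct1, THEN conjunct2, THEN conjunct1, rule_format]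
lemmas connection_leibniz =
  connection[THEN conjunct1, THEN conjunct2, THEN conjunct2, THEN conjunct1, rule_format]
lemmas connection_local =
  connection[THEN conjunct1, THEN conjunct2, THEN conjunct2, THEN conjunct2, rule_format]
lemmas connection_torsion = connection[THEN conjunct2, THEN conjunct1, rule_format]
lemmas connection_metric = connection[THEN conjunct2, THEN conjunct2, rule_format]

text \<open>
  By torsion-freeness this is the bracket of one-forms (\<open>torsion_free\<close>).
  Defined through the connection, it inherits smoothness, additivity and the Leibniz rule
  from the connection axioms, and Lie derivatives are needed on exact forms only.
\<close>

definition br :: "('a, 'e) one_form \<Rightarrow> ('a, 'e) one_form \<Rightarrow> ('a, 'e) one_form" where
  "br \<omega> \<eta> q = D \<omega> \<eta> q - D \<eta> \<omega> q"

definition jac :: "('a, 'e) one_form \<Rightarrow> ('a, 'e) one_form \<Rightarrow> ('a, 'e) one_form \<Rightarrow> ('a, 'e) one_form" where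
  "jac x y z p = br x (br y z) p + br y (br z x) p + br z (br x y) p"

text \<open>
  How far the sharp map is from turning the bracket of forms into the commutator of vector
  fields. It is the obstruction to tensoriality both of the Jacobi expression and of the
  curvature in its third argument.
\<close>

definition anchor_defect :: "('a, 'e) one_form \<Rightarrow> ('a, 'e) one_form \<Rightarrow> ('a \<Rightarrow> real) \<Rightarrow> 'a \<Rightarrow> real" where
  "anchor_defect x y f p = act M (sharp P x) (act M (sharp P y) f) p
     - act M (sharp P y) (act M (sharp P x) f) p - act M (sharp P (br x y)) f p"

abbreviation R where "R \<equiv> curvature M P D"

lemma br_skew: "br x y p = - br y x p"
  by (simp add: br_def)

lemma jac_cycle: "jac x y z p = jac y z x p"
  by (simp add: jac_def)

context
  fixes U assumes U: "openin (mtop M) U"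
begin

lemmas pts = open_subset_points[OF U]

abbreviation form where "form \<equiv> smooth_form M U"
abbreviation func where "func \<equiv> smooth_fun M U"

lemma D_form: "form x \<Longrightarrow> form y \<Longrightarrow> form (D x y)"
  using connection_smooth[of U] U by simp

lemma D_lincomb_left: "form x \<Longrightarrow> form y \<Longrightarrow> form z \<Longrightarrow> p \<in> U \<Longrightarrow>
    D (\<lambda>q. a *\<^sub>R x q + b *\<^sub>R y q) z p = a *\<^sub>R D x z p + b *\<^sub>R D y z p"
  and D_lincomb_right: "form x \<Longrightarrow> form y \<Longrightarrow> form z \<Longrightarrow> p \<in> U \<Longrightarrow>
    D z (\<lambda>q. a *\<^sub>R x q + b *\<^sub>R y q) p = a *\<^sub>R D z x p + b *\<^sub>R D z y p"
  using connection_linear[of U x y z p a b] U by simp_all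

lemma D_scale_left: "func f \<Longrightarrow> form x \<Longrightarrow> form y \<Longrightarrow> p \<in> U \<Longrightarrow> D (\<lambda>q. f q *\<^sub>R x q) y p = f p *\<^sub>R D x y p"
  and D_scale_right: "func f \<Longrightarrow> form x \<Longrightarrow> form y \<Longrightarrow> p \<in> U \<Longrightarrow>
    D x (\<lambda>q. f q *\<^sub>R y q) p = f p *\<^sub>R D x y p + act M (sharp P x) f p *\<^sub>R y p"
  using connection_leibniz[of U f x y p] U by simp_all

lemma D_cong: "form x \<Longrightarrow> form y \<Longrightarrow> (\<And>q. q \<in> U \<Longrightarrow> x' q = x q) \<Longrightarrow> (\<And>q. q \<in> U \<Longrightarrow> y' q = y q) \<Longrightarrow>
    p \<in> U \<Longrightarrow> D x' y' p = D x y p"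
  using connection_local[of U x y x' y' p] U by simp

lemma torsion_free: "form x \<Longrightarrow> form y \<Longrightarrow> p \<in> U \<Longrightarrow> form_bracket M P x y p = br x y p"
  using connection_torsion[of U x y p] U unfolding br_def by simp

lemma metric_compatible: "form x \<Longrightarrow> form y \<Longrightarrow> form z \<Longrightarrow> p \<in> U \<Longrightarrow>
    act M (sharp P x) (\<lambda>q. G q (y q) (z q)) p = G p (D x y p) (z p) + G p (y p) (D x z p)"
  using connection_metric[of U x y z p] U by simp

lemma D_add_left: "form x \<Longrightarrow> form y \<Longrightarrow> form z \<Longrightarrow> p \<in> U \<Longrightarrow>
    D (\<lambda>q. x q + y q) z p = D x z p + D y z p"
  and D_add_right: "form x \<Longrightarrow> form y \<Longrightarrow> form z \<Longrightarrow> p \<in> U \<Longrightarrow>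
    D z (\<lambda>q. x q + y q) p = D z x p + D z y p"
  using D_lincomb_left[of x y z p 1 1] D_lincomb_right[of x y z p 1 1] by simp_all

lemma D_diff_left: "form x \<Longrightarrow> form y \<Longrightarrow> form z \<Longrightarrow> p \<in> U \<Longrightarrow>
    D (\<lambda>q. x q - y q) z p = D x z p - D y z p"
  and D_diff_right: "form x \<Longrightarrow> form y \<Longrightarrow> form z \<Longrightarrow> p \<in> U \<Longrightarrow>
    D z (\<lambda>q. x q - y q) p = D z x p - D z y p"
  using D_lincomb_left[of x y z p 1 "-1"] D_lincomb_right[of x y z p 1 "-1"] by simp_all

lemma br_form: "form x \<Longrightarrow> form y \<Longrightarrow> form (br x y)"
  unfolding br_def[abs_def] by (intro smooth_form_diff[OF U] D_form)

lemma br_cong: "form x \<Longrightarrow> form y \<Longrightarrow> (\<And>q. q \<in> U \<Longrightarrow> x' q = x q) \<Longrightarrow> (\<And>q. q \<in> U \<Longrightarrow> y' q = y q) \<Longrightarrow>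
    p \<in> U \<Longrightarrow> br x' y' p = br x y p"
  unfolding br_def using D_cong[of x y x' y' p] D_cong[of y x y' x' p] by simp

lemma br_add_left: "form x \<Longrightarrow> form y \<Longrightarrow> form z \<Longrightarrow> p \<in> U \<Longrightarrow>
    br (\<lambda>q. x q + y q) z p = br x z p + br y z p"
  and br_add_right: "form x \<Longrightarrow> form y \<Longrightarrow> form z \<Longrightarrow> p \<in> U \<Longrightarrow>
    br z (\<lambda>q. x q + y q) p = br z x p + br z y p"
  unfolding br_def by (simp_all add: D_add_left D_add_right)

lemma br_diff_right: "form x \<Longrightarrow> form y \<Longrightarrow> form z \<Longrightarrow> p \<in> U \<Longrightarrow>
    br z (\<lambda>q. x q - y q) p = br z x p - br z y p"
  unfolding br_def by (simp add: D_diff_left D_diff_right)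

lemma br_scale_left: "func f \<Longrightarrow> form x \<Longrightarrow> form y \<Longrightarrow> p \<in> U \<Longrightarrow>
    br (\<lambda>q. f q *\<^sub>R x q) y p = f p *\<^sub>R br x y p - act M (sharp P y) f p *\<^sub>R x p"
  and br_scale_right: "func f \<Longrightarrow> form x \<Longrightarrow> form y \<Longrightarrow> p \<in> U \<Longrightarrow>
    br y (\<lambda>q. f q *\<^sub>R x q) p = f p *\<^sub>R br y x p + act M (sharp P y) f p *\<^sub>R x p"
  unfolding br_def by (simp_all add: D_scale_left D_scale_right algebra_simps)

lemma br_exact: "func f \<Longrightarrow> func g \<Longrightarrow> p \<in> U \<Longrightarrow> br (ext_d M f) (ext_d M g) p = ext_d M (pb f g) p"
  using torsion_free[of "ext_d M f" "ext_d M g" p] form_bracket_exact[OF U]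
  by (simp add: smooth_form_ext_d[OF U])

lemma jac_cong:
  assumes "form x" "form y" "form z" "\<And>q. q \<in> U \<Longrightarrow> x' q = x q" "\<And>q. q \<in> U \<Longrightarrow> y' q = y q"
    "\<And>q. q \<in> U \<Longrightarrow> z' q = z q" "p \<in> U"
  shows "jac x' y' z' p = jac x y z p"
  unfolding jac_def
  using br_cong[OF assms(1) br_form[OF assms(2,3)] assms(4) br_cong[OF assms(2,3,5,6)] assms(7)]
    br_cong[OF assms(2) br_form[OF assms(3,1)] assms(5) br_cong[OF assms(3,1,6,4)] assms(7)]
    br_cong[OF assms(3) br_form[OF assms(1,2)] assms(6) br_cong[OF assms(1,2,4,5)] assms(7)]
  by simp

lemma jac_add:
  assumes "form x" "form x'" "form y" "form z" "p \<in> U"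
  shows "jac (\<lambda>q. x q + x' q) y z p = jac x y z p + jac x' y z p"
proof -
  have "br y (br z (\<lambda>q. x q + x' q)) p = br y (\<lambda>q. br z x q + br z x' q) p"
    by (rule br_cong) (use assms in \<open>auto intro: smooth_form_add[OF U] br_form br_add_right\<close>)
  moreover have "br z (br (\<lambda>q. x q + x' q) y) p = br z (\<lambda>q. br x y q + br x' y q) p"
    by (rule br_cong) (use assms in \<open>auto intro: smooth_form_add[OF U] br_form br_add_left\<close>)
  ultimately show ?thesis
    using assms by (simp add: jac_def br_add_left br_add_right br_form algebra_simps)
qed

lemma jac_scale:
  assumes f: "func f" and x: "form x" and y: "form y" and z: "form z" and p: "p \<in> U"
  shows "jac (\<lambda>q. f q *\<^sub>R x q) y z p = f p *\<^sub>R jac x y z p + anchor_defect y z f p *\<^sub>R x p"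
proof -
  have s: "func (act M (sharp P y) f)" "func (act M (sharp P z) f)"
    using smooth_act_sharp[OF U] f y z by blast+
  have 1: "br y (br z (\<lambda>q. f q *\<^sub>R x q)) p =
      br y (\<lambda>q. f q *\<^sub>R br z x q + act M (sharp P z) f q *\<^sub>R x q) p"
    by (rule br_cong) (use f x y z s p in
        \<open>auto intro!: smooth_form_add[OF U] smooth_form_scale[OF U] br_form br_scale_right\<close>)
  have 2: "br z (br (\<lambda>q. f q *\<^sub>R x q) y) p =
      br z (\<lambda>q. f q *\<^sub>R br x y q - act M (sharp P y) f q *\<^sub>R x q) p"
    by (rule br_cong) (use f x y z s p in
        \<open>auto intro!: smooth_form_diff[OF U] smooth_form_scale[OF U] br_form br_scale_left\<close>)
  show ?thesis
    unfolding jac_def anchor_defect_def 1 2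
    using f x y z p s br_skew[of z x p] br_skew[of y x p]
    by (simp add: br_scale_left br_scale_right br_add_right br_diff_right br_form
        smooth_form_scale[OF U] algebra_simps)
qed

lemma sharp_scale: "p \<in> points M \<Longrightarrow> act M (sharp P (\<lambda>q. f q *\<^sub>R x q)) g p = f p * act M (sharp P x) g p"
  using bilinear_lmul[OF bivector_bilinear] by (simp add: act_sharp)

lemma sharp_diff: "p \<in> points M \<Longrightarrow>
    act M (sharp P (\<lambda>q. x q - y q)) g p = act M (sharp P x) g p - act M (sharp P y) g p"
  using bilinear_lsub[OF bivector_bilinear] by (simp add: act_sharp)

lemma anchor_defect_skew: "p \<in> U \<Longrightarrow> anchor_defect x y f p = - anchor_defect y x f p"
  using sharp_scale[OF pts, of p "\<lambda>q. -1" "br y x" f]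
  by (simp add: anchor_defect_def act_sharp pts br_skew[of x y])

lemma anchor_defect_scale:
  assumes u: "func u" and f: "func f" and x: "form x" and y: "form y" and p: "p \<in> U"
  shows "anchor_defect (\<lambda>q. u q *\<^sub>R x q) y f p = u p * anchor_defect x y f p"
proof -
  have s: "func (act M (sharp P x) f)" using smooth_act_sharp[OF U] f x by blast
  have "act M (sharp P y) (act M (sharp P (\<lambda>q. u q *\<^sub>R x q)) f) p =
      act M (sharp P y) (\<lambda>q. u q * act M (sharp P x) f q) p"
    unfolding act_def[of M "sharp P y"]
    using ext_d_cong[of U "\<lambda>q. u q * act M (sharp P x) f q" p "act M (sharp P (\<lambda>q. u q *\<^sub>R x q)) f"]
      smooth_fun_mult[OF U u s] U p by (simp add: sharp_scale pts)
  also have "\<dots> = u p * act M (sharp P y) (act M (sharp P x) f) p + act M (sharp P y) u p * act M (sharp P x) f p"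
    unfolding act_def[of M "sharp P y"] ext_d_mult[OF U u s p]
    by (simp add: blinfun.add_left blinfun.scaleR_left)
  finally have 1: "act M (sharp P y) (act M (sharp P (\<lambda>q. u q *\<^sub>R x q)) f) p = \<dots>" .
  have "act M (sharp P (br (\<lambda>q. u q *\<^sub>R x q) y)) f p =
      act M (sharp P (\<lambda>q. u q *\<^sub>R br x y q - act M (sharp P y) u q *\<^sub>R x q)) f p"
    using br_scale_left[OF u x y p] by (simp add: act_sharp pts p)
  also have "\<dots> = u p * act M (sharp P (br x y)) f p - act M (sharp P y) u p * act M (sharp P x) f p"
    by (simp add: sharp_diff sharp_scale pts p)
  finally show ?thesis
    unfolding anchor_defect_def 1 by (simp add: sharp_scale pts p algebra_simps)
qed

lemma anchor_defect_scale_right: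
  assumes u: "func u" and f: "func f" and x: "form x" and y: "form y" and p: "p \<in> U"
  shows "anchor_defect x (\<lambda>q. u q *\<^sub>R y q) f p = u p * anchor_defect x y f p"
  using anchor_defect_scale[OF u f y x p] anchor_defect_skew[OF p, of x] by simp

text \<open>
  On exact forms, \<open>\<sharp>(df)\<close> acts as the bracket with \<open>f\<close>, so
  all three terms are double brackets.
\<close>

lemma anchor_defect_exact:
  assumes f: "func f" and x: "func x" and y: "func y" and p: "p \<in> U"
  shows "anchor_defect (ext_d M x) (ext_d M y) f p = jacobiator x y f p"
proof -
  have 1: "act M (sharp P (ext_d M x)) (act M (sharp P (ext_d M y)) f) p = pb x (pb y f) p"
    if x: "func x" and y: "func y" for x y
    unfolding act_sharp_exact[OF pts[OF p]]
    by (rule pb_cong[OF U x smooth_pb[OF U y f] p]) (simp_all add: act_sharp_exact pts)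
  have "pb y (pb x f) p = pb y (\<lambda>q. - pb f x q) p"
    by (rule pb_cong[OF U y smooth_fun_uminus[OF U smooth_pb[OF U f x]] p])
      (auto simp: pb_skew[of _ x f] pts)
  also have "\<dots> = - pb y (pb f x) p" by (rule pb_uminus_right[OF U smooth_pb[OF U f x] p])
  finally have 2: "pb y (pb x f) p = - pb y (pb f x) p" .
  have "act M (sharp P (br (ext_d M x) (ext_d M y))) f p = act M (sharp P (ext_d M (pb x y))) f p"
    using br_exact[OF x y p] by (simp add: act_sharp pts p)
  also have "\<dots> = - pb f (pb x y) p"
    using pb_skew[OF pts[OF p], of f "pb x y"] by (simp add: act_sharp_exact pts p)
  finally show ?thesis
    unfolding anchor_defect_def 1[OF x y] 1[OF y x] 2 by (simp add: jacobiator_def)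
qed

lemma jac_exact:
  assumes x: "func x" and y: "func y" and z: "func z" and p: "p \<in> U"
  shows "jac (ext_d M x) (ext_d M y) (ext_d M z) p = ext_d M (jacobiator x y z) p"
proof -
  have 1: "br (ext_d M x) (br (ext_d M y) (ext_d M z)) p = ext_d M (pb x (pb y z)) p"
    if x: "func x" and y: "func y" and z: "func z" for x y z
  proof -
    have "br (ext_d M x) (br (ext_d M y) (ext_d M z)) p = br (ext_d M x) (ext_d M (pb y z)) p"
      by (rule br_cong) (auto intro: smooth_form_ext_d[OF U] smooth_pb[OF U] x y z p br_exact)
    then show ?thesis using br_exact[OF x smooth_pb[OF U y z] p] by simp
  qed
  show ?thesis
    unfolding jac_def jacobiator_def[abs_def] 1[OF x y z] 1[OF y z x] 1[OF z x y]
    by (simp add: ext_d_add[OF U] smooth_fun_add[OF U] smooth_pb[OF U] x y z p)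
qed

text \<open>
  The coefficients \<open>c\<close>, \<open>b\<close>, \<open>a\<close> are attached one
  after the other, rotating the arguments so that \<open>jac_scale\<close> applies to the
  first one. Each step produces an anchor defect of exact forms, that is, one of the assumed
  Jacobiators.
\<close>

lemma jac_simple_terms:
  assumes f: "func x" "func y" "func z" "func a" "func b" "func c"
    and J: "\<And>q. q \<in> U \<Longrightarrow> jacobiator x y z q = 0" "\<And>q. q \<in> U \<Longrightarrow> jacobiator a y z q = 0"
      "\<And>q. q \<in> U \<Longrightarrow> jacobiator x b z q = 0" "\<And>q. q \<in> U \<Longrightarrow> jacobiator x y c q = 0"
    and p: "p \<in> U"
  shows "jac (\<lambda>q. a q *\<^sub>R ext_d M x q) (\<lambda>q. b q *\<^sub>R ext_d M y q) (\<lambda>q. c q *\<^sub>R ext_d M z q) p = 0"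
proof -
  note s = smooth_form_ext_d[OF U] smooth_form_scale[OF U]
  let ?y = "\<lambda>q. b q *\<^sub>R ext_d M y q" and ?z = "\<lambda>q. c q *\<^sub>R ext_d M z q"
  have "ext_d M (jacobiator x y z) p = ext_d M (\<lambda>q. 0) p"
    by (rule ext_d_cong[OF smooth_fun_const U p]) (simp add: J)
  then have 0: "jac (ext_d M z) (ext_d M x) (ext_d M y) p = 0"
    using jac_exact[OF f(1-3) p] jac_cycle[of "ext_d M z"] by simp
  have "jac ?z (ext_d M x) (ext_d M y) p = 0"
    using jac_scale[of c "ext_d M z" "ext_d M x" "ext_d M y" p] f s p J(4)
    by (simp add: 0 anchor_defect_exact)
  then have 1: "jac (ext_d M y) ?z (ext_d M x) p = 0" using jac_cycle by metis
  have "anchor_defect ?z (ext_d M x) b p = 0"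
    using f s p J(3)[OF p] jacobiator_cycle[of z x b p] jacobiator_cycle[of x b z p]
    by (simp add: anchor_defect_scale anchor_defect_exact)
  then have "jac ?y ?z (ext_d M x) p = 0"
    using jac_scale[of b "ext_d M y" ?z "ext_d M x" p] f s p by (simp add: 1)
  then have 2: "jac (ext_d M x) ?y ?z p = 0" using jac_cycle by metis
  have "anchor_defect ?y ?z a p = 0"
    using f s p J(2)[OF p] jacobiator_cycle[of a y z p] 
    by (simp add: anchor_defect_scale anchor_defect_scale_right anchor_defect_exact)
  then show ?thesis
    using jac_scale[of a "ext_d M x" ?y ?z p] f s p by (simp add: 2)
qed

lemma jac_zero_left: "form y \<Longrightarrow> form z \<Longrightarrow> p \<in> U \<Longrightarrow> jac (\<lambda>q. 0) y z p = 0"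
  using jac_add[of "\<lambda>q. 0" "\<lambda>q. 0" y z p] by (simp add: smooth_form_zero[OF U])

lemma jac_sum:
  assumes "\<And>i. i \<in> I \<Longrightarrow> form (x i)" "form y" "form z" "p \<in> U"
  shows "jac (\<lambda>q. \<Sum>i\<in>I. x i q) y z p = (\<Sum>i\<in>I. jac (x i) y z p)"
  using assms(1)
proof (induction I rule: infinite_finite_induct)
  case (insert i I)
  then show ?case
    using jac_add[of "x i" "\<lambda>q. \<Sum>i\<in>I. x i q" y z p] assms smooth_form_sum[OF U, of I x] by simp
qed (use jac_zero_left assms in auto)

text \<open>
  Near a point every form is a sum of terms \<open>a dx\<close>, so this reduces the Jacobi
  identity for forms to the one for functions, and only for functions that occur in the
  respective argument.
\<close>

lemma jac_vanishes:
  fixes x y z a b c :: "_ \<Rightarrow> 'a \<Rightarrow> real"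
  assumes x: "\<And>i. i \<in> I \<Longrightarrow> func (x i)" "\<And>i. i \<in> I \<Longrightarrow> func (a i)"
      "\<And>q. q \<in> U \<Longrightarrow> \<omega> q = (\<Sum>i\<in>I. a i q *\<^sub>R ext_d M (x i) q)"
    and y: "\<And>i. i \<in> J \<Longrightarrow> func (y i)" "\<And>i. i \<in> J \<Longrightarrow> func (b i)"
      "\<And>q. q \<in> U \<Longrightarrow> \<eta> q = (\<Sum>i\<in>J. b i q *\<^sub>R ext_d M (y i) q)"
    and z: "\<And>i. i \<in> K \<Longrightarrow> func (z i)" "\<And>i. i \<in> K \<Longrightarrow> func (c i)"
      "\<And>q. q \<in> U \<Longrightarrow> \<gamma> q = (\<Sum>i\<in>K. c i q *\<^sub>R ext_d M (z i) q)"
    and J: "\<And>i j k q. i \<in> I \<Longrightarrow> j \<in> J \<Longrightarrow> k \<in> K \<Longrightarrow> q \<in> U \<Longrightarrow>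
        jacobiator (x i) (y j) (z k) q = 0 \<and> jacobiator (a i) (y j) (z k) q = 0 \<and>
        jacobiator (x i) (b j) (z k) q = 0 \<and> jacobiator (x i) (y j) (c k) q = 0"
    and p: "p \<in> U"
  shows "jac \<omega> \<eta> \<gamma> p = 0"
proof -
  let ?x = "\<lambda>i q. a i q *\<^sub>R ext_d M (x i) q" and ?y = "\<lambda>i q. b i q *\<^sub>R ext_d M (y i) q"
    and ?z = "\<lambda>i q. c i q *\<^sub>R ext_d M (z i) q"
  note s = smooth_form_ext_d[OF U] smooth_form_scale[OF U] smooth_form_sum[OF U]
  let ?X = "\<lambda>q. \<Sum>i\<in>I. ?x i q" and ?Y = "\<lambda>q. \<Sum>i\<in>J. ?y i q" and ?Z = "\<lambda>q. \<Sum>i\<in>K. ?z i q"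
  have fx: "form (?x i)" if "i \<in> I" for i using x that s by auto
  have fy: "form (?y i)" if "i \<in> J" for i using y that s by auto
  have fz: "form (?z i)" if "i \<in> K" for i using z that s by auto
  have F: "form ?X" "form ?Y" "form ?Z"
    by (rule s(3), erule fx, rule s(3), erule fy, rule s(3), erule fz)
  have t: "jac (?x i) (?y j) (?z k) p = 0" if "i \<in> I" "j \<in> J" "k \<in> K" for i j k
    by (rule jac_simple_terms) (use that x y z J p in auto)
  have "jac (?x i) (?y j) ?Z p = 0" if ij: "i \<in> I" "j \<in> J" for i j
  proof -
    have "jac ?Z (?x i) (?y j) p = (\<Sum>k\<in>K. jac (?z k) (?x i) (?y j) p)"
      by (rule jac_sum[OF fz fx[OF ij(1)] fy[OF ij(2)] p])
    also have "\<dots> = 0" using t[OF ij] jac_cycle[of "?z _" "?x i" "?y j" p] by simp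
    finally show ?thesis using jac_cycle[of ?Z "?x i" "?y j" p] by simp
  qed
  note t = this
  have "jac (?x i) ?Y ?Z p = 0" if i: "i \<in> I" for i
  proof -
    have "jac ?Y ?Z (?x i) p = (\<Sum>j\<in>J. jac (?y j) ?Z (?x i) p)"
      by (rule jac_sum[OF fy F(3) fx[OF i] p])
    also have "\<dots> = 0" using t[OF i] jac_cycle[of "?x i" "?y _" ?Z p] by simp
    finally show ?thesis using jac_cycle[of "?x i" ?Y ?Z p] by simp
  qed
  then have "jac ?X ?Y ?Z p = 0" by (simp add: jac_sum[OF fx F(2,3) p])
  then show ?thesis
    using jac_cong[OF F x(3) y(3) z(3) p] by simp
qed

lemma curvature_eq:
  assumes "form x" "form y" "form z" "p \<in> U"
  shows "R x y z p = D x (D y z) p - D y (D x z) p - D (br x y) z p"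
  unfolding curvature_def
  using D_cong[of "br x y" z "form_bracket M P x y" z p] assms by (simp add: br_form torsion_free)

lemma R_skew:
  assumes "form x" "form y" "form z" "p \<in> U"
  shows "R x y z p = - R y x z p"
proof -
  have "D (br y x) z p = D (\<lambda>q. (-1) *\<^sub>R br x y q) z p"
    by (rule D_cong) (use assms smooth_form_cscale[OF U br_form[of x y], of "-1"] br_skew[of y x] in auto)
  also have "\<dots> = - D (br x y) z p"
    using D_lincomb_left[of "br x y" "br x y" z p "-1" 0] assms by (simp add: br_form)
  finally show ?thesis using assms by (simp add: curvature_eq)
qed

lemma R_add_left:
  assumes "form x" "form x'" "form y" "form z" "p \<in> U"
  shows "R (\<lambda>q. x q + x' q) y z p = R x y z p + R x' y z p"
proof -
  have 1: "D y (D (\<lambda>q. x q + x' q) z) p = D y (\<lambda>q. D x z q + D x' z q) p"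
    by (rule D_cong) (use assms in \<open>auto intro: smooth_form_add[OF U] D_form D_add_left\<close>)
  have 2: "D (br (\<lambda>q. x q + x' q) y) z p = D (\<lambda>q. br x y q + br x' y q) z p"
    by (rule D_cong) (use assms in \<open>auto intro: smooth_form_add[OF U] br_form br_add_left\<close>)
  show ?thesis
    using assms by (simp add: curvature_eq smooth_form_add[OF U] 1 2 D_add_left D_add_right D_form br_form)
qed

lemma R_add_right:
  assumes "form x" "form y" "form z" "form z'" "p \<in> U"
  shows "R x y (\<lambda>q. z q + z' q) p = R x y z p + R x y z' p"
proof -
  have 1: "D x (D y (\<lambda>q. z q + z' q)) p = D x (\<lambda>q. D y z q + D y z' q) p"
    if "form x" "form y" for x y
    by (rule D_cong) (use assms that in \<open>auto intro: smooth_form_add[OF U] D_form D_add_right\<close>)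
  show ?thesis
    using assms by (simp add: curvature_eq smooth_form_add[OF U] 1 D_add_left D_add_right D_form br_form)
qed

lemma R_scale_left:
  assumes f: "func f" and x: "form x" and y: "form y" and z: "form z" and p: "p \<in> U"
  shows "R (\<lambda>q. f q *\<^sub>R x q) y z p = f p *\<^sub>R R x y z p"
proof -
  have s: "func (act M (sharp P y) f)" using smooth_act_sharp[OF U] f y by blast
  have 1: "D y (D (\<lambda>q. f q *\<^sub>R x q) z) p = D y (\<lambda>q. f q *\<^sub>R D x z q) p"
    by (rule D_cong) (use f x y z p in \<open>auto intro: smooth_form_scale[OF U] D_form D_scale_left\<close>)
  have 2: "D (br (\<lambda>q. f q *\<^sub>R x q) y) z p = D (\<lambda>q. f q *\<^sub>R br x y q - act M (sharp P y) f q *\<^sub>R x q) z p"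
    by (rule D_cong) (use f x y z s p in
        \<open>auto intro!: smooth_form_diff[OF U] smooth_form_scale[OF U] br_form br_scale_left\<close>)
  show ?thesis
    using f x y z p s
    by (simp add: curvature_eq smooth_form_scale[OF U] 1 2 D_diff_left D_scale_left D_scale_right
        D_form br_form algebra_simps)
qed

lemma R_scale_middle:
  assumes f: "func f" and x: "form x" and y: "form y" and z: "form z" and p: "p \<in> U"
  shows "R x (\<lambda>q. f q *\<^sub>R y q) z p = f p *\<^sub>R R x y z p"
  using R_skew[OF x smooth_form_scale[OF U f y] z p] R_skew[OF x y z p] R_scale_left[OF f y x z p] by simp

lemma R_scale_right:
  assumes f: "func f" and x: "form x" and y: "form y" and z: "form z" and p: "p \<in> U"
  shows "R x y (\<lambda>q. f q *\<^sub>R z q) p = f p *\<^sub>R R x y z p + anchor_defect x y f p *\<^sub>R z p"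
proof -
  have s: "func (act M (sharp P x) f)" if "form x" for x using smooth_act_sharp[OF U] f that by blast
  have 1: "D x (D y (\<lambda>q. f q *\<^sub>R z q)) p = D x (\<lambda>q. f q *\<^sub>R D y z q + act M (sharp P y) f q *\<^sub>R z q) p"
    if x: "form x" and y: "form y" for x y
    by (rule D_cong) (use f x y z p s[OF y] in
        \<open>auto intro!: smooth_form_add[OF U] smooth_form_scale[OF U] D_form D_scale_right\<close>)
  show ?thesis
    using f x y z p s
    by (simp add: curvature_eq smooth_form_scale[OF U] 1 D_add_right D_scale_right
        D_form br_form anchor_defect_def algebra_simps)
qed

text \<open>
  Grouping the six second derivatives by their outer form and using the definition of
  \<open>br\<close> leaves the three double brackets.
\<close>

lemma bianchi:
  assumes "form x" "form y" "form z" "p \<in> U"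
  shows "R x y z p + R y z x p + R z x y p = jac x y z p"
proof -
  have "br x (br y z) p = D x (D y z) p - D x (D z y) p - D (br y z) x p"
    if "form x" "form y" "form z" for x y z
    using that D_diff_right[of "D y z" "D z y" x p] assms(4)
    by (simp add: br_def[of x] D_form br_def[of y z, abs_def])
  then show ?thesis
    using assms by (simp add: jac_def curvature_eq)
qed

text \<open>
  If \<open>G(t, t)\<close> is constant, then \<open>D\<^sub>x t\<close> is orthogonal to
  \<open>t\<close> for every \<open>x\<close>. Differentiating \<open>G(D\<^sub>y t, t) =
  0\<close> expresses \<open>G(D\<^sub>x D\<^sub>y t, t)\<close> by the symmetric term
  \<open>G(D\<^sub>x t, D\<^sub>y t)\<close>, which cancels in the curvature.
\<close>

lemma R_self_orthogonal:
  assumes x: "form x" and y: "form y" and t: "form t" and p: "p \<in> U"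
    and c: "\<And>q. q \<in> U \<Longrightarrow> G q (t q) (t q) = c"
  shows "G p (R x y t p) (t p) = 0"
proof -
  have const: "act M X g q = 0" if "\<And>q. q \<in> U \<Longrightarrow> g q = c'" "q \<in> U" for X g q and c' :: real
    using ext_d_cong[OF smooth_fun_const U that(2), of c' g] that by (simp add: act_def)
  have n: "G q (D x t q) (t q) = 0" if "form x" "q \<in> U" for x q
    using metric_compatible[OF that(1) t t that(2)] const[OF c that(2)]
      cometric_sym[OF pts[OF that(2)], of "t q" "D x t q"] by simp
  have e: "G p (D x (D y t) p) (t p) = - G p (D y t p) (D x t p)" if "form x" "form y" for x y
    using metric_compatible[OF that(1) D_form[OF that(2) t] t p]
      const[of "\<lambda>q. G q (D y t q) (t q)" 0 p] n[OF that(2)] p by simp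
  note B = cometric_bilinear[OF pts[OF p]]
  show ?thesis
    using x y t p n[OF br_form[OF x y] p] e[OF x y] e[OF y x] cometric_sym[OF pts[OF p], of "D y t p" "D x t p"]
    by (simp add: curvature_eq bilinear_lsub[OF B])
qed

text \<open>
  Polarisation of \<open>R_self_orthogonal\<close>: every function differentiated there is
  constant on \<open>U\<close>.
\<close>

lemma R_metric_skew:
  assumes x: "form x" and y: "form y" and s: "form s" and t: "form t" and p: "p \<in> U"
    and c: "\<And>q. q \<in> U \<Longrightarrow> G q (s q) (s q) = c" "\<And>q. q \<in> U \<Longrightarrow> G q (t q) (t q) = c'"
      "\<And>q. q \<in> U \<Longrightarrow> G q (s q) (t q) = c''"
  shows "G p (R x y s p) (t p) = - G p (R x y t p) (s p)"
proof -
  note B = bilinear_ladd[OF cometric_bilinear] bilinear_radd[OF cometric_bilinear]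
  have "G q (s q + t q) (s q + t q) = c + c' + 2 * c''" if "q \<in> U" for q
    using c[OF that] cometric_sym[OF pts[OF that], of "t q" "s q"] by (simp add: B pts that)
  from R_self_orthogonal[OF x y smooth_form_add[OF U s t] p this]
  have "G p (R x y s p + R x y t p) (s p + t p) = 0"
    using R_add_right[OF x y s t p] by simp
  then show ?thesis
    using R_self_orthogonal[OF x y s p c(1)] R_self_orthogonal[OF x y t p c(2)]
    by (simp add: B pts p)
qed

text \<open>
  The Bianchi identity for \<open>(a, t, b)\<close>, paired with \<open>t\<close>: one of
  its terms vanishes and skew symmetry turns the other two into the two sides of the claim.
\<close>

lemma R_pair_symmetry:
  assumes f: "form a" "form b" "form t" and p: "p \<in> U"
    and c: "\<And>q. q \<in> U \<Longrightarrow> G q (a q) (a q) = caa" "\<And>q. q \<in> U \<Longrightarrow> G q (b q) (b q) = cbb"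
      "\<And>q. q \<in> U \<Longrightarrow> G q (t q) (t q) = ctt" "\<And>q. q \<in> U \<Longrightarrow> G q (a q) (t q) = cat"
      "\<And>q. q \<in> U \<Longrightarrow> G q (b q) (t q) = cbt"
    and J: "jac a t b p = 0"
  shows "G p (R a t t p) (b p) = G p (R b t t p) (a p)"
proof -
  note B = cometric_bilinear[OF pts[OF p]]
  have "G p (R a t b p) (t p) + G p (R t b a p) (t p) + G p (R b a t p) (t p) = 0"
    using arg_cong[OF bianchi[OF f(1,3,2) p], of "\<lambda>v. G p v (t p)"] J
    by (simp add: bilinear_ladd[OF B] bilinear_lzero[OF B])
  moreover have "G p (R b a t p) (t p) = 0"
    by (rule R_self_orthogonal[OF f(2,1,3) p c(3)])
  moreover have "G p (R a t b p) (t p) = - G p (R a t t p) (b p)"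
    by (rule R_metric_skew[OF f(1,3,2,3) p c(2,3,5)])
  moreover have "G p (R t b a p) (t p) = - G p (R t b t p) (a p)"
    by (rule R_metric_skew[OF f(3,2,1,3) p c(1,3,4)])
  moreover have "G p (R t b t p) (a p) = - G p (R b t t p) (a p)"
    using R_skew[OF f(3,2,3) p] bilinear_lneg[OF B] by simp
  ultimately show ?thesis by linarith
qed

lemma null_sectional_formula:
  assumes f: "form a" "form b" "form t" and p: "p \<in> U"
    and c: "\<And>q. q \<in> U \<Longrightarrow> G q (a q) (a q) = -1" "\<And>q. q \<in> U \<Longrightarrow> G q (b q) (b q) = 1"
      "\<And>q. q \<in> U \<Longrightarrow> G q (t q) (t q) = e" "\<And>q. q \<in> U \<Longrightarrow> G q (a q) (t q) = 0"
      "\<And>q. q \<in> U \<Longrightarrow> G q (b q) (t q) = 0"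
    and e: "e = 1 \<or> e = -1"
    and J: "jac a t b p = 0"
  shows "null_sectional M G P D (null_form a b) t p =
    - (1/2) * sectional M G P D a t p + (1/2) * sectional M G P D b t p + e * G p (R a t t p) (b p)"
proof -
  note B = cometric_bilinear[OF pts[OF p]]
  let ?k = "1 / sqrt 2"
  have "R (null_form a b) t t p = ?k *\<^sub>R (R a t t p + R b t t p)"
    using R_scale_left[OF smooth_fun_const smooth_form_add[OF U f(1,2)] f(3,3) p, of ?k]
      R_add_left[OF f(1,2,3,3) p]
    by (simp add: null_form_def[abs_def])
  then have "G p (R (null_form a b) t t p) (null_form a b p) = (?k * ?k) *
      (G p (R a t t p) (a p) + G p (R a t t p) (b p) + G p (R b t t p) (a p) + G p (R b t t p) (b p))"
    by (simp add: null_form_def bilinear_ladd[OF B] bilinear_radd[OF B] bilinear_lmul[OF B] bilinear_rmul[OF B]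
        algebra_simps)
  also have "?k * ?k = 1 / 2" by simp
  finally have "G p (R (null_form a b) t t p) (null_form a b p) =
      1/2 * G p (R a t t p) (a p) + 1/2 * G p (R b t t p) (b p) + G p (R a t t p) (b p)"
    using R_pair_symmetry[OF f p c J] by simp
  then show ?thesis
    using c[OF p] e by (auto simp: null_sectional_def sectional_def algebra_simps)
qed

text \<open>
  Rescaling the third argument adds a multiple of \<open>t\<close>, coming from the anchor
  defect; it disappears against a form orthogonal to \<open>t\<close>.
\<close>

lemma curvature_scale:
  assumes f: "func f" and x: "form x" and t: "form t" and p: "p \<in> U" and o: "G p (t p) w = 0"
  shows "G p (R x (\<lambda>q. f q *\<^sub>R t q) (\<lambda>q. f q *\<^sub>R t q) p) w = (f p)\<^sup>2 * G p (R x t t p) w"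
proof -
  note B = cometric_bilinear[OF pts[OF p]]
  show ?thesis
    using R_scale_middle[OF f x t smooth_form_scale[OF U f t] p] R_scale_right[OF f x t t p] o
    by (simp add: bilinear_ladd[OF B] bilinear_lmul[OF B] power2_eq_square)
qed

lemma sectional_scale_left:
  assumes f: "func f" "f p \<noteq> 0" and x: "form x" and t: "form t" and p: "p \<in> U"
  shows "sectional M G P D (\<lambda>q. f q *\<^sub>R x q) t p = sectional M G P D x t p"
proof -
  note B = cometric_bilinear[OF pts[OF p]]
  let ?n = "G p (x p) (x p) * G p (t p) (t p) - (G p (x p) (t p))\<^sup>2"
  have "sectional M G P D (\<lambda>q. f q *\<^sub>R x q) t p = ((f p)\<^sup>2 * G p (R x t t p) (x p)) / ((f p)\<^sup>2 * ?n)"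
    using R_scale_left[OF f(1) x t t p]
    by (simp add: sectional_def bilinear_lmul[OF B] bilinear_rmul[OF B] power2_eq_square algebra_simps)
  then show ?thesis using f(2) by (simp add: sectional_def)
qed

lemma sectional_scale_right:
  assumes f: "func f" "f p \<noteq> 0" and x: "form x" and t: "form t" and p: "p \<in> U" and o: "G p (t p) (x p) = 0"
  shows "sectional M G P D x (\<lambda>q. f q *\<^sub>R t q) p = sectional M G P D x t p"
proof -
  note B = cometric_bilinear[OF pts[OF p]]
  let ?n = "G p (x p) (x p) * G p (t p) (t p) - (G p (x p) (t p))\<^sup>2"
  have "sectional M G P D x (\<lambda>q. f q *\<^sub>R t q) p = ((f p)\<^sup>2 * G p (R x t t p) (x p)) / ((f p)\<^sup>2 * ?n)"
    using curvature_scale[OF f(1) x t p o]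
    by (simp add: sectional_def bilinear_lmul[OF B] bilinear_rmul[OF B] power2_eq_square algebra_simps)
  then show ?thesis using f(2) by (simp add: sectional_def)
qed

end

end

section \<open>Lifts along a projection\<close>

text \<open>
  What the two projections of a product have in common; lifts of functions and forms are
  treated here once for both. In charts the projection is the linear map \<open>L\<close>.
\<close>

locale atlas_projection = total: atlas M + base: atlas N
  for M :: "('a, 'e::euclidean_space) manifold" and N :: "('b, 'f::euclidean_space) manifold" +
  fixes \<pi> :: "'a \<Rightarrow> 'b" and L :: "'e \<Rightarrow> 'f"
  assumes linear_part: "bounded_linear L"
    and points_projection: "m \<in> points M \<Longrightarrow> \<pi> m \<in> points N"
    and preimage_open: "openin (mtop N) U \<Longrightarrow> openin (mtop M) {m \<in> points M. \<pi> m \<in> U}"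
    and chart_projection: "(V, \<phi>) \<in> charts M \<Longrightarrow>
      \<exists>V' \<phi>'. (V', \<phi>') \<in> charts N \<and> (\<forall>m\<in>V. \<pi> m \<in> V' \<and> \<phi>' (\<pi> m) = L (\<phi> m))"
    and chart_at_projection: "m \<in> points M \<Longrightarrow> m' \<in> fst (chart_at M m) \<Longrightarrow>
      \<pi> m' \<in> fst (chart_at N (\<pi> m)) \<and> coord N (\<pi> m) (\<pi> m') = L (coord M m m')"
begin

abbreviation pre where "pre U \<equiv> {m \<in> points M. \<pi> m \<in> U}"

abbreviation lift where "lift \<equiv> pullback_form M N \<pi>"

lemma smooth_fun_lift:
  assumes U: "openin (mtop N) U" and f: "smooth_fun N U f"
  shows "smooth_fun M (pre U) (\<lambda>m. f (\<pi> m))"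
proof (rule total.smooth_funI)
  fix V \<phi> assume c: "(V, \<phi>) \<in> charts M"
  obtain V' \<phi>' where d: "(V', \<phi>') \<in> charts N" "\<And>m. m \<in> V \<Longrightarrow> \<pi> m \<in> V'"
    "\<And>m. m \<in> V \<Longrightarrow> L (\<phi> m) = \<phi>' (\<pi> m)"
    using chart_projection[OF c] by auto
  note o = total.chart_image_open[OF c preimage_open[OF U]]
  have "smooth_on (\<lambda>x. (f \<circ> inv_into V' \<phi>') (L x)) (\<phi> ` (pre U \<inter> V))"
  proof (rule smooth_on_compose[OF o base.chart_image_open[OF d(1) U]])
    show "L ` \<phi> ` (pre U \<inter> V) \<subseteq> \<phi>' ` (U \<inter> V')"
      using d(2,3) by auto
    show "smooth_on L (\<phi> ` (pre U \<inter> V))"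
      by (rule smooth_on_bounded_linear[OF o linear_part smooth_on_ident[OF o]])
    show "smooth_on (f \<circ> inv_into V' \<phi>') (\<phi>' ` (U \<inter> V'))"
      by (rule base.smooth_fun_rep[OF f d(1)])
  qed
  then show "smooth_on ((\<lambda>m. f (\<pi> m)) \<circ> inv_into V \<phi>) (\<phi> ` (pre U \<inter> V))"
    by (rule smooth_on_cong[OF o, rotated]) (use c d in auto)
qed

lemma tangent_map_projection:
  assumes m: "m \<in> points M"
  shows "tangent_map M N \<pi> m = L"
proof -
  note c = total.coord_chart[OF m]
  have "((coord N (\<pi> m) \<circ> \<pi> \<circ> inv_coord M m) has_derivative L) (at (coord M m m))"
    by (rule has_derivative_transform_within_open[OF bounded_linear_imp_has_derivative[OF linear_part]
          total.chart_image_open[OF c(1) total.chart_open[OF c(1)]]])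
      (use c chart_at_projection[OF m] in \<open>auto simp: inv_coord_def\<close>)
  then show ?thesis
    unfolding tangent_map_def using frechet_derivative_at by metis
qed

lemma lift_apply:
  assumes m: "m \<in> points M"
  shows "blinfun_apply (lift \<omega> m) u = blinfun_apply (\<omega> (\<pi> m)) (L u)"
  unfolding pullback_form_def tangent_map_projection[OF m]
  by (simp add: bounded_linear_Blinfun_apply[OF bounded_linear_compose[OF blinfun.bounded_linear_right linear_part]])

lemma ext_d_lift:
  assumes U: "openin (mtop N) U" and f: "smooth_fun N U f" and m: "m \<in> points M" "\<pi> m \<in> U"
  shows "ext_d M (\<lambda>m. f (\<pi> m)) m = lift (ext_d N f) m"
proof -
  note c = total.coord_chart[OF m(1)] and d = base.coord_chart[OF points_projection[OF m(1)]]
  have "(L has_derivative L) (at (coord M m m))"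
    by (rule bounded_linear_imp_has_derivative[OF linear_part])
  moreover have "L (coord M m m) = coord N (\<pi> m) (\<pi> m)"
    using chart_at_projection[OF m(1) c(2)] by simp
  ultimately have deriv: "((\<lambda>x. (f \<circ> inv_coord N (\<pi> m)) (L x)) has_derivative
      (\<lambda>u. blinfun_apply (ext_d N f (\<pi> m)) (L u))) (at (coord M m m))"
    using base.ext_d_has_derivative[OF f U m(2)] has_derivative_compose by metis
  have local_rep: "(f \<circ> inv_coord N (\<pi> m)) (L x) = ((\<lambda>m. f (\<pi> m)) \<circ> inv_coord M m) x"
    if x: "x \<in> coord M m ` (fst (chart_at M m) \<inter> fst (chart_at M m))" for x
  proof -
    obtain m' where m': "m' \<in> fst (chart_at M m)" "x = coord M m m'" using x by blast
    have "L x = coord N (\<pi> m) (\<pi> m')" "\<pi> m' \<in> fst (chart_at N (\<pi> m))"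
      using chart_at_projection[OF m(1) m'(1)] m'(2) by simp_all
    then show ?thesis using m' c(1) d(1) by (simp add: inv_coord_def)
  qed
  have "(((\<lambda>m. f (\<pi> m)) \<circ> inv_coord M m) has_derivative
      (\<lambda>u. blinfun_apply (ext_d N f (\<pi> m)) (L u))) (at (coord M m m))"
    by (rule has_derivative_transform_within_open[OF deriv
          total.chart_image_open[OF c(1) total.chart_open[OF c(1)]] _ local_rep]) (use c(2) in blast)
  from total.ext_d_eqI[OF this] show ?thesis
    by (intro blinfun_eqI) (simp add: lift_apply[OF m(1)])
qed

lemma lift_expansion:
  assumes chart: "(V, \<phi>) \<in> charts N" and m: "m \<in> points M" "\<pi> m \<in> V"
  shows "lift \<omega> m = (\<Sum>b\<in>Basis. blinfun_apply (\<omega> (\<pi> m)) (coord_field N V \<phi> b (\<pi> m)) *\<^sub>R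
    ext_d M (\<lambda>m. \<phi> (\<pi> m) \<bullet> b) m)"
proof (rule blinfun_eqI)
  fix u
  have "blinfun_apply (\<omega> (\<pi> m)) (L u) = blinfun_apply (\<Sum>b\<in>Basis.
      blinfun_apply (\<omega> (\<pi> m)) (coord_field N V \<phi> b (\<pi> m)) *\<^sub>R ext_d N (\<lambda>q. \<phi> q \<bullet> b) (\<pi> m)) (L u)"
    using base.covector_resolution[OF chart m(2), of "\<omega> (\<pi> m)"] by simp
  then show "blinfun_apply (lift \<omega> m) u = blinfun_apply (\<Sum>b\<in>Basis.
      blinfun_apply (\<omega> (\<pi> m)) (coord_field N V \<phi> b (\<pi> m)) *\<^sub>R ext_d M (\<lambda>m. \<phi> (\<pi> m) \<bullet> b) m) u"
    by (simp add: lift_apply[OF m(1)] blinfun.sum_left blinfun.scaleR_left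
        ext_d_lift[OF base.chart_open[OF chart] base.smooth_fun_coordinate[OF chart] m])
qed

text \<open>
  Locally a lift is a sum of lifted coefficients times differentials of lifted coordinates,
  which are smooth forms.
\<close>

lemma smooth_form_lift:
  assumes U: "openin (mtop N) U" and \<omega>: "smooth_form N U \<omega>"
  shows "smooth_form M (pre U) (lift \<omega>)"
proof (rule total.smooth_form_local[OF preimage_open[OF U]])
  fix m assume m: "m \<in> pre U"
  then obtain V \<phi> where chart: "(V, \<phi>) \<in> charts N" and mV: "\<pi> m \<in> V"
    using base.coord_chart[OF points_projection] by blast
  have o: "openin (mtop N) (U \<inter> V)" using U base.chart_open[OF chart] by blast
  note O = preimage_open[OF o]
  show "\<exists>W. openin (mtop M) W \<and> m \<in> W \<and> smooth_form M W (lift \<omega>)"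
  proof (intro exI conjI)
    show "smooth_form M (pre (U \<inter> V)) (lift \<omega>)"
    proof (rule total.smooth_form_cong[OF O])
      show "(\<Sum>b\<in>Basis. blinfun_apply (\<omega> (\<pi> m)) (coord_field N V \<phi> b (\<pi> m)) *\<^sub>R
          ext_d M (\<lambda>m. \<phi> (\<pi> m) \<bullet> b) m) = lift \<omega> m" if "m \<in> pre (U \<inter> V)" for m
        using lift_expansion[OF chart] that by auto
      show "smooth_form M (pre (U \<inter> V)) (\<lambda>m. \<Sum>b\<in>Basis.
          blinfun_apply (\<omega> (\<pi> m)) (coord_field N V \<phi> b (\<pi> m)) *\<^sub>R ext_d M (\<lambda>m. \<phi> (\<pi> m) \<bullet> b) m)"
      proof (intro total.smooth_form_sum[OF O] total.smooth_form_scale[OF O] total.smooth_form_ext_d[OF O])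
        fix b :: 'f
        show "smooth_fun M (pre (U \<inter> V)) (\<lambda>m. blinfun_apply (\<omega> (\<pi> m)) (coord_field N V \<phi> b (\<pi> m)))"
          by (rule smooth_fun_lift[OF o base.smooth_form_coefficient[OF chart smooth_form_subset[OF \<omega>] o]]) auto
        show "smooth_fun M (pre (U \<inter> V)) (\<lambda>m. \<phi> (\<pi> m) \<bullet> b)"
          by (rule smooth_fun_lift[OF o smooth_fun_subset[OF base.smooth_fun_coordinate[OF chart]]]) auto
      qed
    qed
  qed (use O m mV in auto)
qed

end

section \<open>Products\<close>

lemma smooth_on_Pair:
  assumes "open S" "smooth_on f S" "smooth_on g S"
  shows "smooth_on (\<lambda>x. (f x, g x)) S"
proof -
  have "smooth_on (\<lambda>x. (f x, 0) + (0, g x)) S"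
    by (intro smooth_on_add[OF assms(1)] smooth_on_bounded_linear[OF assms(1) _ assms(2)]
        smooth_on_bounded_linear[OF assms(1) _ assms(3)] bounded_linear_intros)
  then show ?thesis by simp
qed

lemma atlas_prod_manifold:
  fixes M\<^sub>1 :: "('a, 'e::euclidean_space) manifold" and M\<^sub>2 :: "('b, 'f::euclidean_space) manifold"
  assumes "atlas M\<^sub>1" "atlas M\<^sub>2"
  shows "atlas (prod_manifold M\<^sub>1 M\<^sub>2)"
proof -
  interpret A: atlas M\<^sub>1 by fact
  interpret B: atlas M\<^sub>2 by fact
  let ?M = "prod_manifold M\<^sub>1 M\<^sub>2"
  have inv: "inv_into (V \<times> W) (map_prod \<phi> \<psi>) (\<phi> p, \<psi> q) = (p, q)"
    if "(V, \<phi>) \<in> charts M\<^sub>1" "(W, \<psi>) \<in> charts M\<^sub>2" "p \<in> V" "q \<in> W" for V W \<phi> \<psi> p q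
    using inv_into_f_f[OF map_prod_inj_on[OF A.chart_inj[OF that(1)] B.chart_inj[OF that(2)]], of "(p, q)"] that
    by simp
  have image_open: "open (map_prod \<phi> \<psi> ` (N \<inter> V \<times> W))"
    if c: "(V, \<phi>) \<in> charts M\<^sub>1" and d: "(W, \<psi>) \<in> charts M\<^sub>2" and N: "openin (mtop ?M) N" for V W \<phi> \<psi> N
  proof (subst open_subopen, intro ballI)
    fix x assume "x \<in> map_prod \<phi> \<psi> ` (N \<inter> V \<times> W)"
    then obtain p q where pq: "(p, q) \<in> N" "p \<in> V" "q \<in> W" "x = (\<phi> p, \<psi> q)" by auto
    obtain S T where ST: "openin (mtop M\<^sub>1) S" "openin (mtop M\<^sub>2) T" "p \<in> S" "q \<in> T" "S \<times> T \<subseteq> N"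
    proof -
      have "openin (prod_topology (mtop M\<^sub>1) (mtop M\<^sub>2)) N" using N by (simp add: prod_manifold_def)
      from this[unfolded openin_prod_topology_alt, rule_format, OF pq(1)] that show ?thesis by metis
    qed
    show "\<exists>X. open X \<and> x \<in> X \<and> X \<subseteq> map_prod \<phi> \<psi> ` (N \<inter> V \<times> W)"
    proof (intro exI conjI)
      show "open (\<phi> ` (S \<inter> V) \<times> \<psi> ` (T \<inter> W))"
        by (intro open_Times A.chart_image_open[OF c] B.chart_image_open[OF d] ST)
      show "\<phi> ` (S \<inter> V) \<times> \<psi> ` (T \<inter> W) \<subseteq> map_prod \<phi> \<psi> ` (N \<inter> V \<times> W)"
      proof clarsimp
        fix p q assume "p \<in> S" "p \<in> V" "q \<in> T" "q \<in> W"
        then show "(\<phi> p, \<psi> q) \<in> map_prod \<phi> \<psi> ` (N \<inter> V \<times> W)"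
          using ST(5) by (intro image_eqI[of _ _ "(p, q)"]) auto
      qed
    qed (use pq ST in auto)
  qed
  show ?thesis
  proof
    fix X \<theta> assume "(X, \<theta>) \<in> charts ?M"
    then obtain V \<phi> W \<psi> where X: "X = V \<times> W" "\<theta> = map_prod \<phi> \<psi>"
      and c: "(V, \<phi>) \<in> charts M\<^sub>1" and d: "(W, \<psi>) \<in> charts M\<^sub>2"
      unfolding prod_manifold_def by auto
    show XO: "openin (mtop ?M) X"
      using A.chart_open[OF c] B.chart_open[OF d] by (simp add: X prod_manifold_def openin_prod_Times_iff)
    show "inj_on \<theta> X"
      unfolding X by (rule map_prod_inj_on[OF A.chart_inj[OF c] B.chart_inj[OF d]])
    show "open (\<theta> ` (N \<inter> X))" if "openin (mtop ?M) N" for N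
      unfolding X by (rule image_open[OF c d that])
    fix X' \<theta>' assume "(X', \<theta>') \<in> charts ?M"
    then obtain V' \<phi>' W' \<psi>' where X': "X' = V' \<times> W'" "\<theta>' = map_prod \<phi>' \<psi>'"
      and c': "(V', \<phi>') \<in> charts M\<^sub>1" and d': "(W', \<psi>') \<in> charts M\<^sub>2"
      unfolding prod_manifold_def by auto
    have XO': "openin (mtop ?M) X'"
      using A.chart_open[OF c'] B.chart_open[OF d'] by (simp add: X' prod_manifold_def openin_prod_Times_iff)
    have o: "open (\<theta> ` (X \<inter> X'))"
      using image_open[OF c d XO'] by (simp add: X Int_commute)
    have s1: "smooth_on (\<lambda>x. (\<phi>' \<circ> inv_into V \<phi>) (fst x)) (\<theta> ` (X \<inter> X'))"
    proof (rule smooth_on_compose[OF o _ _ _ A.transition[OF c c']])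
      show "open (\<phi> ` (V \<inter> V'))"
        using A.chart_image_open[OF c A.chart_open[OF c']] by (simp add: Int_commute)
      show "smooth_on fst (\<theta> ` (X \<inter> X'))"
        by (rule smooth_on_bounded_linear[OF o bounded_linear_fst smooth_on_ident[OF o]])
    qed (auto simp: X X')
    have s2: "smooth_on (\<lambda>x. (\<psi>' \<circ> inv_into W \<psi>) (snd x)) (\<theta> ` (X \<inter> X'))"
    proof (rule smooth_on_compose[OF o _ _ _ B.transition[OF d d']])
      show "open (\<psi> ` (W \<inter> W'))"
        using B.chart_image_open[OF d B.chart_open[OF d']] by (simp add: Int_commute)
      show "smooth_on snd (\<theta> ` (X \<inter> X'))"
        by (rule smooth_on_bounded_linear[OF o bounded_linear_snd smooth_on_ident[OF o]])
    qed (auto simp: X X')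
    show "smooth_on (\<theta>' \<circ> inv_into X \<theta>) (\<theta> ` (X \<inter> X'))"
      by (rule smooth_on_cong[OF o _ smooth_on_Pair[OF o s1 s2]])
        (use c d in \<open>auto simp: X X' inv\<close>)
  next
    fix m assume "m \<in> points ?M"
    then have "fst m \<in> points M\<^sub>1" "snd m \<in> points M\<^sub>2" by (auto simp: prod_manifold_def)
    from A.coord_chart[OF this(1)] B.coord_chart[OF this(2)]
    show "chart_at ?M m \<in> charts ?M"
      by (simp add: prod_manifold_def coord_def split_beta)
        (intro exI conjI, rule refl, rule refl, simp_all)
  next
    fix m assume "m \<in> points ?M"
    then have "fst m \<in> points M\<^sub>1" "snd m \<in> points M\<^sub>2" by (auto simp: prod_manifold_def)
    from A.coord_chart[OF this(1)] B.coord_chart[OF this(2)]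
    show "m \<in> fst (chart_at ?M m)"
      by (simp add: prod_manifold_def split_beta mem_Times_iff)
  qed
qed

lemma atlas_projection_fst:
  fixes M\<^sub>1 :: "('a, 'e::euclidean_space) manifold" and M\<^sub>2 :: "('b, 'f::euclidean_space) manifold"
  assumes "atlas M\<^sub>1" "atlas M\<^sub>2"
  shows "atlas_projection (prod_manifold M\<^sub>1 M\<^sub>2) M\<^sub>1 fst fst"
proof -
  show ?thesis
  proof (intro atlas_projection.intro atlas_projection_axioms.intro)
    show "atlas (prod_manifold M\<^sub>1 M\<^sub>2)" by (rule atlas_prod_manifold[OF assms])
    show "atlas M\<^sub>1" by fact
    show "openin (mtop (prod_manifold M\<^sub>1 M\<^sub>2)) {m \<in> points (prod_manifold M\<^sub>1 M\<^sub>2). fst m \<in> U}"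
      if "openin (mtop M\<^sub>1) U" for U
    proof -
      have "{m \<in> points (prod_manifold M\<^sub>1 M\<^sub>2). fst m \<in> U} = U \<times> points M\<^sub>2"
        using openin_subset[OF that] by (auto simp: prod_manifold_def)
      then show ?thesis using that by (simp add: prod_manifold_def openin_prod_Times_iff)
    qed
    show "\<exists>V' \<phi>'. (V', \<phi>') \<in> charts M\<^sub>1 \<and> (\<forall>m\<in>V. fst m \<in> V' \<and> \<phi>' (fst m) = fst (\<phi> m))"
      if "(V, \<phi>) \<in> charts (prod_manifold M\<^sub>1 M\<^sub>2)" for V \<phi>
    proof -
      from that obtain V\<^sub>1 \<phi>\<^sub>1 V\<^sub>2 \<phi>\<^sub>2 where "V = V\<^sub>1 \<times> V\<^sub>2" "\<phi> = map_prod \<phi>\<^sub>1 \<phi>\<^sub>2"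
        "(V\<^sub>1, \<phi>\<^sub>1) \<in> charts M\<^sub>1" "(V\<^sub>2, \<phi>\<^sub>2) \<in> charts M\<^sub>2"
        unfolding prod_manifold_def by auto
      then show ?thesis by (intro exI[of _ V\<^sub>1] exI[of _ \<phi>\<^sub>1]) auto
    qed
    show "bounded_linear (fst :: 'e \<times> 'f \<Rightarrow> _)" by (rule bounded_linear_fst)
  qed (auto simp: prod_manifold_def coord_def split_beta)
qed

lemma atlas_projection_snd:
  fixes M\<^sub>1 :: "('a, 'e::euclidean_space) manifold" and M\<^sub>2 :: "('b, 'f::euclidean_space) manifold"
  assumes "atlas M\<^sub>1" "atlas M\<^sub>2"
  shows "atlas_projection (prod_manifold M\<^sub>1 M\<^sub>2) M\<^sub>2 snd snd"
proof -
  show ?thesis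
  proof (intro atlas_projection.intro atlas_projection_axioms.intro)
    show "atlas (prod_manifold M\<^sub>1 M\<^sub>2)" by (rule atlas_prod_manifold[OF assms])
    show "atlas M\<^sub>2" by fact
    show "openin (mtop (prod_manifold M\<^sub>1 M\<^sub>2)) {m \<in> points (prod_manifold M\<^sub>1 M\<^sub>2). snd m \<in> U}"
      if "openin (mtop M\<^sub>2) U" for U
    proof -
      have "{m \<in> points (prod_manifold M\<^sub>1 M\<^sub>2). snd m \<in> U} = points M\<^sub>1 \<times> U"
        using openin_subset[OF that] by (auto simp: prod_manifold_def)
      then show ?thesis using that by (simp add: prod_manifold_def openin_prod_Times_iff)
    qed
    show "\<exists>V' \<phi>'. (V', \<phi>') \<in> charts M\<^sub>2 \<and> (\<forall>m\<in>V. snd m \<in> V' \<and> \<phi>' (snd m) = snd (\<phi> m))"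
      if "(V, \<phi>) \<in> charts (prod_manifold M\<^sub>1 M\<^sub>2)" for V \<phi>
    proof -
      from that obtain V\<^sub>1 \<phi>\<^sub>1 V\<^sub>2 \<phi>\<^sub>2 where "V = V\<^sub>1 \<times> V\<^sub>2" "\<phi> = map_prod \<phi>\<^sub>1 \<phi>\<^sub>2"
        "(V\<^sub>1, \<phi>\<^sub>1) \<in> charts M\<^sub>1" "(V\<^sub>2, \<phi>\<^sub>2) \<in> charts M\<^sub>2"
        unfolding prod_manifold_def by auto
      then show ?thesis by (intro exI[of _ V\<^sub>2] exI[of _ \<phi>\<^sub>2]) auto
    qed
    show "bounded_linear (snd :: 'e \<times> 'f \<Rightarrow> _)" by (rule bounded_linear_snd)
  qed (auto simp: prod_manifold_def coord_def split_beta)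
qed

lemma hor_part_apply [simp]: "blinfun_apply (hor_part \<alpha>) u = blinfun_apply \<alpha> (u, 0)"
  and ver_part_apply [simp]: "blinfun_apply (ver_part \<alpha>) v = blinfun_apply \<alpha> (0, v)"
proof -
  have "bounded_linear (\<lambda>u. blinfun_apply \<alpha> (u, 0))" "bounded_linear (\<lambda>v. blinfun_apply \<alpha> (0, v))"
    by (intro bounded_linear_compose[OF blinfun.bounded_linear_right] bounded_linear_intros)+
  then show "blinfun_apply (hor_part \<alpha>) u = blinfun_apply \<alpha> (u, 0)"
    "blinfun_apply (ver_part \<alpha>) v = blinfun_apply \<alpha> (0, v)"
    by (simp_all add: hor_part_def ver_part_def bounded_linear_Blinfun_apply)
qed

lemma hor_part_linear: "hor_part (\<alpha> + \<beta>) = hor_part \<alpha> + hor_part \<beta>" "hor_part (c *\<^sub>R \<alpha>) = c *\<^sub>R hor_part \<alpha>"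
  and ver_part_linear: "ver_part (\<alpha> + \<beta>) = ver_part \<alpha> + ver_part \<beta>" "ver_part (c *\<^sub>R \<alpha>) = c *\<^sub>R ver_part \<alpha>"
  by (auto intro!: blinfun_eqI simp: blinfun.add_left blinfun.scaleR_left)

section \<open>Cometrics\<close>

context
  fixes g :: "('a, 'e::euclidean_space) metric" and p :: 'a
  assumes bil: "bilinear (g p)" and sym: "\<And>u v. g p u v = g p v u"
    and nondeg: "\<And>u. (\<And>v. g p u v = 0) \<Longrightarrow> u = 0"
begin

lemma raise_unique:
  assumes "\<And>v. g p u v = blinfun_apply \<alpha> v"
  shows "raise g p \<alpha> = u"
  unfolding raise_def
proof (rule the_equality)
  fix w assume "\<forall>v. g p w v = blinfun_apply \<alpha> v"
  then have "g p (w - u) v = 0" for v using assms bilinear_lsub[OF bil] by simp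
  then show "w = u" using nondeg[of "w - u"] by simp
qed (use assms in blast)

text \<open>
  Nondegeneracy makes the linear map sending \<open>u\<close> to the vector that represents
  \<open>g(u, \<cdot>)\<close> injective, hence onto.
\<close>

lemma raise_works: "g p (raise g p \<alpha>) v = blinfun_apply \<alpha> v"
proof -
  let ?T = "\<lambda>u. \<Sum>b\<in>Basis. g p u b *\<^sub>R b"
  have expand: "g p u v = ?T u \<bullet> v" for u v
  proof -
    have l: "linear (g p u)" using bil by (simp add: bilinear_def)
    have "g p u v = g p u (\<Sum>b\<in>Basis. (v \<bullet> b) *\<^sub>R b)" by (simp add: euclidean_representation)
    also have "\<dots> = ?T u \<bullet> v"
      by (simp add: linear_sum[OF l] linear_cmul[OF l] inner_sum_left) (simp add: inner_commute mult.commute)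
    finally show ?thesis .
  qed
  have lin: "linear ?T"
    by (rule linearI) (simp_all add: bilinear_ladd[OF bil] bilinear_lmul[OF bil] scaleR_add_left
        sum.distrib scaleR_sum_right)
  have "inj ?T"
    unfolding linear_injective_0[OF lin]
  proof (intro allI impI)
    fix u assume "?T u = 0"
    then have "g p u v = 0" for v using expand[of u v] by (simp only: inner_zero_left)
    then show "u = 0" by (rule nondeg)
  qed
  then have "surj ?T" using linear_injective_imp_surjective[OF lin] by simp
  then obtain u where u: "(\<Sum>b\<in>Basis. blinfun_apply \<alpha> b *\<^sub>R b) = ?T u" by (rule surjE)
  have "g p u v = blinfun_apply \<alpha> v" for v
  proof -
    have "blinfun_apply \<alpha> v = blinfun_apply \<alpha> (\<Sum>b\<in>Basis. (v \<bullet> b) *\<^sub>R b)" by (simp add: euclidean_representation)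
    also have "\<dots> = (\<Sum>b\<in>Basis. blinfun_apply \<alpha> b *\<^sub>R b) \<bullet> v"
      by (simp add: blinfun.sum_right blinfun.scaleR_right inner_sum_left) (simp add: inner_commute mult.commute)
    finally show ?thesis using expand[of u v] by (simp only: u[symmetric])
  qed
  then have "raise g p \<alpha> = u" "g p u v = blinfun_apply \<alpha> v" by (auto intro: raise_unique)
  then show ?thesis by simp
qed

lemma cometric_eq: "cometric g p \<alpha> \<beta> = blinfun_apply \<alpha> (raise g p \<beta>)"
  by (simp add: cometric_def raise_works)

lemma cometric_symmetric: "cometric g p \<alpha> \<beta> = cometric g p \<beta> \<alpha>"
  unfolding cometric_def by (rule sym)

lemma bilinear_cometric: "bilinear (cometric g p)"
proof -
  have "linear (\<lambda>\<alpha>. cometric g p \<alpha> \<beta>)" for \<beta>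
    by (rule linearI) (simp_all add: cometric_eq blinfun.add_left blinfun.scaleR_left)
  then show ?thesis
    unfolding bilinear_def using cometric_symmetric by (metis (no_types, lifting) ext)
qed

end

section \<open>The contravariant warped product\<close>

locale warped_product =
  fixes M\<^sub>1 :: "('a, 'e::euclidean_space) manifold" and M\<^sub>2 :: "('b, 'f::euclidean_space) manifold"
    and P\<^sub>1 :: "('a, 'e) cotensor" and P\<^sub>2 :: "('b, 'f) cotensor"
    and g\<^sub>1 :: "('a, 'e) metric" and g\<^sub>2 :: "('b, 'f) metric"
    and q\<^sub>1 q\<^sub>2 :: nat and f\<^sub>1 \<nu>\<^sub>1 :: "'a \<Rightarrow> real"
    and D :: "('a \<times> 'b, 'e \<times> 'f) one_form \<Rightarrow> ('a \<times> 'b, 'e \<times> 'f) one_form \<Rightarrow>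
              ('a \<times> 'b, 'e \<times> 'f) one_form"
  assumes poisson: "poisson_manifold M\<^sub>1 P\<^sub>1" "poisson_manifold M\<^sub>2 P\<^sub>2"
    and metric: "semi_riemannian M\<^sub>1 g\<^sub>1 q\<^sub>1" "semi_riemannian M\<^sub>2 g\<^sub>2 q\<^sub>2"
    and warping: "smooth_fun M\<^sub>1 (points M\<^sub>1) f\<^sub>1" "\<And>p. p \<in> points M\<^sub>1 \<Longrightarrow> f\<^sub>1 p > 0"
    and nu: "smooth_fun M\<^sub>1 (points M\<^sub>1) \<nu>\<^sub>1"
    and connection: "levi_civita (prod_manifold M\<^sub>1 M\<^sub>2)
      (cometric (warped_metric M\<^sub>1 g\<^sub>1 M\<^sub>2 g\<^sub>2 f\<^sub>1)) (warped_bivector P\<^sub>1 P\<^sub>2 \<nu>\<^sub>1) D"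
begin

abbreviation M where "M \<equiv> prod_manifold M\<^sub>1 M\<^sub>2"
abbreviation P where "P \<equiv> warped_bivector P\<^sub>1 P\<^sub>2 \<nu>\<^sub>1"
abbreviation g where "g \<equiv> warped_metric M\<^sub>1 g\<^sub>1 M\<^sub>2 g\<^sub>2 f\<^sub>1"
abbreviation G where "G \<equiv> cometric g"

end

sublocale warped_product \<subseteq> factor1: bivector_atlas M\<^sub>1 P\<^sub>1
  using poisson smooth_manifold_atlas
  by (auto simp: poisson_manifold_def bivector_atlas_def bivector_atlas_axioms_def)

sublocale warped_product \<subseteq> factor2: bivector_atlas M\<^sub>2 P\<^sub>2
  using poisson smooth_manifold_atlas
  by (auto simp: poisson_manifold_def bivector_atlas_def bivector_atlas_axioms_def)

sublocale warped_product \<subseteq> hor: atlas_projection M M\<^sub>1 fst fst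
  by (rule atlas_projection_fst[OF factor1.atlas_axioms factor2.atlas_axioms])

sublocale warped_product \<subseteq> ver: atlas_projection M M\<^sub>2 snd snd
  by (rule atlas_projection_snd[OF factor1.atlas_axioms factor2.atlas_axioms])

context warped_product
begin

lemma points_prod: "m \<in> points M \<longleftrightarrow> fst m \<in> points M\<^sub>1 \<and> snd m \<in> points M\<^sub>2"
  by (simp add: prod_manifold_def mem_Times_iff)

lemma openin_Times: "openin (mtop M\<^sub>1) U\<^sub>1 \<Longrightarrow> openin (mtop M\<^sub>2) U\<^sub>2 \<Longrightarrow> openin (mtop M) (U\<^sub>1 \<times> U\<^sub>2)"
  by (simp add: prod_manifold_def openin_prod_Times_iff)

lemma Times_subset_pre:
  assumes "openin (mtop M\<^sub>1) U\<^sub>1" "openin (mtop M\<^sub>2) U\<^sub>2"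
  shows "U\<^sub>1 \<times> U\<^sub>2 \<subseteq> hor.pre U\<^sub>1" "U\<^sub>1 \<times> U\<^sub>2 \<subseteq> ver.pre U\<^sub>2"
  using openin_subset[OF assms(1)] openin_subset[OF assms(2)] by (auto simp: points_prod)

lemma parts_lift:
  assumes "m \<in> points M"
  shows "hor_part (hor.lift \<omega> m) = \<omega> (fst m)" "ver_part (hor.lift \<omega> m) = 0"
    "hor_part (ver.lift \<eta> m) = 0" "ver_part (ver.lift \<eta> m) = \<eta> (snd m)"
  by (auto intro!: blinfun_eqI simp: hor.lift_apply[OF assms] ver.lift_apply[OF assms])

lemma product_chart:
  assumes "(V, \<phi>) \<in> charts M"
  obtains V\<^sub>1 \<phi>\<^sub>1 V\<^sub>2 \<phi>\<^sub>2 where "V = V\<^sub>1 \<times> V\<^sub>2" "\<phi> = map_prod \<phi>\<^sub>1 \<phi>\<^sub>2"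
    "(V\<^sub>1, \<phi>\<^sub>1) \<in> charts M\<^sub>1" "(V\<^sub>2, \<phi>\<^sub>2) \<in> charts M\<^sub>2"
  using assms unfolding prod_manifold_def by auto

lemma ext_d_product_coordinate:
  assumes c: "(V\<^sub>1, \<phi>\<^sub>1) \<in> charts M\<^sub>1" and d: "(V\<^sub>2, \<phi>\<^sub>2) \<in> charts M\<^sub>2" and m: "m \<in> V\<^sub>1 \<times> V\<^sub>2"
  shows "ext_d M (\<lambda>m. map_prod \<phi>\<^sub>1 \<phi>\<^sub>2 m \<bullet> b) m =
    hor.lift (ext_d M\<^sub>1 (\<lambda>p. \<phi>\<^sub>1 p \<bullet> fst b)) m + ver.lift (ext_d M\<^sub>2 (\<lambda>q. \<phi>\<^sub>2 q \<bullet> snd b)) m"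
proof -
  note o = factor1.chart_open[OF c] factor2.chart_open[OF d]
  note O = openin_Times[OF o] and sub = Times_subset_pre[OF o]
  have mp: "m \<in> points M" using O m hor.total.open_subset_points by blast
  have 1: "smooth_fun M (V\<^sub>1 \<times> V\<^sub>2) (\<lambda>m. \<phi>\<^sub>1 (fst m) \<bullet> fst b)"
    by (rule smooth_fun_subset[OF hor.smooth_fun_lift[OF o(1) factor1.smooth_fun_coordinate[OF c]] sub(1)])
  have 2: "smooth_fun M (V\<^sub>1 \<times> V\<^sub>2) (\<lambda>m. \<phi>\<^sub>2 (snd m) \<bullet> snd b)"
    by (rule smooth_fun_subset[OF ver.smooth_fun_lift[OF o(2) factor2.smooth_fun_coordinate[OF d]] sub(2)])
  have "ext_d M (\<lambda>m. map_prod \<phi>\<^sub>1 \<phi>\<^sub>2 m \<bullet> b) m =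
      ext_d M (\<lambda>m. \<phi>\<^sub>1 (fst m) \<bullet> fst b + \<phi>\<^sub>2 (snd m) \<bullet> snd b) m"
    by (simp add: inner_prod_def)
  also have "\<dots> = ext_d M (\<lambda>m. \<phi>\<^sub>1 (fst m) \<bullet> fst b) m + ext_d M (\<lambda>m. \<phi>\<^sub>2 (snd m) \<bullet> snd b) m"
    by (rule hor.total.ext_d_add[OF O 1 2 m])
  also have "ext_d M (\<lambda>m. \<phi>\<^sub>1 (fst m) \<bullet> fst b) m = hor.lift (ext_d M\<^sub>1 (\<lambda>p. \<phi>\<^sub>1 p \<bullet> fst b)) m"
    by (rule hor.ext_d_lift[OF o(1) factor1.smooth_fun_coordinate[OF c] mp]) (use m in auto)
  also have "ext_d M (\<lambda>m. \<phi>\<^sub>2 (snd m) \<bullet> snd b) m = ver.lift (ext_d M\<^sub>2 (\<lambda>q. \<phi>\<^sub>2 q \<bullet> snd b)) m"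
    by (rule ver.ext_d_lift[OF o(2) factor2.smooth_fun_coordinate[OF d] mp]) (use m in auto)
  finally show ?thesis .
qed

lemma bilinear_P: 
  assumes m: "m \<in> points M"
  shows "bilinear (P m)"
proof -
  note B = factor1.bivector_bilinear[of "fst m"] factor2.bivector_bilinear[of "snd m"]
  have p: "fst m \<in> points M\<^sub>1" "snd m \<in> points M\<^sub>2" using m by (simp_all add: points_prod)
  note rules = bilinear_ladd[OF B(1)] bilinear_ladd[OF B(2)] bilinear_radd[OF B(1)] bilinear_radd[OF B(2)]
    bilinear_lmul[OF B(1)] bilinear_lmul[OF B(2)] bilinear_rmul[OF B(1)] bilinear_rmul[OF B(2)]
  show ?thesis
    unfolding bilinear_def
    by (intro conjI allI linearI) (simp_all add: warped_bivector_def hor_part_linear ver_part_linear rules p algebra_simps)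
qed

text \<open>
  In a product chart the coefficients \<open>P(dx\<^sub>b, dx\<^sub>c)\<close> are built
  from lifts of smooth functions on the factors; arbitrary smooth forms are combinations of
  the \<open>dx\<^sub>b\<close> with smooth coefficients.
\<close>

lemma bivector_field_product: "bivector_field M P"
  unfolding bivector_field_def
proof (intro conjI ballI allI impI)
  show "bilinear (P m)" if "m \<in> points M" for m by (rule bilinear_P[OF that])
  show "P m \<alpha> \<beta> = - P m \<beta> \<alpha>" if "m \<in> points M" for m \<alpha> \<beta>
    using factor1.bivector_skew[of "fst m" "hor_part \<alpha>"] factor2.bivector_skew[of "snd m" "ver_part \<alpha>"] that
    by (simp add: points_prod warped_bivector_def)
next
  fix U \<omega> \<eta> assume "openin (mtop M) U \<and> smooth_form M U \<omega> \<and> smooth_form M U \<eta>"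
  then have U: "openin (mtop M) U" and \<omega>: "smooth_form M U \<omega>" and \<eta>: "smooth_form M U \<eta>" by auto
  show "smooth_fun M U (\<lambda>m. P m (\<omega> m) (\<eta> m))"
  proof (rule hor.total.smooth_fun_local[OF U])
    fix m assume m: "m \<in> U"
    have mp: "m \<in> points M" using U m hor.total.open_subset_points by blast
    obtain V \<phi> where chart: "(V, \<phi>) \<in> charts M" and mV: "m \<in> V" using hor.total.coord_chart[OF mp] by blast
    obtain V\<^sub>1 \<phi>\<^sub>1 V\<^sub>2 \<phi>\<^sub>2 where V: "V = V\<^sub>1 \<times> V\<^sub>2" "\<phi> = map_prod \<phi>\<^sub>1 \<phi>\<^sub>2"
      and c: "(V\<^sub>1, \<phi>\<^sub>1) \<in> charts M\<^sub>1" and d: "(V\<^sub>2, \<phi>\<^sub>2) \<in> charts M\<^sub>2"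
      using product_chart[OF chart] .
    note o = factor1.chart_open[OF c] factor2.chart_open[OF d]
    define N where "N = U \<inter> V"
    have N: "openin (mtop M) N" "N \<subseteq> U" "N \<subseteq> V"
      using U hor.total.chart_open[OF chart] by (auto simp: N_def)
    have sub: "N \<subseteq> hor.pre V\<^sub>1" "N \<subseteq> ver.pre V\<^sub>2" using Times_subset_pre[OF o] N(3) V(1) by auto
    let ?x = "\<lambda>b. ext_d M\<^sub>1 (\<lambda>p. \<phi>\<^sub>1 p \<bullet> fst b)" and ?y = "\<lambda>b. ext_d M\<^sub>2 (\<lambda>q. \<phi>\<^sub>2 q \<bullet> snd b)"
    let ?P = "\<lambda>b c m. P\<^sub>1 (fst m) (?x b (fst m)) (?x c (fst m)) + \<nu>\<^sub>1 (fst m) * P\<^sub>2 (snd m) (?y b (snd m)) (?y c (snd m))"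
    let ?w = "\<lambda>\<omega> b m. blinfun_apply (\<omega> m) (coord_field M V \<phi> b m)"
    have s: "smooth_fun M N (?P b c)" for b c
    proof (intro hor.total.smooth_fun_add[OF N(1)] hor.total.smooth_fun_mult[OF N(1)])
      show "smooth_fun M N (\<lambda>m. P\<^sub>1 (fst m) (?x b (fst m)) (?x c (fst m)))"
        by (rule smooth_fun_subset[OF hor.smooth_fun_lift[OF o(1)] sub(1)])
          (intro factor1.smooth_fun_bivector o factor1.smooth_form_ext_d factor1.smooth_fun_coordinate c)
      show "smooth_fun M N (\<lambda>m. \<nu>\<^sub>1 (fst m))"
        by (rule smooth_fun_subset[OF hor.smooth_fun_lift[OF o(1)] sub(1)])
          (rule smooth_fun_subset[OF nu openin_subset[OF o(1)]])
      show "smooth_fun M N (\<lambda>m. P\<^sub>2 (snd m) (?y b (snd m)) (?y c (snd m)))"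
        by (rule smooth_fun_subset[OF ver.smooth_fun_lift[OF o(2)] sub(2)])
          (intro factor2.smooth_fun_bivector o factor2.smooth_form_ext_d factor2.smooth_fun_coordinate d)
    qed
    have "smooth_fun M N (\<lambda>m. \<Sum>b\<in>Basis. \<Sum>c\<in>Basis. ?w \<omega> b m * (?w \<eta> c m * ?P b c m))"
      by (intro hor.total.smooth_fun_sum[OF N(1)] hor.total.smooth_fun_mult[OF N(1)] s
          hor.total.smooth_form_coefficient[OF chart] N smooth_form_subset[OF \<omega>] smooth_form_subset[OF \<eta>])
    moreover have "P m (\<omega> m) (\<eta> m) = (\<Sum>b\<in>Basis. \<Sum>c\<in>Basis. ?w \<omega> b m * (?w \<eta> c m * ?P b c m))"
      if m: "m \<in> N" for m
    proof -
      have mp: "m \<in> points M" using N(1) m hor.total.open_subset_points by blast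
      have mV: "m \<in> V" using m N by blast
      let ?dx = "\<lambda>b. ext_d M (\<lambda>m. \<phi> m \<bullet> b) m"
      have "P m (?dx b) (?dx c) = ?P b c m" for b c
        using ext_d_product_coordinate[OF c d] mV mp
        by (simp add: V warped_bivector_def hor_part_linear ver_part_linear parts_lift)
      moreover have "P m (\<omega> m) (\<eta> m) = P m (\<Sum>b\<in>Basis. ?w \<omega> b m *\<^sub>R ?dx b) (\<Sum>b\<in>Basis. ?w \<eta> b m *\<^sub>R ?dx b)"
        using hor.total.covector_resolution[OF chart mV] by metis
      moreover have "\<dots> = (\<Sum>b\<in>Basis. \<Sum>c\<in>Basis. ?w \<omega> b m * (?w \<eta> c m * P m (?dx b) (?dx c)))"
      proof -
        have l: "linear (\<lambda>\<alpha>. P m \<alpha> \<beta>)" "linear (P m \<beta>)" for \<beta>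
          using bilinear_P[OF mp] by (simp_all add: bilinear_def)
        show ?thesis
          by (subst linear_sum[OF l(1)], subst linear_sum[OF l(2)])
            (simp add: linear_cmul[OF l(1)] linear_cmul[OF l(2)] mult.left_commute)
      qed
      ultimately show ?thesis by simp
    qed
    ultimately have "smooth_fun M N (\<lambda>m. P m (\<omega> m) (\<eta> m))"
      using hor.total.smooth_fun_cong[OF N(1)] by (metis (no_types, lifting))
    then show "\<exists>N. openin (mtop M) N \<and> m \<in> N \<and> smooth_fun M N (\<lambda>m. P m (\<omega> m) (\<eta> m))"
      using N m mV by (auto simp: N_def)
  qed
qed

lemma warped_metric_apply:
  assumes "m \<in> points M"
  shows "g m u v = g\<^sub>1 (fst m) (fst u) (fst v) + (f\<^sub>1 (fst m))\<^sup>2 * g\<^sub>2 (snd m) (snd u) (snd v)"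
  by (simp add: warped_metric_def pullback_metric_def hor.tangent_map_projection[OF assms]
      ver.tangent_map_projection[OF assms])

context
  fixes m assumes m: "m \<in> points M"
begin

lemma factor_metrics:
  shows "bilinear (g\<^sub>1 (fst m))" "g\<^sub>1 (fst m) u v = g\<^sub>1 (fst m) v u" "(\<And>v. g\<^sub>1 (fst m) u v = 0) \<Longrightarrow> u = 0"
    "bilinear (g\<^sub>2 (snd m))" "g\<^sub>2 (snd m) u' v' = g\<^sub>2 (snd m) v' u'" "(\<And>v. g\<^sub>2 (snd m) u' v = 0) \<Longrightarrow> u' = 0"
proof -
  have "fst m \<in> points M\<^sub>1" "snd m \<in> points M\<^sub>2" using m by (simp_all add: points_prod)
  with metric show "bilinear (g\<^sub>1 (fst m))" "g\<^sub>1 (fst m) u v = g\<^sub>1 (fst m) v u"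
    "(\<And>v. g\<^sub>1 (fst m) u v = 0) \<Longrightarrow> u = 0"
    "bilinear (g\<^sub>2 (snd m))" "g\<^sub>2 (snd m) u' v' = g\<^sub>2 (snd m) v' u'" "(\<And>v. g\<^sub>2 (snd m) u' v = 0) \<Longrightarrow> u' = 0"
    unfolding semi_riemannian_def by blast+
qed

lemma warping_pos: "f\<^sub>1 (fst m) > 0"
  using warping(2) m by (simp add: points_prod)

lemma warped_metric_nondegenerate:
  shows "bilinear (g m)" "g m u v = g m v u" "(\<And>v. g m u v = 0) \<Longrightarrow> u = 0"
proof -
  note B = factor_metrics(1,4)
  show "bilinear (g m)"
    unfolding bilinear_def
    by (intro conjI allI linearI) (simp_all add: warped_metric_apply[OF m] bilinear_ladd[OF B(1)]
        bilinear_ladd[OF B(2)] bilinear_radd[OF B(1)] bilinear_radd[OF B(2)] bilinear_lmul[OF B(1)]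
        bilinear_lmul[OF B(2)] bilinear_rmul[OF B(1)] bilinear_rmul[OF B(2)] algebra_simps)
  show "g m u v = g m v u"
    using factor_metrics(2,5) by (simp add: warped_metric_apply[OF m])
  assume z: "\<And>v. g m u v = 0"
  have "fst u = 0"
    using z[of "(v, 0)" for v] by (intro factor_metrics(3)) (simp add: warped_metric_apply[OF m] bilinear_rzero[OF B(2)])
  moreover have "snd u = 0"
    using z[of "(0, v)" for v] warping_pos
    by (intro factor_metrics(6)) (simp add: warped_metric_apply[OF m] bilinear_rzero[OF B(1)])
  ultimately show "u = 0" by (simp add: prod_eq_iff)
qed

text \<open>
  Raising an index inverts the factor \<open>f\<^sub>1\<^sup>2\<close> of the vertical part
  of the metric.
\<close>

lemma warped_cometric:
  "G m \<alpha> \<beta> = cometric g\<^sub>1 (fst m) (hor_part \<alpha>) (hor_part \<beta>)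
    + cometric g\<^sub>2 (snd m) (ver_part \<alpha>) (ver_part \<beta>) / (f\<^sub>1 (fst m))\<^sup>2"
proof -
  have "raise g m \<beta> = (raise g\<^sub>1 (fst m) (hor_part \<beta>), (1 / (f\<^sub>1 (fst m))\<^sup>2) *\<^sub>R raise g\<^sub>2 (snd m) (ver_part \<beta>))"
  proof (rule raise_unique[where g = g and p = m, OF warped_metric_nondegenerate])
    fix v
    show "g m (raise g\<^sub>1 (fst m) (hor_part \<beta>), (1 / (f\<^sub>1 (fst m))\<^sup>2) *\<^sub>R raise g\<^sub>2 (snd m) (ver_part \<beta>)) v =
        blinfun_apply \<beta> v"
      using warping_pos
      by (simp add: warped_metric_apply[OF m] raise_works[where g = g\<^sub>1 and p = "fst m", OF factor_metrics(1-3)]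
          raise_works[where g = g\<^sub>2 and p = "snd m", OF factor_metrics(4-6)] bilinear_lmul[OF factor_metrics(4)] flip: blinfun.add_right)
  qed
  moreover have "blinfun_apply \<alpha> (u, c *\<^sub>R v) = blinfun_apply \<alpha> (u, 0) + c * blinfun_apply \<alpha> (0, v)" for u v c
    by (simp flip: blinfun.add_right blinfun.scaleR_right real_scaleR_def)
  ultimately show ?thesis
    by (simp add: cometric_eq[where g = g and p = m, OF warped_metric_nondegenerate] cometric_eq[where g = g\<^sub>1 and p = "fst m", OF factor_metrics(1-3)]
        cometric_eq[where g = g\<^sub>2 and p = "snd m", OF factor_metrics(4-6)])
qed

end

end

sublocale warped_product \<subseteq> levi_civita_atlas M P G D
proof (intro levi_civita_atlas.intro bivector_atlas.intro bivector_atlas_axioms.intro levi_civita_atlas_axioms.intro)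
  show "atlas M" by (rule hor.total.atlas_axioms)
  show "bivector_field M P" by (rule bivector_field_product)
  show "levi_civita M G P D" by (rule connection)
  show "bilinear (G m)" if "m \<in> points M" for m
    by (rule bilinear_cometric[where g = g and p = m, OF warped_metric_nondegenerate[OF that]])
  show "G m \<alpha> \<beta> = G m \<beta> \<alpha>" if "m \<in> points M" for m \<alpha> \<beta>
    by (rule cometric_symmetric[where g = g and p = m, OF warped_metric_nondegenerate[OF that]])
qed

context warped_product
begin

text \<open>
  Horizontal and vertical differentials are orthogonal for the bivector, so bracketing with
  a horizontal function differentiates the horizontal factor only.
\<close>

lemma pb_hor_product:
  assumes o: "openin (mtop M\<^sub>1) U\<^sub>1" "openin (mtop M\<^sub>2) U\<^sub>2"
    and h: "smooth_fun M\<^sub>1 U\<^sub>1 h" and a: "smooth_fun M\<^sub>1 U\<^sub>1 a" and b: "smooth_fun M\<^sub>2 U\<^sub>2 b"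
    and m: "m \<in> U\<^sub>1 \<times> U\<^sub>2"
  shows "pb (\<lambda>m. h (fst m)) (\<lambda>m. a (fst m) * b (snd m)) m = factor1.pb h a (fst m) * b (snd m)"
proof -
  note O = openin_Times[OF o] and sub = Times_subset_pre[OF o]
  have mp: "m \<in> points M" by (rule hor.total.open_subset_points[OF O m])
  have m12: "fst m \<in> U\<^sub>1" "snd m \<in> U\<^sub>2" using m by auto
  note B = factor1.bivector_bilinear[of "fst m"] factor2.bivector_bilinear[of "snd m"]
  have p: "fst m \<in> points M\<^sub>1" "snd m \<in> points M\<^sub>2" using mp by (simp_all add: points_prod)
  have "ext_d M (\<lambda>m. a (fst m) * b (snd m)) m =
      a (fst m) *\<^sub>R ver.lift (ext_d M\<^sub>2 b) m + b (snd m) *\<^sub>R hor.lift (ext_d M\<^sub>1 a) m"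
    using hor.total.ext_d_mult[OF O smooth_fun_subset[OF hor.smooth_fun_lift[OF o(1) a] sub(1)]
        smooth_fun_subset[OF ver.smooth_fun_lift[OF o(2) b] sub(2)] m]
      hor.ext_d_lift[OF o(1) a mp m12(1)] ver.ext_d_lift[OF o(2) b mp m12(2)] by simp
  then show ?thesis
    using hor.ext_d_lift[OF o(1) h mp m12(1)]
    by (simp add: biderivation_def warped_bivector_def hor_part_linear ver_part_linear parts_lift[OF mp]
        bilinear_lzero[OF B(2)] bilinear_rmul[OF B(1)] p)
qed

lemma pb_hor:
  assumes o: "openin (mtop M\<^sub>1) U\<^sub>1" "openin (mtop M\<^sub>2) U\<^sub>2"
    and h: "smooth_fun M\<^sub>1 U\<^sub>1 h" and a: "smooth_fun M\<^sub>1 U\<^sub>1 a" and m: "m \<in> U\<^sub>1 \<times> U\<^sub>2"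
  shows "pb (\<lambda>m. h (fst m)) (\<lambda>m. a (fst m)) m = factor1.pb h a (fst m)"
  using pb_hor_product[OF o h a factor2.smooth_fun_const[of _ 1] m] by simp

lemma jacobiator_factor1:
  assumes U: "openin (mtop M\<^sub>1) U\<^sub>1" and s: "smooth_fun M\<^sub>1 U\<^sub>1 f" "smooth_fun M\<^sub>1 U\<^sub>1 h" "smooth_fun M\<^sub>1 U\<^sub>1 k"
    and p: "p \<in> U\<^sub>1"
  shows "factor1.jacobiator f h k p = 0"
  using factor1.schouten_jacobiator[OF U s p] poisson(1) U s p unfolding poisson_manifold_def by fastforce

text \<open>
  With two horizontal arguments, each double bracket is the corresponding double bracket on
  the first factor times \<open>b\<close>, and the first factor is Poisson.
\<close>

lemma jacobiator_hor:
  assumes o: "openin (mtop M\<^sub>1) U\<^sub>1" "openin (mtop M\<^sub>2) U\<^sub>2"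
    and h: "smooth_fun M\<^sub>1 U\<^sub>1 h" and k: "smooth_fun M\<^sub>1 U\<^sub>1 k" and a: "smooth_fun M\<^sub>1 U\<^sub>1 a"
    and b: "smooth_fun M\<^sub>2 U\<^sub>2 b" and m: "m \<in> U\<^sub>1 \<times> U\<^sub>2"
  shows "jacobiator (\<lambda>m. h (fst m)) (\<lambda>m. k (fst m)) (\<lambda>m. a (fst m) * b (snd m)) m = 0"
proof -
  note O = openin_Times[OF o] and sub = Times_subset_pre[OF o]
  let ?h = "\<lambda>m. h (fst m)" and ?k = "\<lambda>m. k (fst m)" and ?c = "\<lambda>m. a (fst m) * b (snd m)"
  have lift1: "smooth_fun M (U\<^sub>1 \<times> U\<^sub>2) (\<lambda>m. f (fst m))" if "smooth_fun M\<^sub>1 U\<^sub>1 f" for f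
    by (rule smooth_fun_subset[OF hor.smooth_fun_lift[OF o(1) that] sub(1)])
  have lift2: "smooth_fun M (U\<^sub>1 \<times> U\<^sub>2) (\<lambda>m. f (fst m) * b (snd m))" if "smooth_fun M\<^sub>1 U\<^sub>1 f" for f
    by (rule hor.total.smooth_fun_mult[OF O lift1[OF that] smooth_fun_subset[OF ver.smooth_fun_lift[OF o(2) b] sub(2)]])
  note s1 = factor1.smooth_pb[OF o(1)]
  have mp: "m \<in> points M" and p1: "fst m \<in> points M\<^sub>1" "fst m \<in> U\<^sub>1"
    using hor.total.open_subset_points[OF O m] m by (auto simp: points_prod)
  have 1: "pb ?h (pb ?k ?c) m = factor1.pb h (factor1.pb k a) (fst m) * b (snd m)"
    using pb_cong[OF O lift1[OF h] lift2[OF s1[OF k a]] m, of ?h "pb ?k ?c"]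
      pb_hor_product[OF o k a b] pb_hor_product[OF o h s1[OF k a] b m] by simp
  have 2: "pb ?k (pb ?c ?h) m = - factor1.pb k (factor1.pb h a) (fst m) * b (snd m)"
  proof -
    have "pb ?k (pb ?c ?h) m = pb ?k (\<lambda>m. - (factor1.pb h a (fst m) * b (snd m))) m"
      by (rule pb_cong[OF O lift1[OF k] hor.total.smooth_fun_uminus[OF O lift2[OF s1[OF h a]]] m])
        (use pb_hor_product[OF o h a b] pb_skew[of _ ?c ?h] hor.total.open_subset_points[OF O] in simp_all)
    then show ?thesis
      using pb_uminus_right[OF O lift2[OF s1[OF h a]] m] pb_hor_product[OF o k s1[OF h a] b m] by simp
  qed
  have 3: "pb ?c (pb ?h ?k) m = - factor1.pb (factor1.pb h k) a (fst m) * b (snd m)"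
  proof -
    have "pb ?c (pb ?h ?k) m = pb ?c (\<lambda>m. factor1.pb h k (fst m)) m"
      by (rule pb_cong[OF O lift2[OF a] lift1[OF s1[OF h k]] m]) (use pb_hor[OF o h k] in simp_all)
    then show ?thesis
      using pb_skew[OF mp, of ?c] pb_hor_product[OF o s1[OF h k] a b m] by simp
  qed
  have 4: "factor1.pb k (factor1.pb a h) (fst m) = - factor1.pb k (factor1.pb h a) (fst m)"
    using factor1.pb_cong[OF o(1) k factor1.smooth_fun_uminus[OF o(1) s1[OF h a]] p1(2), of k "factor1.pb a h"]
      factor1.pb_skew[of _ a h] factor1.open_subset_points[OF o(1)]
      factor1.pb_uminus_right[OF o(1) s1[OF h a] p1(2), of k] by simp
  have "factor1.pb h (factor1.pb k a) (fst m) - factor1.pb k (factor1.pb h a) (fst m)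
      - factor1.pb (factor1.pb h k) a (fst m) = 0"
    using jacobiator_factor1[OF o(1) h k a p1(2)] 4 factor1.pb_skew[OF p1(1), of a]
    by (simp add: factor1.jacobiator_def)
  then show ?thesis
    unfolding jacobiator_def 1 2 3 by (simp flip: left_diff_distrib)
qed

end

section \<open>Vanishing of the Jacobi expression\<close>

text \<open>
  All Jacobiators of coordinates and of coefficients vanish.
\<close>

lemma (in levi_civita_atlas) jac_poisson:
  assumes P: "poisson_manifold M P" and U: "openin (mtop M) U"
    and s: "smooth_form M U x" "smooth_form M U y" "smooth_form M U z" and m: "m \<in> U"
  shows "jac x y z m = 0"
proof -
  obtain V \<phi> where chart: "(V, \<phi>) \<in> charts M" and mV: "m \<in> V"
    using coord_chart[OF open_subset_points[OF U m]] by blast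
  define N where "N = U \<inter> V"
  have N: "openin (mtop M) N" "N \<subseteq> U" "N \<subseteq> V" "m \<in> N"
    using U chart_open[OF chart] m mV by (auto simp: N_def)
  have J0: "jacobiator f h k q = 0"
    if "smooth_fun M N f" "smooth_fun M N h" "smooth_fun M N k" "q \<in> N" for f h k q
    using schouten_jacobiator[OF N(1) that] P N(1) that unfolding poisson_manifold_def by fastforce
  let ?c = "\<lambda>\<omega> b q. blinfun_apply (\<omega> q) (coord_field M V \<phi> b q)" and ?x = "\<lambda>b q. \<phi> q \<bullet> b"
  have c: "smooth_fun M N (?c \<omega> b)" if "smooth_form M U \<omega>" for \<omega> b
    by (rule smooth_form_coefficient[OF chart smooth_form_subset[OF that N(2)] N(1,3)])
  have x: "smooth_fun M N (\<lambda>q. \<phi> q \<bullet> b)" for b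
    by (rule smooth_fun_subset[OF smooth_fun_coordinate[OF chart] N(3)])
  have e: "\<omega> q = (\<Sum>b\<in>Basis. ?c \<omega> b q *\<^sub>R ext_d M (\<lambda>q. \<phi> q \<bullet> b) q)" if "q \<in> N" for \<omega> q
    by (rule covector_resolution[OF chart]) (use that N(3) in blast)
  have J: "jacobiator (?x i) (?x j) (?x k) q = 0 \<and> jacobiator (?c x i) (?x j) (?x k) q = 0 \<and>
      jacobiator (?x i) (?c y j) (?x k) q = 0 \<and> jacobiator (?x i) (?x j) (?c z k) q = 0"
    if "q \<in> N" for i j k q
    by (intro conjI J0 x c s that)
  show ?thesis
    by (rule jac_vanishes[where x = "\<lambda>b q. \<phi> q \<bullet> b" and y = "\<lambda>b q. \<phi> q \<bullet> b"
          and z = "\<lambda>b q. \<phi> q \<bullet> b" and a = "?c x" and b = "?c y" and c = "?c z"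
          and I = Basis and J = Basis and K = Basis and \<omega> = x and \<eta> = y and \<gamma> = z,
          OF N(1) x c[OF s(1)] e[of _ x] x c[OF s(2)] e[of _ y] x c[OF s(3)] e[of _ z] J N(4)])
qed

context warped_product
begin

text \<open>
  The third form is allowed to be any combination of differentials of functions that split
  into a horizontal and a vertical factor. This includes horizontal lifts and vertical lifts
  multiplied by a horizontal function, such as \<open>f\<^sub>1 dy\<close>.
\<close>

lemma jac_hor_hor:
  fixes z c :: "'i \<Rightarrow> 'a \<Rightarrow> real" and z' c' :: "'i \<Rightarrow> 'b \<Rightarrow> real"
  assumes U: "openin (mtop M\<^sub>1) U\<^sub>1" "openin (mtop M\<^sub>2) U\<^sub>2" and m: "m \<in> U\<^sub>1 \<times> U\<^sub>2"
    and \<omega>: "smooth_form M\<^sub>1 U\<^sub>1 \<omega>" and \<eta>: "smooth_form M\<^sub>1 U\<^sub>1 \<eta>"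
    and z: "\<And>i. i \<in> I \<Longrightarrow> smooth_fun M\<^sub>1 U\<^sub>1 (z i)" "\<And>i. i \<in> I \<Longrightarrow> smooth_fun M\<^sub>2 U\<^sub>2 (z' i)"
    and c: "\<And>i. i \<in> I \<Longrightarrow> smooth_fun M\<^sub>1 U\<^sub>1 (c i)" "\<And>i. i \<in> I \<Longrightarrow> smooth_fun M\<^sub>2 U\<^sub>2 (c' i)"
    and \<gamma>: "\<And>q. q \<in> U\<^sub>1 \<times> U\<^sub>2 \<Longrightarrow>
      \<gamma> q = (\<Sum>i\<in>I. (c i (fst q) * c' i (snd q)) *\<^sub>R ext_d M (\<lambda>q. z i (fst q) * z' i (snd q)) q)"
  shows "jac (hor.lift \<omega>) (hor.lift \<eta>) \<gamma> m = 0"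
proof -
  have p: "fst m \<in> U\<^sub>1" "snd m \<in> U\<^sub>2" using m by auto
  obtain V \<phi> where chart: "(V, \<phi>) \<in> charts M\<^sub>1" and mV: "fst m \<in> V"
    using factor1.coord_chart[OF factor1.open_subset_points[OF U(1) p(1)]] by blast
  define N where "N = U\<^sub>1 \<inter> V"
  have N: "openin (mtop M\<^sub>1) N" "N \<subseteq> U\<^sub>1" "N \<subseteq> V" "m \<in> N \<times> U\<^sub>2"
    using U factor1.chart_open[OF chart] p mV by (auto simp: N_def mem_Times_iff)
  note O = openin_Times[OF N(1) U(2)] and sub = Times_subset_pre[OF N(1) U(2)]
  let ?c = "\<lambda>\<omega> b p. blinfun_apply (\<omega> p) (coord_field M\<^sub>1 V \<phi> b p)"
  have s1: "smooth_fun M (N \<times> U\<^sub>2) (\<lambda>q. f (fst q))" if "smooth_fun M\<^sub>1 N f" for f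
    by (rule smooth_fun_subset[OF hor.smooth_fun_lift[OF N(1) that] sub(1)])
  have s2: "smooth_fun M (N \<times> U\<^sub>2) (\<lambda>q. f (fst q) * h (snd q))"
    if "smooth_fun M\<^sub>1 U\<^sub>1 f" "smooth_fun M\<^sub>2 U\<^sub>2 h" for f h
    by (rule hor.total.smooth_fun_mult[OF O s1[OF smooth_fun_subset[OF that(1) N(2)]]
          smooth_fun_subset[OF ver.smooth_fun_lift[OF U(2) that(2)] sub(2)]])
  have c1: "smooth_fun M\<^sub>1 N (?c \<omega> b)" if "smooth_form M\<^sub>1 U\<^sub>1 \<omega>" for \<omega> b
    by (rule factor1.smooth_form_coefficient[OF chart smooth_form_subset[OF that N(2)] N(1,3)])
  have x1: "smooth_fun M\<^sub>1 N (\<lambda>q. \<phi> q \<bullet> b)" for b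
    by (rule smooth_fun_subset[OF factor1.smooth_fun_coordinate[OF chart] N(3)])
  have e: "hor.lift \<omega> q = (\<Sum>b\<in>Basis. ?c \<omega> b (fst q) *\<^sub>R ext_d M (\<lambda>q. \<phi> (fst q) \<bullet> b) q)"
    if "q \<in> N \<times> U\<^sub>2" for \<omega> q
    by (rule hor.lift_expansion[OF chart hor.total.open_subset_points[OF O that]]) (use that N(3) in auto)
  have J: "jacobiator (\<lambda>m. h (fst m)) (\<lambda>m. k (fst m)) (\<lambda>m. a (fst m) * b (snd m)) q = 0"
    if "smooth_fun M\<^sub>1 N h" "smooth_fun M\<^sub>1 N k" "smooth_fun M\<^sub>1 U\<^sub>1 a" "smooth_fun M\<^sub>2 U\<^sub>2 b"
      "q \<in> N \<times> U\<^sub>2" for h k a b q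
    by (rule jacobiator_hor[OF N(1) U(2) that(1,2) smooth_fun_subset[OF that(3) N(2)] that(4,5)])
  have JJ: "jacobiator (\<lambda>q. \<phi> (fst q) \<bullet> i) (\<lambda>q. \<phi> (fst q) \<bullet> j) (\<lambda>q. z k (fst q) * z' k (snd q)) q = 0 \<and>
      jacobiator (\<lambda>q. ?c \<omega> i (fst q)) (\<lambda>q. \<phi> (fst q) \<bullet> j) (\<lambda>q. z k (fst q) * z' k (snd q)) q = 0 \<and>
      jacobiator (\<lambda>q. \<phi> (fst q) \<bullet> i) (\<lambda>q. ?c \<eta> j (fst q)) (\<lambda>q. z k (fst q) * z' k (snd q)) q = 0 \<and>
      jacobiator (\<lambda>q. \<phi> (fst q) \<bullet> i) (\<lambda>q. \<phi> (fst q) \<bullet> j) (\<lambda>q. c k (fst q) * c' k (snd q)) q = 0"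
    if "k \<in> I" "q \<in> N \<times> U\<^sub>2" for i j k q
    using J[OF x1 x1 z(1)[OF that(1)] z(2)[OF that(1)] that(2)]
      J[OF c1[OF \<omega>] x1 z(1)[OF that(1)] z(2)[OF that(1)] that(2)]
      J[OF x1 c1[OF \<eta>] z(1)[OF that(1)] z(2)[OF that(1)] that(2)]
      J[OF x1 x1 c(1)[OF that(1)] c(2)[OF that(1)] that(2)]
    by (intro conjI)
  show ?thesis
    by (rule jac_vanishes[where x = "\<lambda>b q. \<phi> (fst q) \<bullet> b" and y = "\<lambda>b q. \<phi> (fst q) \<bullet> b"
          and z = "\<lambda>i q. z i (fst q) * z' i (snd q)" and c = "\<lambda>i q. c i (fst q) * c' i (snd q)"
          and a = "\<lambda>b q. ?c \<omega> b (fst q)" and b = "\<lambda>b q. ?c \<eta> b (fst q)"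
          and I = Basis and J = Basis and K = I
          and \<omega> = "hor.lift \<omega>" and \<eta> = "hor.lift \<eta>" and \<gamma> = \<gamma>,
          OF O s1[OF x1] s1[OF c1[OF \<omega>]] e s1[OF x1] s1[OF c1[OF \<eta>]] e s2[OF z] s2[OF c] \<gamma> JJ N(4)])
      (use N(2) in auto)
qed

lemma jac_hor_hor_hor:
  assumes U: "openin (mtop M\<^sub>1) U\<^sub>1" "openin (mtop M\<^sub>2) U\<^sub>2" and m: "m \<in> U\<^sub>1 \<times> U\<^sub>2"
    and f: "smooth_form M\<^sub>1 U\<^sub>1 \<omega>" "smooth_form M\<^sub>1 U\<^sub>1 \<eta>" "smooth_form M\<^sub>1 U\<^sub>1 \<gamma>"
  shows "jac (hor.lift \<omega>) (hor.lift \<eta>) (hor.lift \<gamma>) m = 0"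
proof -
  have p: "fst m \<in> U\<^sub>1" "snd m \<in> U\<^sub>2" using m by auto
  obtain V \<phi> where chart: "(V, \<phi>) \<in> charts M\<^sub>1" and mV: "fst m \<in> V"
    using factor1.coord_chart[OF factor1.open_subset_points[OF U(1) p(1)]] by blast
  define N where "N = U\<^sub>1 \<inter> V"
  have N: "openin (mtop M\<^sub>1) N" "N \<subseteq> U\<^sub>1" "N \<subseteq> V" "m \<in> N \<times> U\<^sub>2"
    using U factor1.chart_open[OF chart] p mV by (auto simp: N_def mem_Times_iff)
  note O = openin_Times[OF N(1) U(2)]
  have e: "hor.lift \<gamma> q = (\<Sum>b\<in>Basis. (blinfun_apply (\<gamma> (fst q)) (coord_field M\<^sub>1 V \<phi> b (fst q)) * 1) *\<^sub>R
      ext_d M (\<lambda>q. (\<phi> (fst q) \<bullet> b) * 1) q)" if "q \<in> N \<times> U\<^sub>2" for q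
    using hor.lift_expansion[OF chart hor.total.open_subset_points[OF O that], of \<gamma>] that N(3) by auto
  show ?thesis
    by (rule jac_hor_hor[OF N(1) U(2) N(4) smooth_form_subset[OF f(1) N(2)] smooth_form_subset[OF f(2) N(2)]
          smooth_fun_subset[OF factor1.smooth_fun_coordinate[OF chart] N(3)] factor2.smooth_fun_const
          factor1.smooth_form_coefficient[OF chart smooth_form_subset[OF f(3) N(2)] N(1,3)]
          factor2.smooth_fun_const e])
qed

lemma jac_hor_hor_ver:
  assumes U: "openin (mtop M\<^sub>1) U\<^sub>1" "openin (mtop M\<^sub>2) U\<^sub>2" and m: "m \<in> U\<^sub>1 \<times> U\<^sub>2"
    and f: "smooth_form M\<^sub>1 U\<^sub>1 \<omega>" "smooth_form M\<^sub>1 U\<^sub>1 \<eta>" and \<gamma>: "smooth_form M\<^sub>2 U\<^sub>2 \<gamma>"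
    and h: "smooth_fun M\<^sub>1 U\<^sub>1 h"
  shows "jac (hor.lift \<omega>) (hor.lift \<eta>) (\<lambda>q. h (fst q) *\<^sub>R ver.lift \<gamma> q) m = 0"
proof -
  have p: "fst m \<in> U\<^sub>1" "snd m \<in> U\<^sub>2" using m by auto
  obtain V \<phi> where chart: "(V, \<phi>) \<in> charts M\<^sub>2" and mV: "snd m \<in> V"
    using factor2.coord_chart[OF factor2.open_subset_points[OF U(2) p(2)]] by blast
  define N where "N = U\<^sub>2 \<inter> V"
  have N: "openin (mtop M\<^sub>2) N" "N \<subseteq> U\<^sub>2" "N \<subseteq> V" "m \<in> U\<^sub>1 \<times> N"
    using U factor2.chart_open[OF chart] p mV by (auto simp: N_def mem_Times_iff)
  note O = openin_Times[OF U(1) N(1)]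
  have e: "h (fst q) *\<^sub>R ver.lift \<gamma> q =
      (\<Sum>b\<in>Basis. (h (fst q) * blinfun_apply (\<gamma> (snd q)) (coord_field M\<^sub>2 V \<phi> b (snd q))) *\<^sub>R
        ext_d M (\<lambda>q. 1 * (\<phi> (snd q) \<bullet> b)) q)" if "q \<in> U\<^sub>1 \<times> N" for q
    using ver.lift_expansion[OF chart hor.total.open_subset_points[OF O that], of \<gamma>] that N(3)
    by (auto simp: scaleR_sum_right)
  show ?thesis
    by (rule jac_hor_hor[OF U(1) N(1) N(4) f factor1.smooth_fun_const
          smooth_fun_subset[OF factor2.smooth_fun_coordinate[OF chart] N(3)] h
          factor2.smooth_form_coefficient[OF chart smooth_form_subset[OF \<gamma> N(2)] N(1,3)] e])
qed

end

section \<open>Null sectional curvatures in an orthonormal frame\<close>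

text \<open>
  The index bounds the labels of the negative frame forms, which must lie in the range of
  the orthonormal frame.
\<close>

lemma form_index_le_DIM: "form_index (b :: 'e::euclidean_space \<Rightarrow> 'e \<Rightarrow> real) \<le> DIM('e)"
proof -
  let ?A = "{dim S | S :: 'e set. subspace S \<and> (\<forall>v \<in> S. v \<noteq> 0 \<longrightarrow> b v v < 0)}"
  have sub: "?A \<subseteq> {..DIM('e)}" using dim_subset_UNIV by auto
  have "dim {0 :: 'e} \<in> ?A" by (auto intro!: exI[of _ "{0}"] simp: subspace_def)
  then have "Max ?A \<in> ?A" using finite_subset[OF sub] by (intro Max_in) auto
  then show ?thesis using sub unfolding form_index_def by blast
qed

lemma semi_riemannian_index_le:
  fixes M :: "('a, 'e::euclidean_space) manifold"
  assumes "semi_riemannian M g q" "p \<in> points M"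
  shows "q \<le> DIM('e)"
  using assms form_index_le_DIM[of "g p"] unfolding semi_riemannian_def by metis

locale warped_frame = warped_product M\<^sub>1 M\<^sub>2 P\<^sub>1 P\<^sub>2 g\<^sub>1 g\<^sub>2 q\<^sub>1 q\<^sub>2 f\<^sub>1 \<nu>\<^sub>1 D
  for M\<^sub>1 :: "('a, 'e::euclidean_space) manifold" and M\<^sub>2 :: "('b, 'f::euclidean_space) manifold"
    and P\<^sub>1 P\<^sub>2 g\<^sub>1 g\<^sub>2 q\<^sub>1 q\<^sub>2 f\<^sub>1 \<nu>\<^sub>1 D +
  fixes U\<^sub>1 :: "'a set" and U\<^sub>2 :: "'b set"
    and dx :: "nat \<Rightarrow> ('a, 'e) one_form" and dy :: "nat \<Rightarrow> ('b, 'f) one_form"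
  assumes frames: "orthonormal_coframe M\<^sub>1 g\<^sub>1 q\<^sub>1 U\<^sub>1 dx" "orthonormal_coframe M\<^sub>2 g\<^sub>2 q\<^sub>2 U\<^sub>2 dy"
begin

abbreviation "U \<equiv> U\<^sub>1 \<times> U\<^sub>2"
abbreviation "F \<equiv> \<lambda>m :: 'a \<times> 'b. f\<^sub>1 (fst m)"
abbreviation "dxh \<equiv> \<lambda>i. hor.lift (dx i)"
abbreviation "dyv \<equiv> \<lambda>i. ver.lift (dy i)"
abbreviation "fdyv \<equiv> \<lambda>i m. F m *\<^sub>R dyv i m"
abbreviation "K \<equiv> sectional M G P D"
abbreviation "NK \<equiv> null_sectional M G P D"
abbreviation "\<epsilon>\<^sub>1 \<equiv> \<lambda>l (m :: 'a \<times> 'b). cometric g\<^sub>1 (fst m) (dx l (fst m)) (dx l (fst m))"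
abbreviation "\<epsilon>\<^sub>2 \<equiv> \<lambda>l (m :: 'a \<times> 'b). cometric g\<^sub>2 (snd m) (dy l (snd m)) (dy l (snd m))"

lemma open_frames: "openin (mtop M\<^sub>1) U\<^sub>1" "openin (mtop M\<^sub>2) U\<^sub>2" "openin (mtop M) U"
  using frames openin_Times unfolding orthonormal_coframe_def by blast+

lemma frame_point: "m \<in> U \<Longrightarrow> m \<in> points M"
  by (rule hor.total.open_subset_points[OF open_frames(3)])

lemma frame_forms:
  "i \<in> {1..DIM('e)} \<Longrightarrow> smooth_form M\<^sub>1 U\<^sub>1 (dx i)" "j \<in> {1..DIM('f)} \<Longrightarrow> smooth_form M\<^sub>2 U\<^sub>2 (dy j)"
  using frames unfolding orthonormal_coframe_def by blast+

lemma smooth_warping: "smooth_fun M\<^sub>1 U\<^sub>1 f\<^sub>1" "smooth_fun M U F"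
proof -
  show s: "smooth_fun M\<^sub>1 U\<^sub>1 f\<^sub>1"
    by (rule smooth_fun_subset[OF warping(1) openin_subset[OF open_frames(1)]])
  show "smooth_fun M U F"
    by (rule smooth_fun_subset[OF hor.smooth_fun_lift[OF open_frames(1) s] Times_subset_pre(1)[OF open_frames(1,2)]])
qed

lemma lifted_frame_forms:
  "i \<in> {1..DIM('e)} \<Longrightarrow> smooth_form M U (dxh i)"
  "j \<in> {1..DIM('f)} \<Longrightarrow> smooth_form M U (dyv j)"
  "j \<in> {1..DIM('f)} \<Longrightarrow> smooth_form M U (fdyv j)"
proof -
  note sub = Times_subset_pre[OF open_frames(1,2)]
  show "smooth_form M U (dxh i)" if "i \<in> {1..DIM('e)}"
    by (rule smooth_form_subset[OF hor.smooth_form_lift[OF open_frames(1) frame_forms(1)[OF that]] sub(1)])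
  show v: "smooth_form M U (dyv j)" if "j \<in> {1..DIM('f)}" for j
    by (rule smooth_form_subset[OF ver.smooth_form_lift[OF open_frames(2) frame_forms(2)[OF that]] sub(2)])
  show "smooth_form M U (fdyv j)" if "j \<in> {1..DIM('f)}"
    by (rule hor.total.smooth_form_scale[OF open_frames(3) smooth_warping(2) v[OF that]])
qed

lemma cometric_zero:
  assumes "m \<in> points M"
  shows "cometric g\<^sub>1 (fst m) 0 \<alpha> = 0" "cometric g\<^sub>1 (fst m) \<alpha> 0 = 0"
    "cometric g\<^sub>2 (snd m) 0 \<beta> = 0" "cometric g\<^sub>2 (snd m) \<beta> 0 = 0"
  using bilinear_cometric[where g = g\<^sub>1 and p = "fst m", OF factor_metrics(1-3)[OF assms]]
    bilinear_cometric[where g = g\<^sub>2 and p = "snd m", OF factor_metrics(4-6)[OF assms]]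
  by (simp_all add: bilinear_lzero bilinear_rzero)

lemma gram_dyv:
  assumes m: "m \<in> U"
  shows "i \<in> {1..DIM('e)} \<Longrightarrow> j \<in> {1..DIM('e)} \<Longrightarrow>
      G m (dxh i m) (dxh j m) = (if i = j then if i \<le> q\<^sub>1 then -1 else 1 else 0)"
    "G m (dxh i m) (dyv j m) = 0" "G m (dyv j m) (dxh i m) = 0"
    "i \<in> {1..DIM('f)} \<Longrightarrow> j \<in> {1..DIM('f)} \<Longrightarrow>
      G m (dyv i m) (dyv j m) = (if i = j then if i \<le> q\<^sub>2 then -1 else 1 else 0) / (F m)\<^sup>2"
  using frames m unfolding orthonormal_coframe_def
  by (auto simp: warped_cometric[OF frame_point[OF m]] parts_lift[OF frame_point[OF m]]
      cometric_zero[OF frame_point[OF m]])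

lemma gram:
  assumes m: "m \<in> U"
  shows "i \<in> {1..DIM('e)} \<Longrightarrow> j \<in> {1..DIM('e)} \<Longrightarrow>
      G m (dxh i m) (dxh j m) = (if i = j then if i \<le> q\<^sub>1 then -1 else 1 else 0)"
    "G m (dxh i m) (fdyv j m) = 0" "G m (fdyv j m) (dxh i m) = 0"
    "i \<in> {1..DIM('f)} \<Longrightarrow> j \<in> {1..DIM('f)} \<Longrightarrow>
      G m (fdyv i m) (fdyv j m) = (if i = j then if i \<le> q\<^sub>2 then -1 else 1 else 0)"
  using gram_dyv[OF m] warping_pos[OF frame_point[OF m]] cometric_bilinear[OF frame_point[OF m]]
  by (simp_all add: bilinear_lmul bilinear_rmul power2_eq_square)

lemma frame_signs:
  assumes "m \<in> U"
  shows "l \<in> {1..DIM('e)} \<Longrightarrow> \<epsilon>\<^sub>1 l m = (if l \<le> q\<^sub>1 then -1 else 1)"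
    "l \<in> {1..DIM('f)} \<Longrightarrow> \<epsilon>\<^sub>2 l m = (if l \<le> q\<^sub>2 then -1 else 1)"
  using frames assms unfolding orthonormal_coframe_def by auto

lemma index_le:
  assumes "m \<in> U"
  shows "q\<^sub>1 \<le> DIM('e)" "q\<^sub>2 \<le> DIM('f)"
  using semi_riemannian_index_le[OF metric(1), of "fst m"] semi_riemannian_index_le[OF metric(2), of "snd m"]
    frame_point[OF assms] by (simp_all add: points_prod)

context
  fixes m assumes m: "m \<in> U"
begin

lemma F_nonzero: "F m \<noteq> 0"
  using warping_pos[OF frame_point[OF m]] by simp

lemma G_scale: "G m \<alpha> (c *\<^sub>R \<beta>) = c * G m \<alpha> \<beta>" "G m (c *\<^sub>R \<alpha>) \<beta> = c * G m \<alpha> \<beta>"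
  using cometric_bilinear[OF frame_point[OF m]] by (simp_all add: bilinear_lmul bilinear_rmul)

text \<open>
  For orthogonal forms the sectional curvature depends only on the plane that they span.
\<close>

lemma K_rescale:
  assumes "i \<in> {1..DIM('e)}" "l \<in> {1..DIM('f)}"
  shows "K (dxh i) (fdyv l) m = K (dxh i) (dyv l) m" "K (fdyv l) (dxh i) m = K (dyv l) (dxh i) m"
proof -
  note s = open_frames(3) smooth_warping(2) F_nonzero
  note f = lifted_frame_forms(1)[OF assms(1)] lifted_frame_forms(2,3)[OF assms(2)]
  show "K (dxh i) (fdyv l) m = K (dxh i) (dyv l) m"
    by (rule sectional_scale_right[OF s f(1,2) m gram_dyv(3)[OF m]])
  show "K (fdyv l) (dxh i) m = K (dyv l) (dxh i) m"
    by (rule sectional_scale_left[OF s f(2,1) m])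
qed

lemma K_rescale_ver:
  assumes k: "s \<in> {1..DIM('f)}" "l \<in> {1..DIM('f)}" "s \<noteq> l"
  shows "K (fdyv s) (fdyv l) m = K (dyv s) (dyv l) m"
proof -
  note s = open_frames(3) smooth_warping(2) F_nonzero
  note f = lifted_frame_forms(2,3)[OF k(2)]
  have "K (fdyv s) (fdyv l) m = K (dyv s) (fdyv l) m"
    by (rule sectional_scale_left[OF s lifted_frame_forms(2)[OF k(1)] f(2) m])
  also have "\<dots> = K (dyv s) (dyv l) m"
    by (rule sectional_scale_right[OF s lifted_frame_forms(2)[OF k(1)] f(1) m])
      (use gram_dyv(4)[OF m k(2,1)] k(3) in simp)
  finally show ?thesis .
qed

lemma R_rescale:
  assumes x: "smooth_form M U x" and l: "l \<in> {1..DIM('f)}" and o: "G m (dyv l m) w = 0"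
  shows "G m (R x (fdyv l) (fdyv l) m) w = (F m)\<^sup>2 * G m (R x (dyv l) (dyv l) m) w"
  by (rule curvature_scale[OF open_frames(3) smooth_warping(2) x lifted_frame_forms(2)[OF l] m o])

lemma R_rescale_left:
  assumes "i \<in> {1..DIM('f)}" "smooth_form M U t"
  shows "R (fdyv i) t t m = F m *\<^sub>R R (dyv i) t t m"
  by (rule R_scale_left[OF open_frames(3) smooth_warping(2) lifted_frame_forms(2)[OF assms(1)] assms(2,2) m])

lemmas null_formula = null_sectional_formula[OF open_frames(3) _ _ _ m]
lemmas pair_symmetry = R_pair_symmetry[OF open_frames(3) _ _ _ m]
lemmas frame_simps = gram lifted_frame_forms frame_signs[OF m]

lemma null_hh_h:
  assumes i: "i \<in> {1..q\<^sub>1}" and s: "s \<in> {q\<^sub>1 + 1..DIM('e)}" and l: "l \<in> {1..DIM('e)} - {i, s}"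
  shows "NK (null_form (dxh i) (dxh s)) (dxh l) m =
    - (1/2) * K (dxh i) (dxh l) m + (1/2) * K (dxh s) (dxh l) m
    + \<epsilon>\<^sub>1 l m * G m (R (dxh i) (dxh l) (dxh l) m) (dxh s m)"
proof (rule null_formula)
  show "jac (dxh i) (dxh l) (dxh s) m = 0"
    by (rule jac_hor_hor_hor[OF open_frames(1,2) m]) (use i s l index_le[OF m] in \<open>auto intro: frame_forms\<close>)
qed (use i s l index_le[OF m] in \<open>auto simp: frame_simps\<close>)

text \<open>
  The Jacobi expression is invariant under cyclic rotation, which brings the two horizontal
  forms to the front.
\<close>

lemma null_hh_v:
  assumes i: "i \<in> {1..q\<^sub>1}" and s: "s \<in> {q\<^sub>1 + 1..DIM('e)}" and l: "l \<in> {1..DIM('f)}"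
  shows "NK (null_form (dxh i) (dxh s)) (fdyv l) m =
    - (1/2) * K (dxh i) (dyv l) m + (1/2) * K (dxh s) (dyv l) m
    + \<epsilon>\<^sub>2 l m * (F m)^2 * G m (R (dxh i) (dyv l) (dyv l) m) (dxh s m)"
proof -
  have r: "i \<in> {1..DIM('e)}" "s \<in> {1..DIM('e)}" using i s index_le[OF m] by auto
  have J: "jac (dxh i) (fdyv l) (dxh s) m = 0"
    using jac_hor_hor_ver[OF open_frames(1,2) m frame_forms(1)[OF r(2)] frame_forms(1)[OF r(1)]
        frame_forms(2)[OF l] smooth_warping(1)] jac_cycle[of "dxh s" "dxh i" "fdyv l" m] by simp
  have "NK (null_form (dxh i) (dxh s)) (fdyv l) m =
    - (1/2) * K (dxh i) (fdyv l) m + (1/2) * K (dxh s) (fdyv l) m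
    + \<epsilon>\<^sub>2 l m * G m (R (dxh i) (fdyv l) (fdyv l) m) (dxh s m)"
    by (rule null_formula) (use i s l r J in \<open>auto simp: frame_simps\<close>)
  then show ?thesis
    using K_rescale(1)[OF r(1) l] K_rescale(1)[OF r(2) l]
      R_rescale[OF lifted_frame_forms(1)[OF r(1)] l gram_dyv(3)[OF m, of l s]] by simp
qed

lemma null_hv_h:
  assumes i: "i \<in> {1..q\<^sub>1}" and s: "s \<in> {q\<^sub>2 + 1..DIM('f)}" and l: "l \<in> {1..DIM('e)} - {i}"
  shows "NK (null_form (dxh i) (fdyv s)) (dxh l) m =
    - (1/2) * K (dxh i) (dxh l) m + (1/2) * K (dyv s) (dxh l) m
    + \<epsilon>\<^sub>1 l m * F m * G m (R (dxh i) (dxh l) (dxh l) m) (dyv s m)"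
proof -
  have r: "i \<in> {1..DIM('e)}" "s \<in> {1..DIM('f)}" "l \<in> {1..DIM('e)}" using i s l index_le[OF m] by auto
  have J: "jac (dxh i) (dxh l) (fdyv s) m = 0"
    by (rule jac_hor_hor_ver[OF open_frames(1,2) m frame_forms(1)[OF r(1)] frame_forms(1)[OF r(3)]
        frame_forms(2)[OF r(2)] smooth_warping(1)])
  have "NK (null_form (dxh i) (fdyv s)) (dxh l) m =
    - (1/2) * K (dxh i) (dxh l) m + (1/2) * K (fdyv s) (dxh l) m
    + \<epsilon>\<^sub>1 l m * G m (R (dxh i) (dxh l) (dxh l) m) (fdyv s m)"
    by (rule null_formula) (use i s l r J in \<open>auto simp: frame_simps\<close>)
  then show ?thesis
    using K_rescale(2)[OF r(3,2)] by (simp add: G_scale)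
qed

lemma null_hv_v:
  assumes i: "i \<in> {1..q\<^sub>1}" and s: "s \<in> {q\<^sub>2 + 1..DIM('f)}" and l: "l \<in> {1..DIM('f)} - {s}"
    and P: "poisson_manifold M P"
  shows "NK (null_form (dxh i) (fdyv s)) (fdyv l) m =
    - (1/2) * K (dxh i) (dyv l) m + (1/2) * K (dyv s) (dyv l) m
    + \<epsilon>\<^sub>2 l m * (F m)^3 * G m (R (dxh i) (dyv l) (dyv l) m) (dyv s m)"
proof -
  have r: "i \<in> {1..DIM('e)}" "s \<in> {1..DIM('f)}" "l \<in> {1..DIM('f)}" using i s l index_le[OF m] by auto
  have J: "jac (dxh i) (fdyv l) (fdyv s) m = 0"
    by (rule jac_poisson[OF P open_frames(3) _ _ _ m]) (use r in \<open>auto intro: lifted_frame_forms\<close>)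
  have "NK (null_form (dxh i) (fdyv s)) (fdyv l) m =
    - (1/2) * K (dxh i) (fdyv l) m + (1/2) * K (fdyv s) (fdyv l) m
    + \<epsilon>\<^sub>2 l m * G m (R (dxh i) (fdyv l) (fdyv l) m) (fdyv s m)"
    by (rule null_formula) (use i s l r J in \<open>auto simp: frame_simps\<close>)
  moreover have "G m (dyv l m) (dyv s m) = 0" using gram_dyv(4)[OF m r(3,2)] l by auto
  ultimately show ?thesis
    using K_rescale(1)[OF r(1,3)] K_rescale_ver[OF r(2,3)] l
      R_rescale[OF lifted_frame_forms(1)[OF r(1)] r(3), of "dyv s m"]
    by (simp add: G_scale power2_eq_square power3_eq_cube)
qed

text \<open>
  Here \<open>null_sectional_formula\<close> yields the mixed term with the roles of
  \<open>\<alpha>\<close> and \<open>\<beta>\<close> exchanged; pair symmetry puts it into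
  the stated form.
\<close>

lemma null_vh_h:
  assumes i: "i \<in> {1..q\<^sub>2}" and s: "s \<in> {q\<^sub>1 + 1..DIM('e)}" and l: "l \<in> {1..DIM('e)} - {s}"
  shows "NK (null_form (fdyv i) (dxh s)) (dxh l) m =
    (1/2) * K (dxh s) (dxh l) m - (1/2) * K (dyv i) (dxh l) m
    + \<epsilon>\<^sub>1 l m * F m * G m (R (dxh s) (dxh l) (dxh l) m) (dyv i m)"
proof -
  have r: "i \<in> {1..DIM('f)}" "s \<in> {1..DIM('e)}" "l \<in> {1..DIM('e)}" using i s l index_le[OF m] by auto
  have J: "jac (fdyv i) (dxh l) (dxh s) m = 0"
    using jac_hor_hor_ver[OF open_frames(1,2) m frame_forms(1)[OF r(3)] frame_forms(1)[OF r(2)]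
        frame_forms(2)[OF r(1)] smooth_warping(1)] jac_cycle[of "fdyv i" "dxh l" "dxh s" m] by simp
  have "NK (null_form (fdyv i) (dxh s)) (dxh l) m =
    - (1/2) * K (fdyv i) (dxh l) m + (1/2) * K (dxh s) (dxh l) m
    + \<epsilon>\<^sub>1 l m * G m (R (fdyv i) (dxh l) (dxh l) m) (dxh s m)"
    by (rule null_formula) (use i s l r J in \<open>auto simp: frame_simps\<close>)
  moreover have "G m (R (fdyv i) (dxh l) (dxh l) m) (dxh s m) = G m (R (dxh s) (dxh l) (dxh l) m) (fdyv i m)"
    by (rule pair_symmetry) (use i s l r J in \<open>auto simp: frame_simps\<close>)
  ultimately show ?thesis
    using K_rescale(2)[OF r(3,1)] by (simp add: G_scale)
qed

lemma null_vh_v: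
  assumes i: "i \<in> {1..q\<^sub>2}" and s: "s \<in> {q\<^sub>1 + 1..DIM('e)}" and l: "l \<in> {1..DIM('f)} - {i}"
    and P: "poisson_manifold M P"
  shows "NK (null_form (fdyv i) (dxh s)) (fdyv l) m =
    (1/2) * K (dxh s) (dyv l) m - (1/2) * K (dyv i) (dyv l) m
    + \<epsilon>\<^sub>2 l m * (F m)^3 * G m (R (dxh s) (dyv l) (dyv l) m) (dyv i m)"
proof -
  have r: "i \<in> {1..DIM('f)}" "s \<in> {1..DIM('e)}" "l \<in> {1..DIM('f)}" using i s l index_le[OF m] by auto
  have J: "jac (fdyv i) (fdyv l) (dxh s) m = 0"
    by (rule jac_poisson[OF P open_frames(3) _ _ _ m]) (use r in \<open>auto intro: lifted_frame_forms\<close>)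
  have "NK (null_form (fdyv i) (dxh s)) (fdyv l) m =
    - (1/2) * K (fdyv i) (fdyv l) m + (1/2) * K (dxh s) (fdyv l) m
    + \<epsilon>\<^sub>2 l m * G m (R (fdyv i) (fdyv l) (fdyv l) m) (dxh s m)"
    by (rule null_formula) (use i s l r J in \<open>auto simp: frame_simps\<close>)
  moreover have "G m (R (fdyv i) (fdyv l) (fdyv l) m) (dxh s m) = G m (R (dxh s) (fdyv l) (fdyv l) m) (fdyv i m)"
    by (rule pair_symmetry) (use i s l r J in \<open>auto simp: frame_simps\<close>)
  moreover have "G m (dyv l m) (dyv i m) = 0" using gram_dyv(4)[OF m r(3,1)] l by auto
  ultimately show ?thesis
    using K_rescale(1)[OF r(2,3)] K_rescale_ver[OF r(1,3)] l
      R_rescale[OF lifted_frame_forms(1)[OF r(2)] r(3), of "dyv i m"]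
    by (simp add: G_scale power2_eq_square power3_eq_cube)
qed

lemma null_vv_h:
  assumes i: "i \<in> {1..q\<^sub>2}" and s: "s \<in> {q\<^sub>2 + 1..DIM('f)}" and l: "l \<in> {1..DIM('e)}"
    and P: "poisson_manifold M P"
  shows "NK (null_form (fdyv i) (fdyv s)) (dxh l) m =
    - (1/2) * K (dyv i) (dxh l) m + (1/2) * K (dyv s) (dxh l) m
    + \<epsilon>\<^sub>1 l m * (F m)^2 * G m (R (dyv i) (dxh l) (dxh l) m) (dyv s m)"
proof -
  have r: "i \<in> {1..DIM('f)}" "s \<in> {1..DIM('f)}" using i s index_le[OF m] by auto
  have J: "jac (fdyv i) (dxh l) (fdyv s) m = 0"
    by (rule jac_poisson[OF P open_frames(3) _ _ _ m]) (use r l in \<open>auto intro: lifted_frame_forms\<close>)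
  have "NK (null_form (fdyv i) (fdyv s)) (dxh l) m =
    - (1/2) * K (fdyv i) (dxh l) m + (1/2) * K (fdyv s) (dxh l) m
    + \<epsilon>\<^sub>1 l m * G m (R (fdyv i) (dxh l) (dxh l) m) (fdyv s m)"
    by (rule null_formula) (use i s l r J in \<open>auto simp: frame_simps\<close>)
  then show ?thesis
    using K_rescale(2)[OF l r(1)] K_rescale(2)[OF l r(2)] R_rescale_left[OF r(1) lifted_frame_forms(1)[OF l]]
    by (simp add: G_scale power2_eq_square)
qed

lemma null_vv_v:
  assumes i: "i \<in> {1..q\<^sub>2}" and s: "s \<in> {q\<^sub>2 + 1..DIM('f)}" and l: "l \<in> {1..DIM('f)} - {i, s}"
    and P: "poisson_manifold M P"
  shows "NK (null_form (fdyv i) (fdyv s)) (fdyv l) m =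
    - (1/2) * K (dyv i) (dyv l) m + (1/2) * K (dyv s) (dyv l) m
    + \<epsilon>\<^sub>2 l m * (F m)^4 * G m (R (dyv i) (dyv l) (dyv l) m) (dyv s m)"
proof -
  have r: "i \<in> {1..DIM('f)}" "s \<in> {1..DIM('f)}" "l \<in> {1..DIM('f)}" using i s l index_le[OF m] by auto
  have J: "jac (fdyv i) (fdyv l) (fdyv s) m = 0"
    by (rule jac_poisson[OF P open_frames(3) _ _ _ m]) (use r in \<open>auto intro: lifted_frame_forms\<close>)
  have "NK (null_form (fdyv i) (fdyv s)) (fdyv l) m =
    - (1/2) * K (fdyv i) (fdyv l) m + (1/2) * K (fdyv s) (fdyv l) m
    + \<epsilon>\<^sub>2 l m * G m (R (fdyv i) (fdyv l) (fdyv l) m) (fdyv s m)"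
    by (rule null_formula) (use i s l r J in \<open>auto simp: frame_simps\<close>)
  moreover have "G m (R (fdyv i) (fdyv l) (fdyv l) m) (fdyv s m) =
      (F m)^4 * G m (R (dyv i) (dyv l) (dyv l) m) (dyv s m)"
  proof -
    have "G m (dyv l m) (dyv s m) = 0" using gram_dyv(4)[OF m r(3,2)] l by auto
    then have "G m (R (dyv i) (fdyv l) (fdyv l) m) (dyv s m) =
        (F m)\<^sup>2 * G m (R (dyv i) (dyv l) (dyv l) m) (dyv s m)"
      by (rule R_rescale[OF lifted_frame_forms(2)[OF r(1)] r(3)])
    then show ?thesis
      using R_rescale_left[OF r(1) lifted_frame_forms(3)[OF r(3)]]
      by (simp add: G_scale power2_eq_square power4_eq_xxxx)
  qed
  ultimately show ?thesis
    using K_rescale_ver[OF r(1,3)] K_rescale_ver[OF r(2,3)] l by simp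
qed

end

end

theorem proposition4p1:
  fixes M\<^sub>1 :: "('a, 'e::euclidean_space) manifold"
    and M\<^sub>2 :: "('b, 'f::euclidean_space) manifold"
    and P\<^sub>1 :: "('a, 'e) cotensor" and P\<^sub>2 :: "('b, 'f) cotensor"
    and g\<^sub>1 :: "('a, 'e) metric" and g\<^sub>2 :: "('b, 'f) metric"
    and q\<^sub>1 q\<^sub>2 :: nat
    and f\<^sub>1 \<nu>\<^sub>1 :: "'a \<Rightarrow> real"
    and D :: "('a \<times> 'b, 'e \<times> 'f) one_form \<Rightarrow> ('a \<times> 'b, 'e \<times> 'f) one_form \<Rightarrow>
              ('a \<times> 'b, 'e \<times> 'f) one_form"
    and U\<^sub>1 :: "'a set" and U\<^sub>2 :: "'b set"
    and dx :: "nat \<Rightarrow> ('a, 'e) one_form" and dy :: "nat \<Rightarrow> ('b, 'f) one_form"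
  defines "M \<equiv> prod_manifold M\<^sub>1 M\<^sub>2"
    and "P \<equiv> warped_bivector P\<^sub>1 P\<^sub>2 \<nu>\<^sub>1"
    and "G \<equiv> cometric (warped_metric M\<^sub>1 g\<^sub>1 M\<^sub>2 g\<^sub>2 f\<^sub>1)"
    and "F \<equiv> \<lambda>m :: 'a \<times> 'b. f\<^sub>1 (fst m)"
  defines "R \<equiv> curvature M P D"
    and "K \<equiv> sectional M G P D"
    and "NK \<equiv> null_sectional M G P D"
    and "dxh \<equiv> \<lambda>i. pullback_form M M\<^sub>1 fst (dx i)"
    and "dyv \<equiv> \<lambda>i. pullback_form M M\<^sub>2 snd (dy i)"
  defines "fdyv \<equiv> \<lambda>i m. F m *\<^sub>R dyv i m"
    and "\<epsilon>\<^sub>1 \<equiv> \<lambda>l (m :: 'a \<times> 'b). cometric g\<^sub>1 (fst m) (dx l (fst m)) (dx l (fst m))"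
    and "\<epsilon>\<^sub>2 \<equiv> \<lambda>l (m :: 'a \<times> 'b). cometric g\<^sub>2 (snd m) (dy l (snd m)) (dy l (snd m))"
  assumes poisson: "poisson_manifold M\<^sub>1 P\<^sub>1" "poisson_manifold M\<^sub>2 P\<^sub>2"
    and metric: "semi_riemannian M\<^sub>1 g\<^sub>1 q\<^sub>1" "semi_riemannian M\<^sub>2 g\<^sub>2 q\<^sub>2"
    and warping: "smooth_fun M\<^sub>1 (points M\<^sub>1) f\<^sub>1" "\<And>p. p \<in> points M\<^sub>1 \<Longrightarrow> f\<^sub>1 p > 0"
    and nu: "smooth_fun M\<^sub>1 (points M\<^sub>1) \<nu>\<^sub>1"
    and connection: "levi_civita M G P D"
    and frames: "orthonormal_coframe M\<^sub>1 g\<^sub>1 q\<^sub>1 U\<^sub>1 dx" "orthonormal_coframe M\<^sub>2 g\<^sub>2 q\<^sub>2 U\<^sub>2 dy"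
  shows
    "\<forall>m \<in> U\<^sub>1 \<times> U\<^sub>2.
      (\<forall>i \<in> {1..q\<^sub>1}. \<forall>s \<in> {q\<^sub>1 + 1..DIM('e)}.
        (\<forall>l \<in> {1..DIM('e)} - {i, s}.
          NK (null_form (dxh i) (dxh s)) (dxh l) m =
            - (1/2) * K (dxh i) (dxh l) m + (1/2) * K (dxh s) (dxh l) m
            + \<epsilon>\<^sub>1 l m * G m (R (dxh i) (dxh l) (dxh l) m) (dxh s m)) \<and>
        (\<forall>l \<in> {1..DIM('f)}.
          NK (null_form (dxh i) (dxh s)) (fdyv l) m =
            - (1/2) * K (dxh i) (dyv l) m + (1/2) * K (dxh s) (dyv l) m
            + \<epsilon>\<^sub>2 l m * (F m)^2 * G m (R (dxh i) (dyv l) (dyv l) m) (dxh s m))) \<and>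
      (\<forall>i \<in> {1..q\<^sub>1}. \<forall>s \<in> {q\<^sub>2 + 1..DIM('f)}.
        (\<forall>l \<in> {1..DIM('e)} - {i}.
          NK (null_form (dxh i) (fdyv s)) (dxh l) m =
            - (1/2) * K (dxh i) (dxh l) m + (1/2) * K (dyv s) (dxh l) m
            + \<epsilon>\<^sub>1 l m * F m * G m (R (dxh i) (dxh l) (dxh l) m) (dyv s m)) \<and>
        (\<forall>l \<in> {1..DIM('f)} - {s}. poisson_manifold M P \<longrightarrow>
          NK (null_form (dxh i) (fdyv s)) (fdyv l) m =
            - (1/2) * K (dxh i) (dyv l) m + (1/2) * K (dyv s) (dyv l) m
            + \<epsilon>\<^sub>2 l m * (F m)^3 * G m (R (dxh i) (dyv l) (dyv l) m) (dyv s m))) \<and>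
      (\<forall>i \<in> {1..q\<^sub>2}. \<forall>s \<in> {q\<^sub>1 + 1..DIM('e)}.
        (\<forall>l \<in> {1..DIM('e)} - {s}.
          NK (null_form (fdyv i) (dxh s)) (dxh l) m =
            (1/2) * K (dxh s) (dxh l) m - (1/2) * K (dyv i) (dxh l) m
            + \<epsilon>\<^sub>1 l m * F m * G m (R (dxh s) (dxh l) (dxh l) m) (dyv i m)) \<and>
        (\<forall>l \<in> {1..DIM('f)} - {i}. poisson_manifold M P \<longrightarrow>
          NK (null_form (fdyv i) (dxh s)) (fdyv l) m =
            (1/2) * K (dxh s) (dyv l) m - (1/2) * K (dyv i) (dyv l) m
            + \<epsilon>\<^sub>2 l m * (F m)^3 * G m (R (dxh s) (dyv l) (dyv l) m) (dyv i m))) \<and>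
      (\<forall>i \<in> {1..q\<^sub>2}. \<forall>s \<in> {q\<^sub>2 + 1..DIM('f)}.
        (\<forall>l \<in> {1..DIM('e)}. poisson_manifold M P \<longrightarrow>
          NK (null_form (fdyv i) (fdyv s)) (dxh l) m =
            - (1/2) * K (dyv i) (dxh l) m + (1/2) * K (dyv s) (dxh l) m
            + \<epsilon>\<^sub>1 l m * (F m)^2 * G m (R (dyv i) (dxh l) (dxh l) m) (dyv s m)) \<and>
        (\<forall>l \<in> {1..DIM('f)} - {i, s}. poisson_manifold M P \<longrightarrow>
          NK (null_form (fdyv i) (fdyv s)) (fdyv l) m =
            - (1/2) * K (dyv i) (dyv l) m + (1/2) * K (dyv s) (dyv l) m
            + \<epsilon>\<^sub>2 l m * (F m)^4 * G m (R (dyv i) (dyv l) (dyv l) m) (dyv s m)))"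
proof -
  interpret warped_frame M\<^sub>1 M\<^sub>2 P\<^sub>1 P\<^sub>2 g\<^sub>1 g\<^sub>2 q\<^sub>1 q\<^sub>2 f\<^sub>1 \<nu>\<^sub>1 D U\<^sub>1 U\<^sub>2 dx dy
    by unfold_locales (use poisson metric warping nu connection frames in \<open>simp_all add: M_def P_def G_def\<close>)
  show ?thesis
    unfolding M_def P_def G_def F_def R_def K_def NK_def dxh_def dyv_def fdyv_def \<epsilon>\<^sub>1_def \<epsilon>\<^sub>2_def
    by (intro ballI conjI impI null_hh_h null_hh_v null_hv_h null_hv_v null_vh_h null_vh_v null_vv_h null_vv_v)
qed

end
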